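(* Let $s>1$ and let $\{\psi_{l,n}\}_{l\in\mathbb{N}_0^d,\,n\in\mathbb{Z}^d}$ be a Wilson basis of exponential decay of $L^2(\mathbb{R}^d)$. a) Every $f\in\mathcal{S}_s'(\mathbb{R}^d)$ (respectively $f\in\Sigma_s'(\mathbb{R}^d)$) has a unique expansion $$f=\sum_{l\in\mathbb{N}_0^d,\,n\in\mathbb{Z}^d}\langle f,\psi_{l,n}\rangle\,\psi_{l,n}$$ in $\mathcal{S}_s'(\mathbb{R}^d)$ (respectively in $\Sigma_s'(\mathbb{R}^d)$), and, with $c_{l,n}=\langle f,\psi_{l,n}\rangle$, $$\sum_{l\in\mathbb{N}_0^d,\,n\in\mathbb{Z}^d}|c_{l,n}|^2e^{-2h(|n/2|+|l|)^{1/s}}<\infty$$ for every $h>0$ (respectively for some $h>0$). b) Conversely, if $(c_{l,n})_{l\in\mathbb{N}_0^d,\,n\in\mathbb{Z}^d}$ is a sequence of complex numbers such that $$\sum_{l\in\mathbb{N}_0^d,\,n\in\mathbb{Z}^d}|c_{l,n}|^2e^{-2h(|n/2|+|l|)^{1/s}}<\infty$$ for every $h>0$ (respectively for some $h>0$), then there exists $f\in\mathcal{S}_s'(\mathbb{R}^d)$ (respectively $f\in\Sigma_s'(\mathbb{R}^d)$) such that $$f=\sum_{l\in\mathbb{N}_0^d,\,n\in\mathbb{Z}^d}c_{l,n}\,\psi_{l,n}$$ in $\mathcal{S}_s'(\mathbb{R}^d)$ (respectively in $\Sigma_s'(\mathbb{R}^d)$).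
   Context: Notation: $\mathbb{N}_0=\{0,1,2,\dots\}$; $|\cdot|$ is the Euclidean norm; $\hat f(\xi)=\int_{\mathbb{R}^d}e^{-2\pi i\xi x}f(x)\,dx$. Gelfand–Shilov spaces: for $s>0$, $h>0$ and $f\in C^\infty(\mathbb{R}^d)$ put $$\|f\|_{\mathcal{S}_{s,h}}=\sup_{\alpha,\beta\in\mathbb{N}_0^d}\ \sup_{x\in\mathbb{R}^d}\frac{|x^\alpha\partial^\beta f(x)|}{h^{|\alpha+\beta|}(\alpha!\,\beta!)^s}.$$ $\mathcal{S}_s(\mathbb{R}^d)$ (Roumieu type) is the set of $f\in C^\infty(\mathbb{R}^d)$ with $\|f\|_{\mathcal{S}_{s,h}}<\infty$ for some $h>0$, with the inductive limit topology; $\Sigma_s(\mathbb{R}^d)$ (Beurling type) is the set of $f\in C^\infty(\mathbb{R}^d)$ with $\|f\|_{\mathcal{S}_{s,h}}<\infty$ for every $h>0$, with the projective limit topology. $\mathcal{S}_s'(\mathbb{R}^d)$ and $\Sigma_s'(\mathbb{R}^d)$ are their dual spaces (tempered ultradistributions). The pairing $\langle f,\phi\rangle$ of an ultradistribution $f$ with a test function $\phi$ is the one extending the scalar product $\langle f,g\rangle=\int_{\mathbb{R}^d}f(x)\overline{g(x)}\,dx$ of $L^2(\mathbb{R}^d)$ (linear in the first, conjugate-linear in the second argument). Wilson basis of exponential decay: in dimension one, let $\psi:\mathbb{R}\to\mathbb{R}$ satisfy, for some constants $a,b,C>0$, $|\psi(x)|\le Ce^{-a|x|}$ and $|\hat\psi(\xi)|\le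 Ce^{-b|\xi|}$ for all $x,\xi\in\mathbb{R}$, and be such that the functions, for $l\in\mathbb{N}_0$, $n\in\mathbb{Z}$, $$\psi_{0,n}(x)=\psi(x-n),\qquad \psi_{l,n}(x)=\begin{cases}\sqrt2\cos(2\pi lx)\,\psi(x-\tfrac n2), & l\neq0,\ l+n \text{ even},\\ \sqrt2\sin(2\pi lx)\,\psi(x-\tfrac n2), & l\ne0,\ l+n\text{ odd},\end{cases}$$ form an orthonormal basis of $L^2(\mathbb{R})$. In dimension $d$, the Wilson basis is the tensor product orthonormal basis of $L^2(\mathbb{R}^d)$ given by $\psi_{l,n}(x)=\psi_{l_1,n_1}(x_1)\cdots\psi_{l_d,n_d}(x_d)$ for $l=(l_1,\dots,l_d)\in\mathbb{N}_0^d$, $n=(n_1,\dots,n_d)\in\mathbb{Z}^d$. Its elements belong to $\mathcal{S}_1(\mathbb{R}^d)\subset\Sigma_s(\mathbb{R}^d)\subset\mathcal{S}_s(\mathbb{R}^d)$ for $s>1$, so the pairings $\langle f,\psi_{l,n}\rangle$ are defined. *)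

theory Defs
  imports "HOL-Analysis.Analysis"
begin

section \<open>Locally convex spaces of complex-valued functions\<close>

definition seminorm_on :: "('x \<Rightarrow> complex) set \<Rightarrow> (('x \<Rightarrow> complex) \<Rightarrow> real) \<Rightarrow> bool" where
  "seminorm_on V p \<longleftrightarrow>
     (\<forall>f\<in>V. 0 \<le> p f) \<and>
     (\<forall>f\<in>V. \<forall>c. p (\<lambda>x. c * f x) = norm c * p f) \<and>
     (\<forall>f\<in>V. \<forall>g\<in>V. p (\<lambda>x. f x + g x) \<le> p f + p g)"

definition seminorm_topology ::
    "('x \<Rightarrow> complex) set \<Rightarrow> (('x \<Rightarrow> complex) \<Rightarrow> real) set \<Rightarrow> ('x \<Rightarrow> complex) topology" where
  "seminorm_topology V P =
     topology_generated_by {{g\<in>V. p (\<lambda>x. g x - f x) < e} | p f e. p \<in> P \<and> f \<in> V \<and> 0 < e}"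

text \<open>Boundedness in the sense of von Neumann: absorbed by every neighbourhood of zero.\<close>

definition vn_bounded :: "('x \<Rightarrow> complex) topology \<Rightarrow> ('x \<Rightarrow> complex) set \<Rightarrow> bool" where
  "vn_bounded T B \<longleftrightarrow> B \<subseteq> topspace T \<and>
     (\<forall>U. openin T U \<and> (\<lambda>x. 0) \<in> U \<longrightarrow> (\<exists>r>0::real. \<forall>f\<in>B. (\<lambda>x. f x / of_real r) \<in> U))"

text \<open>The dual consists of the continuous linear functionals. Functionals are made
  extensional, so that two of them are equal as soon as they agree on the space.\<close>

definition dual_space :: "('x \<Rightarrow> complex) topology \<Rightarrow> (('x \<Rightarrow> complex) \<Rightarrow> complex) set" where
  "dual_space T = {u \<in> extensional (topspace T).
     (\<forall>f\<in>topspace T. \<forall>g\<in>topspace T. u (\<lambda>x. f x + g x) = u f + u g) \<and>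
     (\<forall>f\<in>topspace T. \<forall>c. u (\<lambda>x. c * f x) = c * u f) \<and>
     continuous_map T euclidean u}"

text \<open>The dual carries the strong topology, i.e. uniform convergence on bounded sets.\<close>

definition strong_dual :: "('x \<Rightarrow> complex) topology \<Rightarrow> (('x \<Rightarrow> complex) \<Rightarrow> complex) topology" where
  "strong_dual T = seminorm_topology (dual_space T)
     {(\<lambda>u. SUP \<phi>\<in>B. norm (u \<phi>)) | B. vn_bounded T B \<and> B \<noteq> {}}"


section \<open>Gelfand-Shilov spaces\<close>

definition partial_deriv :: "'d::finite \<Rightarrow> (real^'d \<Rightarrow> complex) \<Rightarrow> real^'d \<Rightarrow> complex" where
  "partial_deriv i f x = vector_derivative (\<lambda>t. f (x + t *\<^sub>R axis i 1)) (at 0)"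

primrec iter_deriv :: "'d::finite list \<Rightarrow> (real^'d \<Rightarrow> complex) \<Rightarrow> real^'d \<Rightarrow> complex" where
  "iter_deriv [] f = f"
| "iter_deriv (i # is) f = partial_deriv i (iter_deriv is f)"

definition smooth :: "(real^'d::finite \<Rightarrow> complex) \<Rightarrow> bool" where
  "smooth f \<longleftrightarrow> (\<forall>is. continuous_on UNIV (iter_deriv is f) \<and>
     (\<forall>i x. (\<lambda>t::real. iter_deriv is f (x + t *\<^sub>R axis i 1)) differentiable (at 0)))"

text \<open>The derivative of multi-index \<open>\<beta>\<close>. The order of differentiation is an arbitrary fixed
  one; it is irrelevant for the smooth functions considered below.\<close>

definition multi_deriv :: "nat^'d::finite \<Rightarrow> (real^'d \<Rightarrow> complex) \<Rightarrow> real^'d \<Rightarrow> complex" where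
  "multi_deriv \<beta> = iter_deriv (SOME is. \<forall>i. count_list is i = \<beta> $ i)"

text \<open>The exponent of \<open>h\<close> is the length of the multi-index \<open>\<alpha> + \<beta>\<close>, not its Euclidean norm.\<close>

definition gs_norm :: "real \<Rightarrow> real \<Rightarrow> (real^'d::finite \<Rightarrow> complex) \<Rightarrow> ennreal" where
  "gs_norm s h f = (SUP \<alpha>::nat^'d. SUP \<beta>::nat^'d. SUP x.
     ennreal (norm (of_real (\<Prod>i\<in>UNIV. x $ i ^ (\<alpha> $ i)) * multi_deriv \<beta> f x) /
       (h ^ (\<Sum>i\<in>UNIV. \<alpha> $ i + \<beta> $ i) *
        ((\<Prod>i\<in>UNIV. fact (\<alpha> $ i)) * (\<Prod>i\<in>UNIV. fact (\<beta> $ i))) powr s)))"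

definition gs_step :: "real \<Rightarrow> real \<Rightarrow> (real^'d::finite \<Rightarrow> complex) set" where
  "gs_step s h = {f. smooth f \<and> gs_norm s h f < \<infinity>}"

definition gs_roumieu :: "real \<Rightarrow> (real^'d::finite \<Rightarrow> complex) set" where
  "gs_roumieu s = {f. smooth f \<and> (\<exists>h>0. gs_norm s h f < \<infinity>)}"

definition gs_beurling :: "real \<Rightarrow> (real^'d::finite \<Rightarrow> complex) set" where
  "gs_beurling s = {f. smooth f \<and> (\<forall>h>0. gs_norm s h f < \<infinity>)}"

text \<open>The locally convex inductive limit topology is the finest locally convex topology for
  which the inclusions of all steps are continuous; it is generated by all seminorms whose
  restriction to each step is continuous.\<close>

definition roumieu_topology :: "real \<Rightarrow> (real^'d::finite \<Rightarrow> complex) topology" where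
  "roumieu_topology s = seminorm_topology (gs_roumieu s)
     {p. seminorm_on (gs_roumieu s) p \<and>
         (\<forall>h>0. \<exists>C. \<forall>f\<in>gs_step s h. p f \<le> C * enn2real (gs_norm s h f))}"

definition beurling_topology :: "real \<Rightarrow> (real^'d::finite \<Rightarrow> complex) topology" where
  "beurling_topology s = seminorm_topology (gs_beurling s) {(\<lambda>f. enn2real (gs_norm s h f)) | h. h > 0}"

lemma topspace_seminorm_topology:
  assumes "p \<in> P" and "\<And>f. f \<in> V \<Longrightarrow> p (\<lambda>x. f x - f x) \<le> 0"
  shows "topspace (seminorm_topology V P) = V"
proof -
  have "f \<in> topspace (seminorm_topology V P)" if "f \<in> V" for f
  proof -
    have "p (\<lambda>x. f x - f x) < 1" using assms(2)[OF that] by linarith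
    then have "f \<in> {g\<in>V. p (\<lambda>x. g x - f x) < 1}" using that by blast
    moreover have "{g\<in>V. p (\<lambda>x. g x - f x) < 1} \<in>
        {{g\<in>V. p (\<lambda>x. g x - f x) < e} | p f e. p \<in> P \<and> f \<in> V \<and> 0 < e}"
      using assms(1) that zero_less_one by blast
    ultimately show ?thesis
      unfolding seminorm_topology_def topology_generated_by_topspace by blast
  qed
  then show ?thesis
    unfolding seminorm_topology_def topology_generated_by_topspace by blast
qed

lemma topspace_roumieu_topology: "topspace (roumieu_topology s) = gs_roumieu s"
  unfolding roumieu_topology_def
  by (rule topspace_seminorm_topology[where p = "\<lambda>f. 0"])
     (auto simp: seminorm_on_def intro!: exI[of _ 0])

lemma iter_deriv_zero: "iter_deriv is (\<lambda>x. 0) = (\<lambda>x. 0)"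
  by (induction "is") (auto simp: partial_deriv_def fun_eq_iff)

lemma gs_norm_zero: "gs_norm s h (\<lambda>x. 0) = 0"
  by (simp add: gs_norm_def multi_deriv_def iter_deriv_zero)

lemma topspace_beurling_topology: "topspace (beurling_topology s) = gs_beurling s"
  unfolding beurling_topology_def
proof (rule topspace_seminorm_topology)
  show "(\<lambda>f. enn2real (gs_norm s 1 f)) \<in> {(\<lambda>f. enn2real (gs_norm s h f)) | h. h > 0}"
    using zero_less_one by blast
qed (simp add: gs_norm_zero)


section \<open>Ultradistributions\<close>

text \<open>An element of the dual acts linearly on test functions. The pairing is conjugate-linear
  in the test function; with the identification of a function \<open>g\<close> with \<open>\<phi> \<mapsto> \<integral> g \<phi>\<close> it extends
  the scalar product \<open>\<integral> g (cnj \<phi>)\<close> of \<open>L\<^sup>2\<close>.\<close>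

definition pairing :: "(('x \<Rightarrow> complex) \<Rightarrow> complex) \<Rightarrow> ('x \<Rightarrow> complex) \<Rightarrow> complex" where
  "pairing u \<phi> = u (\<lambda>x. cnj (\<phi> x))"

definition as_functional ::
    "(real^'d::finite \<Rightarrow> complex) topology \<Rightarrow> (real^'d \<Rightarrow> complex) \<Rightarrow> (real^'d \<Rightarrow> complex) \<Rightarrow> complex" where
  "as_functional T g = (\<lambda>\<phi>\<in>topspace T. LINT x|lborel. g x * \<phi> x)"


section \<open>Wilson bases of exponential decay\<close>

definition square_integrable :: "('a::euclidean_space \<Rightarrow> complex) \<Rightarrow> bool" where
  "square_integrable f \<longleftrightarrow> f \<in> borel_measurable lborel \<and> integrable lborel (\<lambda>x. (norm (f x))\<^sup>2)"

definition orthonormal_basis_L2 :: "('i \<Rightarrow> 'a::euclidean_space \<Rightarrow> complex) \<Rightarrow> bool" where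
  "orthonormal_basis_L2 e \<longleftrightarrow>
     (\<forall>i. square_integrable (e i)) \<and>
     (\<forall>i j. (LINT x|lborel. e i x * cnj (e j x)) = (if i = j then 1 else 0)) \<and>
     (\<forall>f. square_integrable f \<longrightarrow> (\<forall>\<epsilon>>0. \<exists>F c. finite F \<and>
        (LINT x|lborel. (norm (f x - (\<Sum>i\<in>F. c i * e i x)))\<^sup>2) < \<epsilon>))"

definition fourier :: "(real \<Rightarrow> complex) \<Rightarrow> real \<Rightarrow> complex" where
  "fourier f \<xi> = (LINT x|lborel. exp (- 2 * of_real pi * \<i> * of_real \<xi> * of_real x) * f x)"

definition wilson1 :: "(real \<Rightarrow> real) \<Rightarrow> nat \<Rightarrow> int \<Rightarrow> real \<Rightarrow> real" where
  "wilson1 \<psi> l n x =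
     (if l = 0 then \<psi> (x - of_int n)
      else if even (int l + n) then sqrt 2 * cos (2 * pi * real l * x) * \<psi> (x - of_int n / 2)
      else sqrt 2 * sin (2 * pi * real l * x) * \<psi> (x - of_int n / 2))"

text \<open>The decay of \<open>\<psi>\<close> and of its Fourier transform make \<open>\<psi>\<close> equal almost everywhere to
  an analytic function. Continuity selects this representative, without which the basis
  functions would not be test functions.\<close>

definition wilson_window :: "(real \<Rightarrow> real) \<Rightarrow> bool" where
  "wilson_window \<psi> \<longleftrightarrow>
     continuous_on UNIV \<psi> \<and>
     (\<exists>a b C. a > 0 \<and> b > 0 \<and> C > 0 \<and>
        (\<forall>x. \<bar>\<psi> x\<bar> \<le> C * exp (- a * \<bar>x\<bar>)) \<and>
        (\<forall>\<xi>. norm (fourier (\<lambda>x. of_real (\<psi> x)) \<xi>) \<le> C * exp (- b * \<bar>\<xi>\<bar>))) \<and>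
     orthonormal_basis_L2 (\<lambda>(l, n) x. of_real (wilson1 \<psi> l n x))"

definition wilson :: "(real \<Rightarrow> real) \<Rightarrow> (nat^'d) \<times> (int^'d) \<Rightarrow> real^'d::finite \<Rightarrow> complex" where
  "wilson \<psi> = (\<lambda>(l, n) x. of_real (\<Prod>i\<in>UNIV. wilson1 \<psi> (l $ i) (n $ i) (x $ i)))"

text \<open>\<open>u = \<Sum>c\<^sub>k \<psi>\<^sub>k\<close> in the dual of \<open>T\<close>: the net of all finite partial sums
  converges to \<open>u\<close> strongly.\<close>

definition wilson_expansion ::
    "(real^'d::finite \<Rightarrow> complex) topology \<Rightarrow> (real \<Rightarrow> real) \<Rightarrow> ((nat^'d) \<times> (int^'d) \<Rightarrow> complex) \<Rightarrow>
     ((real^'d \<Rightarrow> complex) \<Rightarrow> complex) \<Rightarrow> bool" where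
  "wilson_expansion T \<psi> c u \<longleftrightarrow>
     limitin (strong_dual T)
       (\<lambda>F. \<lambda>\<phi>\<in>topspace T. \<Sum>k\<in>F. c k * as_functional T (wilson \<psi> k) \<phi>)
       u (finite_subsets_at_top UNIV)"

definition weighted_summable :: "real \<Rightarrow> real \<Rightarrow> ((nat^'d) \<times> (int^'d) \<Rightarrow> complex) \<Rightarrow> bool" where
  "weighted_summable s h c \<longleftrightarrow>
     (\<lambda>(l, n). (norm (c (l, n)))\<^sup>2 *
        exp (- 2 * h * (norm (\<chi> i. of_int (n $ i) / 2 :: real^'d) +
                        norm (\<chi> i. of_nat (l $ i) :: real^'d)) powr (1 / s)))
     summable_on (UNIV :: ((nat^'d::finite) \<times> (int^'d)) set)"

end

theory Submission
  imports Defs "HOL-Probability.Characteristic_Functions" "HOL-Probability.Sinc_Integral"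
    "HOL-Complex_Analysis.Conformal_Mappings"
begin

text \<open>
Write \<open>\<rho>(k) = |n/2| + |l|\<close> for an index \<open>k = (l, n)\<close>. The theorem rests on two estimates that mirror each other:
the norms of the basis functions grow at most like \<open>exp (\<kappa> (\<rho>(k)/h)^(1/s))\<close> (lemma \<open>gs_norm_wilson\<close>), and the
coefficients \<open>\<integral> \<psi>\<^sub>k f\<close> of a test function with finite norm for the parameter \<open>h\<close> decay at least like
\<open>exp (- \<kappa>' (\<rho>(k)/h)^(1/s))\<close> (lemma \<open>coef_decay\<close>), where \<open>\<kappa>\<close> and \<open>\<kappa>'\<close> do not depend on \<open>h\<close>. So the rate is tuned by \<open>h\<close>,
and the quantifiers "some \<open>h\<close>" and "every \<open>h\<close>" for test functions become "every rate" and "some rate" for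
functionals.

Both estimates come from a property of the window alone (lemma \<open>window_derivatives\<close>). By Fourier inversion \<open>\<psi>\<close> extends to a
bounded holomorphic function on a strip around the real line; a Phragmen-Lindelof argument carries its exponential
decay into a thinner strip; Cauchy's estimates yield \<open>|\<psi>^(m)(x)| \<le> K A^m m! exp (- c |x|)\<close>. For \<open>s > 1\<close> such analytic
growth is smaller than \<open>q^m m!^s\<close> for every \<open>q > 0\<close>, up to a constant, which gives the first estimate. For the second one, a
moment of order \<open>m\<close> in the position is split between \<open>f\<close> and the localised basis function, and \<open>m\<close> integrations by parts
against the cosine produce the corresponding power of the frequency. Bounds \<open>q^m m!^s\<close> for all \<open>m\<close> are the same as
stretched exponential decay (lemma \<open>gevrey_decay\<close>).

If the coefficients of a test function \<open>\<phi>\<close> decay faster than the norms grow, the series \<open>\<Sum> (\<integral> \<psi>\<^sub>k \<phi>) \<psi>\<^sub>k\<close> converges absolutely in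
the norm. The difference of \<open>\<phi>\<close> and the sum is continuous, rapidly decreasing and orthogonal to the basis, hence zero by
completeness (lemma \<open>wilson_expansion_test_function\<close>).

Now let \<open>f\<close> be a continuous functional. It is bounded by the norms, in the Roumieu case by all of them and in the
Beurling case by one, so the values \<open>f(\<psi>\<^sub>k)\<close> inherit the growth of the norms of \<open>\<psi>\<^sub>k\<close>, at every rate respectively at some rate.
Applying \<open>f\<close> to the expansion of \<open>\<phi>\<close> gives \<open>f(\<phi>) = \<Sum> f(\<psi>\<^sub>k) \<integral> \<psi>\<^sub>k \<phi>\<close> (lemma \<open>dual_element_eq_series\<close>). Conversely, coefficients \<open>c\<^sub>k\<close>
with that growth define a functional by \<open>\<phi> \<mapsto> \<Sum> c\<^sub>k \<integral> \<psi>\<^sub>k \<phi>\<close>. The convergence is uniform on bounded sets because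
\<open>\<phi> \<mapsto> \<Sum> (1 + \<rho>(k)) |c\<^sub>k| |\<integral> \<psi>\<^sub>k \<phi>|\<close> is dominated by a continuous seminorm, hence bounded on a bounded set, and dominates the
tail over \<open>\<rho>(k) > r\<close> with the factor \<open>1 / (1 + r)\<close> (lemma \<open>wilson_series_in_dual\<close>). Testing with \<open>\<psi>\<^sub>j\<close> shows that the
coefficients are unique (lemma \<open>wilson_expansion_unique\<close>).
\<close>

section \<open>Powers, factorials and stretched exponentials\<close>

text \<open>With \<open>z = (y/q)^(1/s)\<close>, the single term \<open>z^m / m!\<close> of the exponential series is at most \<open>exp z\<close>;
raise this to the power \<open>s\<close>.\<close>

lemma power_le_gevrey:
  fixes y q s :: real
  assumes "y \<ge> 0" "q > 0" "s > 0"
  shows "y ^ m \<le> q ^ m * fact m powr s * exp (s * (y / q) powr (1 / s))"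
proof (cases "y = 0")
  case True
  then show ?thesis using assms by (cases m) auto
next
  case False
  define z where "z = (y / q) powr (1 / s)"
  have z: "z > 0" using False assms by (simp add: z_def)
  have zs: "z powr s = y / q" using False assms by (simp add: z_def powr_powr)
  have "z ^ m / fact m \<le> exp z"
  proof -
    have "(\<Sum>n\<in>{m}. inverse (fact n) * z ^ n) \<le> (\<Sum>n. inverse (fact n) * z ^ n)"
      using z by (intro sum_le_suminf summable_exp) auto
    also have "\<dots> = exp z" by (simp add: exp_def scaleR_conv_of_real divide_inverse)
    finally show ?thesis by (simp add: divide_inverse mult.commute)
  qed
  then have "(z ^ m / fact m) powr s \<le> exp z powr s"
    using z assms by (intro powr_mono2) auto
  moreover have "(z ^ m / fact m) powr s = (y / q) ^ m / fact m powr s"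
    using z by (simp add: powr_divide zs[symmetric]) (simp add: powr_realpow[symmetric] powr_powr mult.commute)
  moreover have "exp z powr s = exp (s * z)" by (simp add: powr_def)
  ultimately have "(y / q) ^ m / fact m powr s \<le> exp (s * z)" by simp
  then show ?thesis using assms by (simp add: power_divide z_def field_simps)
qed

text \<open>The converse direction: moment bounds of Gevrey type for all \<open>m\<close> amount to stretched exponential
decay. The \<open>s\<close>-th roots of the hypotheses are bounds on the terms of the exponential series of
\<open>(y/q)^(1/s)\<close>.\<close>

lemma gevrey_decay:
  fixes y q s A K :: real
  assumes "y \<ge> 0" "q > 0" "s > 0" "A \<ge> 0"
    and le: "\<And>m. y ^ m * A \<le> K * q ^ m * fact m powr s"
  shows "A \<le> 2 powr s * K * exp (- (s / 2) * (y / q) powr (1 / s))"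
proof -
  have K: "K \<ge> A" using le[of 0] by simp
  define z where "z = (y / q) powr (1 / s)"
  have z0: "z \<ge> 0" by (simp add: z_def)
  have zs: "z powr s = y / q" using assms by (cases "y = 0") (simp_all add: z_def powr_powr)
  have *: "(z / 2) ^ m /\<^sub>R fact m * A powr (1/s) \<le> K powr (1/s) * (1/2)^m" for m
  proof -
    have "(z ^ m / fact m) powr s * A \<le> K"
    proof (cases "y = 0")
      case True
      then show ?thesis using K assms by (cases m) (auto simp: z_def)
    next
      case False
      then have z: "z > 0" using assms by (simp add: z_def)
      have "(z ^ m / fact m) powr s = (y / q) ^ m / fact m powr s"
        using z by (simp add: powr_divide zs[symmetric]) (simp add: powr_realpow[symmetric] powr_powr mult.commute)
      also have "\<dots> * A = y ^ m * A / (q ^ m * fact m powr s)" by (simp add: power_divide)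
      also have "\<dots> \<le> K" using le[of m] assms by (subst pos_divide_le_eq) (auto simp: mult_ac)
      finally show ?thesis .
    qed
    then have "((z ^ m / fact m) powr s * A) powr (1/s) \<le> K powr (1/s)"
      using assms by (intro powr_mono2) auto
    moreover have "((z ^ m / fact m) powr s * A) powr (1/s) = z ^ m / fact m * A powr (1/s)"
      using z0 assms by (simp add: powr_mult powr_powr)
    ultimately have "z ^ m / fact m * A powr (1/s) \<le> K powr (1/s)" by simp
    then have "z ^ m / fact m * A powr (1/s) * (1/2)^m \<le> K powr (1/s) * (1/2)^m"
      by (intro mult_right_mono) auto
    then show ?thesis by (simp add: power_divide field_simps)
  qed
  \<comment> \<open>The factors \<open>(1/2)^m\<close> make both sides summable; the left one becomes \<open>exp (z/2)\<close>.\<close>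
  have "(\<Sum>m. (z / 2) ^ m /\<^sub>R fact m * A powr (1/s)) \<le> (\<Sum>m. K powr (1/s) * (1/2::real)^m)"
  proof (intro suminf_le *)
    show "summable (\<lambda>m. (z / 2) ^ m /\<^sub>R fact m * A powr (1/s))"
      using summable_exp_generic[of "z/2"] by (rule summable_mult2)
    show "summable (\<lambda>m. K powr (1/s) * (1/2::real)^m)"
      by (intro summable_mult summable_geometric) auto
  qed
  moreover have "(\<Sum>m. (z / 2) ^ m /\<^sub>R fact m * A powr (1/s)) = exp (z/2) * A powr (1/s)"
    using suminf_mult2[OF summable_exp_generic[of "z/2"], of "A powr (1/s)"] by (simp add: exp_def)
  moreover have "(\<Sum>m. K powr (1/s) * (1/2::real)^m) = 2 * K powr (1/s)"
    by (subst suminf_mult) (auto simp: suminf_geometric)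
  ultimately have "exp (z/2) * A powr (1/s) \<le> 2 * K powr (1/s)" by simp
  then have "(exp (z/2) * A powr (1/s)) powr s \<le> (2 * K powr (1/s)) powr s"
    using assms by (intro powr_mono2) auto
  then have "exp (s * z / 2) * A \<le> 2 powr s * K"
    using assms K by (simp add: powr_mult powr_powr) (simp add: powr_def)
  then have "A \<le> 2 powr s * K * exp (- (s * z / 2))"
    by (simp add: exp_minus field_simps)
  then show ?thesis by (simp add: z_def)
qed

text \<open>This is where \<open>s > 1\<close> enters: the surplus \<open>m!^(s-1)\<close> absorbs every geometric factor, so that analytic
growth of derivatives is Gevrey growth of order \<open>s\<close> with an arbitrarily small constant \<open>q\<close>.\<close>

lemma analytic_le_gevrey:
  fixes B q s :: real
  assumes "B > 0" "q > 0" "s > 1"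
  obtains C where "C \<ge> 1" "\<And>m. B ^ m * fact m \<le> C * q ^ m * fact m powr s"
proof
  let ?C = "exp ((s - 1) * (B / q) powr (1 / (s - 1)))"
  show "?C \<ge> 1" using assms by auto
  fix m
  have "B ^ m * fact m \<le> q ^ m * fact m powr (s - 1) * ?C * fact m"
    using power_le_gevrey[of B q "s - 1" m] assms by (intro mult_right_mono) auto
  also have "fact m powr (s - 1) * fact m = fact m powr s" by (simp add: powr_diff)
  then have "q ^ m * fact m powr (s - 1) * ?C * fact m = ?C * q ^ m * fact m powr s"
    by (simp add: mult_ac)
  finally show "B ^ m * fact m \<le> ?C * q ^ m * fact m powr s" .
qed

section \<open>Topologies given by seminorms and their strong duals\<close>

lemma seminorm_on_triangle:
  "seminorm_on V p \<Longrightarrow> f \<in> V \<Longrightarrow> g \<in> V \<Longrightarrow> p (\<lambda>x. f x + g x) \<le> p f + p g"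
  unfolding seminorm_on_def by blast

text \<open>The balls that generate the topology are centred anywhere. By the triangle inequality every
neighbourhood of \<open>f0\<close> still contains a finite intersection of balls centred at \<open>f0\<close> itself.\<close>

lemma seminorm_topology_0:
  assumes sn: "\<And>p. p \<in> P \<Longrightarrow> seminorm_on V p"
    and Vs: "\<And>f c. f \<in> V \<Longrightarrow> (\<lambda>x. c * f x) \<in> V"
    and Va: "\<And>f g. f \<in> V \<Longrightarrow> g \<in> V \<Longrightarrow> (\<lambda>x. f x + g x) \<in> V"
    and U: "openin (seminorm_topology V P) U" and f0: "f0 \<in> U"
  shows "\<exists>Q d. finite Q \<and> Q \<subseteq> P \<and> d > 0 \<and> (\<forall>g\<in>V. (\<forall>p\<in>Q. p (\<lambda>x. g x - f0 x) < d) \<longrightarrow> g \<in> U)"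
proof -
  have Vm: "(\<lambda>x. f x - g x) \<in> V" if "f \<in> V" "g \<in> V" for f g
    using Va[OF that(1) Vs[OF that(2), of "-1"]] by simp
  let ?S = "{{g\<in>V. p (\<lambda>x. g x - f x) < e} | p f e. p \<in> P \<and> f \<in> V \<and> 0 < e}"
  have "generate_topology_on ?S U"
    using U unfolding seminorm_topology_def openin_topology_generated_by_iff .
  then show ?thesis using f0
  proof induction
    case Empty then show ?case by simp
  next
    case (Int a b)
    then obtain Q1 d1 Q2 d2 where *: "finite Q1" "Q1 \<subseteq> P" "d1 > 0" "\<forall>g\<in>V. (\<forall>p\<in>Q1. p (\<lambda>x. g x - f0 x) < d1) \<longrightarrow> g \<in> a"
      "finite Q2" "Q2 \<subseteq> P" "d2 > 0" "\<forall>g\<in>V. (\<forall>p\<in>Q2. p (\<lambda>x. g x - f0 x) < d2) \<longrightarrow> g \<in> b" by blast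
    have "g \<in> a \<inter> b" if "g \<in> V" "\<forall>p\<in>Q1 \<union> Q2. p (\<lambda>x. g x - f0 x) < min d1 d2" for g
    proof -
      have "\<forall>p\<in>Q1. p (\<lambda>x. g x - f0 x) < d1" "\<forall>p\<in>Q2. p (\<lambda>x. g x - f0 x) < d2" using that(2) by auto
      then show ?thesis using *(4,8) that(1) by blast
    qed
    note g = this
    show ?case
    proof (intro exI conjI ballI impI)
      show "finite (Q1 \<union> Q2)" "Q1 \<union> Q2 \<subseteq> P" "min d1 d2 > 0" using *(1,2,3,5,6,7) by auto
    qed (fact g)
  next
    case (UN K)
    then obtain k where k: "k \<in> K" "f0 \<in> k" by blast
    from UN.IH[OF this] obtain Q d where *: "finite Q" "Q \<subseteq> P" "d > 0"
      "\<forall>g\<in>V. (\<forall>p\<in>Q. p (\<lambda>x. g x - f0 x) < d) \<longrightarrow> g \<in> k" by blast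
    show ?case
    proof (intro exI conjI ballI impI)
      show "finite Q" "Q \<subseteq> P" "d > 0" by fact+
      show "g \<in> \<Union> K" if "g \<in> V" "\<forall>p\<in>Q. p (\<lambda>x. g x - f0 x) < d" for g
        using *(4) that k(1) by blast
    qed
  next
    case (Basis S)
    then obtain p f e where S: "S = {g\<in>V. p (\<lambda>x. g x - f x) < e}" "p \<in> P" "f \<in> V" "0 < e" by blast
    have f0: "f0 \<in> V" "p (\<lambda>x. f0 x - f x) < e" using Basis(2) S(1) by auto
    have "g \<in> S" if "g \<in> V" "p (\<lambda>x. g x - f0 x) < e - p (\<lambda>x. f0 x - f x)" for g
    proof -
      have "p (\<lambda>x. (g x - f0 x) + (f0 x - f x)) \<le> p (\<lambda>x. g x - f0 x) + p (\<lambda>x. f0 x - f x)"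
        by (rule seminorm_on_triangle[OF sn[OF S(2)] Vm[OF that(1) f0(1)] Vm[OF f0(1) S(3)]])
      then show ?thesis using that S(1) by auto
    qed
    note g = this
    show ?case
    proof (intro exI conjI ballI impI)
      show "finite {p}" "{p} \<subseteq> P" "e - p (\<lambda>x. f0 x - f x) > 0" using S f0 by auto
      show "g \<in> S" if "g \<in> V" "\<forall>q\<in>{p}. q (\<lambda>x. g x - f0 x) < e - p (\<lambda>x. f0 x - f x)" for g
        using that by (intro g) auto
    qed
  qed
qed

text \<open>Both spaces of test functions and their topologies are instances; duality is studied here once for both.\<close>

locale seminorm_space =
  fixes V :: "('x \<Rightarrow> complex) set" and P :: "(('x \<Rightarrow> complex) \<Rightarrow> real) set"
  assumes seminorm: "\<And>p. p \<in> P \<Longrightarrow> seminorm_on V p"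
    and nonempty: "P \<noteq> {}"
    and zero_mem: "(\<lambda>x. 0) \<in> V"
    and scale_mem: "\<And>f c. f \<in> V \<Longrightarrow> (\<lambda>x. c * f x) \<in> V"
    and add_mem: "\<And>f g. f \<in> V \<Longrightarrow> g \<in> V \<Longrightarrow> (\<lambda>x. f x + g x) \<in> V"
begin

abbreviation "T \<equiv> seminorm_topology V P"

lemma diff_mem: "f \<in> V \<Longrightarrow> g \<in> V \<Longrightarrow> (\<lambda>x. f x - g x) \<in> V"
  using add_mem[of f "\<lambda>x. -1 * g x"] scale_mem[of g "-1"] by simp

lemma seminorm_scale: "p \<in> P \<Longrightarrow> f \<in> V \<Longrightarrow> p (\<lambda>x. c * f x) = norm c * p f"
  using seminorm unfolding seminorm_on_def by blast

lemma seminorm_nonneg: "p \<in> P \<Longrightarrow> f \<in> V \<Longrightarrow> 0 \<le> p f"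
  using seminorm unfolding seminorm_on_def by blast

lemma seminorm_zero: "p \<in> P \<Longrightarrow> p (\<lambda>x. 0) = 0"
  using seminorm_scale[of p "\<lambda>x. 0" 0] zero_mem by simp

lemma topspace_eq: "topspace T = V"
proof -
  obtain p where "p \<in> P" using nonempty by blast
  then show ?thesis by (rule topspace_seminorm_topology) (simp add: seminorm_zero \<open>p \<in> P\<close>)
qed

lemma openin_ball: "p \<in> P \<Longrightarrow> f \<in> V \<Longrightarrow> 0 < e \<Longrightarrow> openin T {g\<in>V. p (\<lambda>x. g x - f x) < e}"
  unfolding seminorm_topology_def by (intro topology_generated_by_Basis) blast

text \<open>The unit ball of \<open>p\<close> is a neighbourhood of zero and absorbs \<open>B\<close>.\<close>

lemma bounded_seminorm:
  assumes "vn_bounded T B" "p \<in> P"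
  shows "\<exists>M. \<forall>f\<in>B. p f \<le> M"
proof -
  let ?U = "{g\<in>V. p (\<lambda>x. g x - 0) < 1}"
  have "openin T ?U" using openin_ball[OF assms(2) zero_mem, of 1] by simp
  moreover have "(\<lambda>x. 0) \<in> ?U" using zero_mem seminorm_zero[OF assms(2)] by simp
  ultimately obtain r :: real where r: "r > 0" "\<forall>f\<in>B. (\<lambda>x. f x / of_real r) \<in> ?U"
    using assms(1) unfolding vn_bounded_def by blast
  have "p f \<le> r" if "f \<in> B" for f
  proof -
    have fV: "f \<in> V" using assms(1) that topspace_eq unfolding vn_bounded_def by blast
    have "p (\<lambda>x. of_real (1/r) * f x) < 1" using r that by (auto simp: field_simps)
    then have "(1/r) * p f < 1" using seminorm_scale[OF assms(2) fV, of "of_real (1/r)"] r by (simp add: norm_divide)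
    then show ?thesis using r by (simp add: field_simps)
  qed
  then show ?thesis by blast
qed

text \<open>Continuity at zero gives \<open>|u f| < 1\<close> on a finite intersection of balls; homogeneity turns this into a
bound by the sum of the seminorms involved.\<close>

lemma dual_bound:
  assumes "u \<in> dual_space T"
  shows "\<exists>Q C. finite Q \<and> Q \<subseteq> P \<and> C > 0 \<and> (\<forall>f\<in>V. norm (u f) \<le> C * (\<Sum>p\<in>Q. p f))"
proof -
  have u: "continuous_map T euclidean u" "\<And>f c. f \<in> V \<Longrightarrow> u (\<lambda>x. c * f x) = c * u f"
    using assms topspace_eq unfolding dual_space_def by auto
  have u0: "u (\<lambda>x. 0) = 0" using u(2)[OF zero_mem, of 0] by simp
  have "openin T {f \<in> topspace T. u f \<in> ball 0 1}"
    by (rule openin_continuous_map_preimage[OF u(1)]) (auto simp: open_openin[symmetric])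
  moreover have "(\<lambda>x. 0) \<in> {f \<in> topspace T. u f \<in> ball 0 1}" using u0 zero_mem topspace_eq by simp
  ultimately have "\<exists>Q d. finite Q \<and> Q \<subseteq> P \<and> d > 0 \<and> (\<forall>g\<in>V. (\<forall>p\<in>Q. p (\<lambda>x. g x - 0) < d) \<longrightarrow>
      g \<in> {f \<in> topspace T. u f \<in> ball 0 1})"
    by (intro seminorm_topology_0[OF seminorm scale_mem add_mem])
  then obtain Q d where Q: "finite Q" "Q \<subseteq> P" "d > 0"
    "\<forall>g\<in>V. (\<forall>p\<in>Q. p (\<lambda>x. g x - 0) < d) \<longrightarrow> g \<in> {f \<in> topspace T. u f \<in> ball 0 1}" by blast
  then have Q4: "\<And>g. g \<in> V \<Longrightarrow> (\<And>p. p \<in> Q \<Longrightarrow> p g < d) \<Longrightarrow> norm (u g) < 1" by simp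
  have "norm (u f) \<le> (2 / d) * (\<Sum>p\<in>Q. p f)" if f: "f \<in> V" for f
  proof -
    let ?S = "\<Sum>p\<in>Q. p f"
    have nn: "?S \<ge> 0" using Q f by (intro sum_nonneg) (auto intro: seminorm_nonneg)
    have le: "p f \<le> ?S" if "p \<in> Q" for p
      using that Q f by (intro member_le_sum) (auto intro: seminorm_nonneg)
    show ?thesis
    proof (rule field_le_epsilon)
      fix e :: real assume e: "e > 0"
      \<comment> \<open>The term \<open>e\<close> keeps the scaling factor positive when all seminorms of \<open>f\<close> vanish.\<close>
      let ?t = "(2/d) * ?S + e"
      have t: "?t > 0" using nn e Q by (simp add: add_nonneg_pos)
      have "norm (u (\<lambda>x. of_real (1/?t) * f x)) < 1"
      proof -
        have "p (\<lambda>x. of_real (1/?t) * f x) < d" if "p \<in> Q" for p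
        proof -
          have "p (\<lambda>x. of_real (1/?t) * f x) = p f / ?t"
            using seminorm_scale[of p f "of_real (1/?t)"] that Q f t by (auto simp: norm_divide simp del: of_real_add of_real_mult of_real_divide)
          also have "\<dots> < d"
          proof -
            have "?t * d = 2 * ?S + e * d" using Q by (simp add: field_simps)
            moreover have "e * d > 0" using e Q by simp
            ultimately have "p f < ?t * d" using le[OF that] nn by linarith
            then show ?thesis using t by (simp add: pos_divide_less_eq mult.commute)
          qed
          finally show ?thesis .
        qed
        then show ?thesis by (intro Q4 scale_mem f)
      qed
      then have "norm (u f) / ?t < 1" using u(2)[OF f, of "of_real (1/?t)"] t
        by (simp add: norm_mult norm_divide del: of_real_add of_real_mult of_real_divide)
      then show "norm (u f) \<le> ?t" using t by (simp add: field_simps)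
    qed
  qed
  then show ?thesis using Q(1-3) by (intro exI[of _ Q] exI[of _ "2/d"]) auto
qed

lemma dual_bounded:
  assumes "u \<in> dual_space T" "vn_bounded T B"
  shows "bdd_above ((\<lambda>\<phi>. norm (u \<phi>)) ` B)"
proof -
  obtain Q C where Q: "finite Q" "Q \<subseteq> P" "C > 0" "\<forall>f\<in>V. norm (u f) \<le> C * (\<Sum>p\<in>Q. p f)"
    using dual_bound[OF assms(1)] by blast
  have "\<forall>p\<in>Q. \<exists>M. \<forall>f\<in>B. p f \<le> M" using bounded_seminorm assms(2) Q(2) by blast
  then obtain M where M: "\<forall>p\<in>Q. \<forall>f\<in>B. p f \<le> M p" by metis
  have BV: "B \<subseteq> V" using assms(2) topspace_eq unfolding vn_bounded_def by blast
  show ?thesis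
  proof (rule bdd_aboveI2)
    fix f assume f: "f \<in> B"
    have "norm (u f) \<le> C * (\<Sum>p\<in>Q. p f)" using Q BV f by blast
    also have "\<dots> \<le> C * (\<Sum>p\<in>Q. M p)" using Q M f by (intro mult_left_mono sum_mono) auto
    finally show "norm (u f) \<le> C * (\<Sum>p\<in>Q. M p)" .
  qed
qed

lemma in_dualI:
  assumes ext: "u \<in> extensional V"
    and add: "\<And>f g. f \<in> V \<Longrightarrow> g \<in> V \<Longrightarrow> u (\<lambda>x. f x + g x) = u f + u g"
    and scale: "\<And>f c. f \<in> V \<Longrightarrow> u (\<lambda>x. c * f x) = c * u f"
    and p: "p \<in> P" and bound: "\<And>f. f \<in> V \<Longrightarrow> norm (u f) \<le> C * p f"
  shows "u \<in> dual_space T"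
proof -
  define C' where "C' = max C 1"
  have C': "C' > 0" "C \<le> C'" by (auto simp: C'_def)
  have bound': "norm (u f) \<le> C' * p f" if "f \<in> V" for f
    using bound[OF that] mult_right_mono[OF C'(2) seminorm_nonneg[OF p that]] by linarith
  have "openin T {f \<in> V. u f \<in> W}" if W: "open W" for W
  proof (rule openin_subopen[THEN iffD2], rule ballI)
    fix f assume "f \<in> {f \<in> V. u f \<in> W}"
    then have f: "f \<in> V" "u f \<in> W" by auto
    obtain e where e: "e > 0" "ball (u f) e \<subseteq> W" using openE[OF W f(2)] by metis
    let ?N = "{g\<in>V. p (\<lambda>x. g x - f x) < e / C'}"
    have "g \<in> {f \<in> V. u f \<in> W}" if g: "g \<in> ?N" for g
    proof -
      have gV: "g \<in> V" using g by simp
      have "u g = u (\<lambda>x. (g x - f x) + f x)" by simp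
      also have "\<dots> = u (\<lambda>x. g x - f x) + u f" using add[OF diff_mem[OF gV f(1)] f(1)] .
      finally have "norm (u g - u f) \<le> C' * p (\<lambda>x. g x - f x)" using bound'[OF diff_mem[OF gV f(1)]] by simp
      also have "\<dots> < e" using g C' by (simp add: field_simps)
      finally show ?thesis using e gV by (auto simp: dist_norm norm_minus_commute)
    qed
    moreover have "f \<in> ?N" using f seminorm_zero[OF p] e C' by simp
    moreover have "openin T ?N" using openin_ball[OF p f(1), of "e / C'"] e C' by simp
    ultimately show "\<exists>T'. openin T T' \<and> f \<in> T' \<and> T' \<subseteq> {f \<in> V. u f \<in> W}"
      by (intro exI[of _ ?N] conjI subsetI)
  qed
  then have "continuous_map T euclidean u"
    by (simp add: continuous_map_def topspace_eq open_openin[symmetric])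
  then show ?thesis unfolding dual_space_def topspace_eq using ext add scale by blast
qed

lemma bounded_singleton:
  assumes "\<phi> \<in> V"
  shows "vn_bounded T {\<phi>}"
proof -
  have "\<exists>r>0::real. (\<lambda>x. \<phi> x / of_real r) \<in> U" if U: "openin T U" "(\<lambda>x. 0) \<in> U" for U
  proof -
    obtain Q d where Q: "finite Q" "Q \<subseteq> P" "d > 0" "\<forall>g\<in>V. (\<forall>p\<in>Q. p (\<lambda>x. g x - 0) < d) \<longrightarrow> g \<in> U"
      using seminorm_topology_0[OF seminorm scale_mem add_mem U] by blast
    define r where "r = (1 + (\<Sum>p\<in>Q. p \<phi>)) / d"
    have nn: "(\<Sum>p\<in>Q. p \<phi>) \<ge> 0" using Q assms by (intro sum_nonneg) (auto intro: seminorm_nonneg)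
    then have r: "r > 0" using Q by (simp add: r_def add_pos_nonneg)
    have "p (\<lambda>x. of_real (1/r) * \<phi> x) < d" if "p \<in> Q" for p
    proof -
      have "p \<phi> \<le> (\<Sum>p\<in>Q. p \<phi>)" using that Q assms by (intro member_le_sum) (auto intro: seminorm_nonneg)
      then have "p \<phi> < r * d" using Q by (simp add: r_def)
      then have "p \<phi> / r < d" using r by (simp add: field_simps)
      then show ?thesis using seminorm_scale[of p \<phi> "of_real (1/r)"] that Q assms r
        by (auto simp: norm_divide simp del: of_real_divide)
    qed
    then have "(\<lambda>x. of_real (1/r) * \<phi> x) \<in> U" using Q(4) scale_mem[OF assms, of "of_real (1/r)"] by simp
    then show ?thesis using r by (intro exI[of _ r]) simp
  qed
  then show ?thesis unfolding vn_bounded_def topspace_eq using assms by simp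
qed

lemma topspace_strong_dual: "topspace (strong_dual T) = dual_space T"
proof -
  let ?p = "\<lambda>u. SUP \<phi>\<in>{\<lambda>x::'x. 0::complex}. norm (u \<phi>)"
  have "?p \<in> {(\<lambda>u. SUP \<phi>\<in>B. norm (u \<phi>)) | B. vn_bounded T B \<and> B \<noteq> {}}"
    using bounded_singleton[OF zero_mem] by blast
  then show ?thesis
    unfolding strong_dual_def by (rule topspace_seminorm_topology) simp
qed

text \<open>The strong topology is that of uniform convergence on bounded sets. The supremum in its seminorms is
finite by \<open>dual_bounded\<close>, without which it would be an arbitrary real number.\<close>

lemma strong_dual_limitin:
  assumes u: "u \<in> dual_space T" and v: "\<And>F. v F \<in> dual_space T"
    and lim: "\<And>B e. vn_bounded T B \<Longrightarrow> B \<noteq> {} \<Longrightarrow> e > 0 \<Longrightarrow> eventually (\<lambda>F. \<forall>\<phi>\<in>B. norm (v F \<phi> - u \<phi>) \<le> e) G"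
  shows "limitin (strong_dual T) v u G"
proof -
  let ?Q = "{(\<lambda>u. SUP \<phi>\<in>B. norm (u \<phi>)) | B. vn_bounded T B \<and> B \<noteq> {}}"
  let ?S = "{{g\<in>dual_space T. p (\<lambda>x. g x - f x) < e} | p f e. p \<in> ?Q \<and> f \<in> dual_space T \<and> (0::real) < e}"
  have bdiff: "bdd_above ((\<lambda>\<phi>. norm (a \<phi> - b \<phi>)) ` B)" if ab: "a \<in> dual_space T" "b \<in> dual_space T" "vn_bounded T B" for a b B
  proof -
    obtain M1 M2 where "\<And>\<phi>. \<phi> \<in> B \<Longrightarrow> norm (a \<phi>) \<le> M1" "\<And>\<phi>. \<phi> \<in> B \<Longrightarrow> norm (b \<phi>) \<le> M2"
      using dual_bounded[OF ab(1,3)] dual_bounded[OF ab(2,3)] unfolding bdd_above_def by auto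
    then have "\<And>\<phi>. \<phi> \<in> B \<Longrightarrow> norm (a \<phi> - b \<phi>) \<le> M1 + M2" using norm_triangle_ineq4 by (meson add_mono order_trans)
    then show ?thesis by (rule bdd_aboveI2)
  qed
  have ev: "eventually (\<lambda>F. v F \<in> U) G" if "generate_topology_on ?S U" "u \<in> U" for U
    using that
  proof induction
    case (Basis S)
    then obtain B f e where S: "S = {g\<in>dual_space T. (SUP \<phi>\<in>B. norm (g \<phi> - f \<phi>)) < e}" "vn_bounded T B" "B \<noteq> {}"
      "f \<in> dual_space T" "0 < e" by blast
    define d where "d = (e - (SUP \<phi>\<in>B. norm (u \<phi> - f \<phi>))) / 2"
    have d: "d > 0" using Basis(2) S(1) by (simp add: d_def)
    have "eventually (\<lambda>F. \<forall>\<phi>\<in>B. norm (v F \<phi> - u \<phi>) \<le> d) G" by (rule lim[OF S(2,3) d])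
    then show ?case
    proof eventually_elim
      case (elim F)
      have "(SUP \<phi>\<in>B. norm (v F \<phi> - f \<phi>)) \<le> (SUP \<phi>\<in>B. norm (u \<phi> - f \<phi>)) + d"
      proof (rule cSUP_least[OF S(3)])
        fix \<phi> assume \<phi>: "\<phi> \<in> B"
        have "norm (v F \<phi> - f \<phi>) \<le> norm (v F \<phi> - u \<phi>) + norm (u \<phi> - f \<phi>)" using norm_triangle_ineq[of "v F \<phi> - u \<phi>" "u \<phi> - f \<phi>"] by simp
        also have "norm (u \<phi> - f \<phi>) \<le> (SUP \<phi>\<in>B. norm (u \<phi> - f \<phi>))" by (rule cSUP_upper[OF \<phi> bdiff[OF u S(4,2)]])
        finally show "norm (v F \<phi> - f \<phi>) \<le> (SUP \<phi>\<in>B. norm (u \<phi> - f \<phi>)) + d" using elim \<phi> by fastforce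
      qed
      then show ?case using S(1) d v[of F] by (auto simp: d_def field_simps)
    qed
  next
    case (UN K)
    then obtain k where k: "k \<in> K" "u \<in> k" by blast
    then have "eventually (\<lambda>F. v F \<in> k) G" by (rule UN.IH)
    then show ?case by eventually_elim (use k in blast)
  next
    case (Int a b)
    then have "eventually (\<lambda>F. v F \<in> a) G" "eventually (\<lambda>F. v F \<in> b) G" by auto
    then show ?case by eventually_elim auto
  qed simp
  show ?thesis
    unfolding limitin_def topspace_strong_dual using u ev
    by (auto simp: strong_dual_def seminorm_topology_def openin_topology_generated_by_iff)
qed

text \<open>Singletons are bounded.\<close>

lemma limitin_strong_dual_pointwise:
  assumes "limitin (strong_dual T) v u G" "\<phi> \<in> V"
  shows "((\<lambda>F. v F \<phi>) \<longlongrightarrow> u \<phi>) G"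
proof -
  have b: "vn_bounded T {\<phi>}" using bounded_singleton assms(2) .
  have u: "u \<in> dual_space T" using limitin_topspace[OF assms(1)] topspace_strong_dual by simp
  show ?thesis
  proof (rule tendstoI)
    fix e :: real assume e: "e > 0"
    let ?U = "{g\<in>dual_space T. (SUP \<phi>\<in>{\<phi>}. norm (g \<phi> - u \<phi>)) < e}"
    have "openin (strong_dual T) ?U"
      unfolding strong_dual_def seminorm_topology_def
      by (intro topology_generated_by_Basis CollectI exI[of _ "\<lambda>u. SUP \<phi>\<in>{\<phi>}. norm (u \<phi> :: complex)"]
          exI[of _ u] exI[of _ e] exI[of _ "{\<phi>}"] conjI refl u[unfolded seminorm_topology_def] e b[unfolded seminorm_topology_def]) simp
    then have "eventually (\<lambda>F. v F \<in> ?U) G" using assms(1) u e unfolding limitin_def by auto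
    then show "eventually (\<lambda>F. dist (v F \<phi>) (u \<phi>) < e) G" by eventually_elim (simp add: dist_norm)
  qed
qed

end

section \<open>Fourier inversion\<close>

lemma integrable_exp_abs:
  assumes "a > 0"
  shows "integrable lborel (\<lambda>x::real. exp (- a * \<bar>x\<bar>))"
proof -
  have i: "integrable lborel (\<lambda>x. indicator {0<..} x *\<^sub>R exp (-(x * a)))"
    using integrable_I0i_exp_mscale[OF assms] by (simp add: set_integrable_def)
  then have i': "integrable lborel (\<lambda>x. indicator {0<..} (0 + (-1) * x) *\<^sub>R exp (-((0 + (-1) * x) * a)))"
    by (rule lborel_integrable_real_affine) simp
  show ?thesis
  proof (rule Bochner_Integration.integrable_bound[OF Bochner_Integration.integrable_add[OF i i']])
    show "AE x in lborel. norm (exp (- a * \<bar>x\<bar>)) \<le> norm (indicator {0<..} x *\<^sub>R exp (-(x * a)) +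
        indicator {0<..} (0 + (-1) * x) *\<^sub>R exp (-((0 + (-1) * x) * a)))"
    proof (rule AE_mp[OF AE_lborel_singleton[of 0]], rule AE_I2, rule impI)
      fix x :: real assume "x \<noteq> 0"
      then consider "x > 0" | "x < 0" by linarith
      then show "norm (exp (- a * \<bar>x\<bar>)) \<le> norm (indicator {0<..} x *\<^sub>R exp (-(x * a)) +
        indicator {0<..} (0 + (-1) * x) *\<^sub>R exp (-((0 + (-1) * x) * a)))"
        by cases (auto simp: mult.commute)
    qed
  qed simp
qed

lemma fourier_iexp: "fourier f \<xi> = (LINT y|lborel. iexp (- (2 * pi * y * \<xi>)) * f y)"
  unfolding fourier_def by (rule Bochner_Integration.integral_cong) (auto simp: algebra_simps)

text \<open>The characteristic function of the standard normal distribution, rescaled.\<close>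

lemma gaussian_fourier:
  fixes z e :: real
  assumes "e > 0"
  shows "(LINT \<xi>|lborel. iexp (2 * pi * z * \<xi>) * of_real (std_normal_density (e * \<xi>))) =
    of_real (1 / e * exp (- (2 * pi * z / e)\<^sup>2 / 2))"
proof -
  have "(LINT \<xi>|lborel. iexp (2 * pi * z * \<xi>) * of_real (std_normal_density (e * \<xi>))) =
    \<bar>1/e\<bar> *\<^sub>R (LINT u|lborel. iexp (2 * pi * z * (0 + 1/e * u)) * of_real (std_normal_density (e * (0 + 1/e * u))))"
    by (rule lborel_integral_real_affine) (use assms in auto)
  also have "(LINT u|lborel. iexp (2 * pi * z * (0 + 1/e * u)) * of_real (std_normal_density (e * (0 + 1/e * u)))) =
     (LINT u|lborel. std_normal_density u *\<^sub>R iexp (2 * pi * z / e * u))"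
    using assms by (intro Bochner_Integration.integral_cong) (auto simp: scaleR_conv_of_real mult_ac)
  also have "\<dots> = char std_normal_distribution (2 * pi * z / e)"
    unfolding char_def by (subst integral_density) (auto simp: normal_density_nonneg)
  also have "\<dots> = of_real (exp (- (2 * pi * z / e)\<^sup>2 / 2))"
    by (simp add: char_std_normal_distribution)
  finally show ?thesis using assms by (simp add: scaleR_conv_of_real)
qed

lemma std_normal_density_le: "std_normal_density x \<le> std_normal_density 0"
  unfolding std_normal_density_def by (intro mult_left_mono) auto

text \<open>Gaussian summability. Insert a factor that widens to a constant into the inversion integral. Its limit
is computed twice by dominated convergence: directly, and after Fubini as a limit of Gaussian averages
of \<open>f\<close> around \<open>x\<close>. The factor \<open>?n 0\<close> that is common to both limits cancels.\<close>

lemma fourier_inversion: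
  fixes f :: "real \<Rightarrow> complex"
  assumes cont: "continuous_on UNIV f" and bd: "\<And>x. norm (f x) \<le> M"
    and int: "integrable lborel f" and Fint: "integrable lborel (fourier f)"
  shows "f x = (LINT \<xi>|lborel. iexp (2 * pi * x * \<xi>) * fourier f \<xi>)"
proof -
  let ?n = std_normal_density
  define e where "e k = 1 / real (Suc k)" for k
  have e: "e k > 0" for k by (simp add: e_def)
  have e0: "e \<longlonglongrightarrow> 0" unfolding e_def using LIMSEQ_inverse_real_of_nat by (simp add: inverse_eq_divide)
  have [measurable]: "f \<in> borel_measurable borel" by (rule borel_measurable_continuous_onI[OF cont])
  have [measurable]: "fourier f \<in> borel_measurable borel" using Fint by auto
  define A where "A k = (LINT \<xi>|lborel. iexp (2 * pi * x * \<xi>) * fourier f \<xi> * of_real (?n (e k * \<xi>)))" for k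
  have n_cont: "isCont ?n y" for y unfolding std_normal_density_def by (intro continuous_intros) auto
  \<comment> \<open>As the Gaussian factor tends to the constant \<open>?n 0\<close>, the regularised inversion integral
    tends to the full one.\<close>
  have lim1: "A \<longlonglongrightarrow> (LINT \<xi>|lborel. iexp (2 * pi * x * \<xi>) * fourier f \<xi> * of_real (?n 0))"
    unfolding A_def
  proof (rule integral_dominated_convergence[where w = "\<lambda>\<xi>. norm (fourier f \<xi>) * ?n 0"])
    show "integrable lborel (\<lambda>\<xi>. norm (fourier f \<xi>) * ?n 0)" using Fint by (intro integrable_mult_left integrable_norm)
    show "AE \<xi> in lborel. (\<lambda>k. iexp (2 * pi * x * \<xi>) * fourier f \<xi> * of_real (?n (e k * \<xi>))) \<longlonglongrightarrow>
        iexp (2 * pi * x * \<xi>) * fourier f \<xi> * of_real (?n 0)"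
    proof (rule AE_I2)
      fix \<xi>
      have "(\<lambda>k. e k * \<xi>) \<longlonglongrightarrow> 0 * \<xi>" by (intro tendsto_intros e0)
      then have "(\<lambda>k. ?n (e k * \<xi>)) \<longlonglongrightarrow> ?n 0" using isCont_tendsto_compose[OF n_cont[of 0]] by simp
      then show "(\<lambda>k. iexp (2 * pi * x * \<xi>) * fourier f \<xi> * of_real (?n (e k * \<xi>))) \<longlonglongrightarrow>
        iexp (2 * pi * x * \<xi>) * fourier f \<xi> * of_real (?n 0)" by (intro tendsto_intros)
    qed
    show "AE \<xi> in lborel. norm (iexp (2 * pi * x * \<xi>) * fourier f \<xi> * of_real (?n (e k * \<xi>))) \<le> norm (fourier f \<xi>) * ?n 0" for k
      by (rule AE_I2) (auto simp: norm_mult normal_density_nonneg intro!: mult_left_mono std_normal_density_le)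
  qed measurable
  \<comment> \<open>Exchanging the integrals turns \<open>A k\<close> into an average of \<open>f\<close> over a Gaussian of width \<open>e k\<close> around \<open>x\<close>.\<close>
  have Aeq: "A k = (LINT u|lborel. f (x + e k * u) * of_real (exp (- (2 * pi * u)\<^sup>2 / 2)))" for k
  proof -
    define h where "h \<xi> y = iexp (2 * pi * (x - y) * \<xi>) * f y * of_real (?n (e k * \<xi>))" for \<xi> y
    have ni: "integrable lborel (\<lambda>\<xi>. ?n (e k * \<xi>))"
      using lborel_integrable_real_affine[of ?n "e k" 0] e[of k] by auto
    have hm [measurable]: "case_prod h \<in> borel_measurable (lborel \<Otimes>\<^sub>M lborel)"
      unfolding h_def by (subst measurable_split_conv) measurable
    have hint: "integrable (lborel \<Otimes>\<^sub>M lborel) (case_prod h)"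
    proof (rule lborel_pair.Fubini_integrable[OF hm])
      have "(\<lambda>\<xi>. LINT y|lborel. norm (case_prod h (\<xi>, y))) = (\<lambda>\<xi>. (LINT y|lborel. norm (f y)) * ?n (e k * \<xi>))"
        by (auto simp: h_def norm_mult normal_density_nonneg)
      then show "integrable lborel (\<lambda>\<xi>. LINT y|lborel. norm (case_prod h (\<xi>, y)))"
        using ni by (simp only:) (intro integrable_mult_right)
      show "AE \<xi> in lborel. integrable lborel (\<lambda>y. case_prod h (\<xi>, y))"
      proof (rule AE_I2)
        fix \<xi>
        have "integrable lborel (\<lambda>y. norm (f y) * ?n (e k * \<xi>))" using int by (intro integrable_mult_left integrable_norm)
        then show "integrable lborel (\<lambda>y. case_prod h (\<xi>, y))"
          by (rule Bochner_Integration.integrable_bound) (auto simp: h_def norm_mult normal_density_nonneg)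
      qed
    qed
    have "A k = (LINT \<xi>|lborel. LINT y|lborel. h \<xi> y)"
      unfolding A_def
    proof (rule Bochner_Integration.integral_cong[OF refl])
      fix \<xi>
      have "iexp (2 * pi * x * \<xi>) * fourier f \<xi> * of_real (?n (e k * \<xi>)) =
        (iexp (2 * pi * x * \<xi>) * of_real (?n (e k * \<xi>))) * (LINT y|lborel. iexp (- (2 * pi * y * \<xi>)) * f y)"
        by (simp add: fourier_iexp mult_ac)
      also have "\<dots> = (LINT y|lborel. (iexp (2 * pi * x * \<xi>) * of_real (?n (e k * \<xi>))) * (iexp (- (2 * pi * y * \<xi>)) * f y))"
        by (rule integral_mult_right_zero[symmetric])
      also have "\<dots> = (LINT y|lborel. h \<xi> y)"
        by (rule Bochner_Integration.integral_cong[OF refl])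
           (auto simp: h_def exp_add[symmetric] algebra_simps exp_diff exp_minus field_simps)
      finally show "iexp (2 * pi * x * \<xi>) * fourier f \<xi> * of_real (?n (e k * \<xi>)) = (LINT y|lborel. h \<xi> y)" .
    qed
    also have "\<dots> = (LINT y|lborel. LINT \<xi>|lborel. h \<xi> y)"
      by (rule lborel_pair.Fubini_integral[OF hint, symmetric])
    also have "\<dots> = (LINT y|lborel. f y * of_real (1 / e k * exp (- (2 * pi * (x - y) / e k)\<^sup>2 / 2)))"
    proof (rule Bochner_Integration.integral_cong[OF refl])
      fix y
      have "(LINT \<xi>|lborel. h \<xi> y) = (LINT \<xi>|lborel. f y * (iexp (2 * pi * (x - y) * \<xi>) * of_real (?n (e k * \<xi>))))"
        by (rule Bochner_Integration.integral_cong[OF refl]) (simp add: h_def mult_ac)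
      also have "\<dots> = f y * (LINT \<xi>|lborel. iexp (2 * pi * (x - y) * \<xi>) * of_real (?n (e k * \<xi>)))"
        by (rule integral_mult_right_zero)
      also have "\<dots> = f y * of_real (1 / e k * exp (- (2 * pi * (x - y) / e k)\<^sup>2 / 2))"
        by (simp only: gaussian_fourier[OF e])
      finally show "(LINT \<xi>|lborel. h \<xi> y) = f y * of_real (1 / e k * exp (- (2 * pi * (x - y) / e k)\<^sup>2 / 2))" .
    qed
    also have "\<dots> = \<bar>e k\<bar> *\<^sub>R (LINT u|lborel. f (x + e k * u) * of_real (1 / e k * exp (- (2 * pi * (x - (x + e k * u)) / e k)\<^sup>2 / 2)))"
      by (rule lborel_integral_real_affine) (use e[of k] in auto)
    also have "\<dots> = (LINT u|lborel. \<bar>e k\<bar> *\<^sub>R (f (x + e k * u) * of_real (1 / e k * exp (- (2 * pi * (x - (x + e k * u)) / e k)\<^sup>2 / 2))))"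
      by simp
    also have "\<dots> = (LINT u|lborel. f (x + e k * u) * of_real (exp (- (2 * pi * u)\<^sup>2 / 2)))"
    proof (rule Bochner_Integration.integral_cong[OF refl])
      fix u
      have "2 * pi * (x - (x + e k * u)) / e k = - (2 * pi * u)" using e[of k] by (simp add: field_simps)
      then show "\<bar>e k\<bar> *\<^sub>R (f (x + e k * u) * of_real (1 / e k * exp (- (2 * pi * (x - (x + e k * u)) / e k)\<^sup>2 / 2))) =
         f (x + e k * u) * of_real (exp (- (2 * pi * u)\<^sup>2 / 2))"
        using e[of k] by (simp only: power2_minus) (simp add: scaleR_conv_of_real)
    qed
    finally show ?thesis .
  qed
  have n2: "exp (- (2 * pi * u)\<^sup>2 / 2) = sqrt (2 * pi) * ?n (0 + 2 * pi * u)" for u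
    by (simp add: std_normal_density_def)
  have gi: "integrable lborel (\<lambda>u. exp (- (2 * pi * u)\<^sup>2 / 2))"
    unfolding n2 using lborel_integrable_real_affine[of ?n "2 * pi" 0] by (intro integrable_mult_right) auto
  have gv: "(LINT u|lborel. exp (- (2 * pi * u)\<^sup>2 / 2)) = ?n 0"
  proof -
    have "1 = \<bar>2 * pi\<bar> *\<^sub>R (LINT u|lborel. ?n (0 + 2 * pi * u))"
      by (subst lborel_integral_real_affine[symmetric]) auto
    then have "(LINT u|lborel. ?n (0 + 2 * pi * u)) = 1 / (2 * pi)" by (simp add: field_simps)
    moreover have "(LINT u|lborel. exp (- (2 * pi * u)\<^sup>2 / 2)) = sqrt (2 * pi) * (LINT u|lborel. ?n (0 + 2 * pi * u))"
      unfolding n2 by (rule integral_mult_right_zero)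
    moreover have "sqrt (2 * pi) * (1 / (2 * pi)) = ?n 0"
    proof -
      have "sqrt (2 * pi) * sqrt (2 * pi) = 2 * pi" by simp
      moreover have "sqrt (2 * pi) > 0" by simp
      ultimately show ?thesis unfolding std_normal_density_def by (simp add: field_simps)
    qed
    ultimately show ?thesis by simp
  qed
  \<comment> \<open>Those averages tend to \<open>f x\<close> by continuity, up to the mass \<open>?n 0\<close> of the Gaussian.\<close>
  have lim2: "A \<longlonglongrightarrow> (LINT u|lborel. f x * of_real (exp (- (2 * pi * u)\<^sup>2 / 2)))"
    unfolding Aeq
  proof (rule integral_dominated_convergence[where w = "\<lambda>u. M * exp (- (2 * pi * u)\<^sup>2 / 2)"])
    show "integrable lborel (\<lambda>u. M * exp (- (2 * pi * u)\<^sup>2 / 2))" by (intro integrable_mult_right gi)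
    show "AE u in lborel. (\<lambda>k. f (x + e k * u) * of_real (exp (- (2 * pi * u)\<^sup>2 / 2))) \<longlonglongrightarrow> f x * of_real (exp (- (2 * pi * u)\<^sup>2 / 2))"
    proof (rule AE_I2)
      fix u
      have "(\<lambda>k. x + e k * u) \<longlonglongrightarrow> x + 0 * u" by (intro tendsto_intros e0)
      moreover have "isCont f x" using cont by (simp add: continuous_on_eq_continuous_at)
      ultimately have "(\<lambda>k. f (x + e k * u)) \<longlonglongrightarrow> f x" using isCont_tendsto_compose[of x f] by simp
      then show "(\<lambda>k. f (x + e k * u) * of_real (exp (- (2 * pi * u)\<^sup>2 / 2))) \<longlonglongrightarrow> f x * of_real (exp (- (2 * pi * u)\<^sup>2 / 2))"
        by (intro tendsto_intros)
    qed
    show "AE u in lborel. norm (f (x + e k * u) * of_real (exp (- (2 * pi * u)\<^sup>2 / 2))) \<le> M * exp (- (2 * pi * u)\<^sup>2 / 2)" for k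
      by (rule AE_I2) (auto simp: norm_mult intro!: mult_right_mono bd)
  qed measurable
  have "(LINT \<xi>|lborel. iexp (2 * pi * x * \<xi>) * fourier f \<xi> * of_real (?n 0)) = (LINT u|lborel. f x * of_real (exp (- (2 * pi * u)\<^sup>2 / 2)))"
    by (rule LIMSEQ_unique[OF lim1 lim2])
  moreover have "(LINT u|lborel. f x * of_real (exp (- (2 * pi * u)\<^sup>2 / 2))) = f x * of_real (?n 0)"
    using gv by (simp only: integral_mult_right_zero integral_complex_of_real)
  moreover have "(LINT \<xi>|lborel. iexp (2 * pi * x * \<xi>) * fourier f \<xi> * of_real (?n 0)) = (LINT \<xi>|lborel. iexp (2 * pi * x * \<xi>) * fourier f \<xi>) * of_real (?n 0)"
    by (rule integral_mult_left_zero)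
  ultimately have "(LINT \<xi>|lborel. iexp (2 * pi * x * \<xi>) * fourier f \<xi>) * of_real (?n 0) = f x * of_real (?n 0)"
    by (simp only:)
  moreover have "?n 0 \<noteq> 0" using normal_density_pos[of 1 0 0] by simp
  ultimately show ?thesis by (simp del: of_real_mult)
qed

section \<open>Holomorphic extension and decay in a strip\<close>

lemma norm_exp_minus_one_le: "norm (exp w - 1) \<le> norm w * exp (norm w)" for w :: complex
proof -
  have "norm (exp w - exp 0) \<le> exp (norm w) * norm (w - 0)"
  proof (rule field_differentiable_bound[of "cball 0 (norm w)" exp exp])
    show "(exp has_field_derivative exp z) (at z within cball 0 (norm w))" for z :: complex
      by (rule has_field_derivative_at_within) (rule DERIV_exp)
    show "norm (exp z) \<le> exp (norm w)" if "z \<in> cball 0 (norm w)" for z :: complex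
      using order_trans[OF norm_exp, of z "exp (norm w)"] that by simp
  qed auto
  then show ?thesis by (simp add: mult.commute)
qed

lemma fourier_laplace_integrand_bound:
  fixes F :: "real \<Rightarrow> complex"
  assumes F: "norm (F \<xi>) \<le> C * exp (- b * \<bar>\<xi>\<bar>)"
  shows "norm (exp (2 * pi * \<i> * z * of_real \<xi>) * F \<xi>) \<le> C * exp (- (b - 2 * pi * \<bar>Im z\<bar>) * \<bar>\<xi>\<bar>)"
proof -
  have "norm (exp (2 * pi * \<i> * z * of_real \<xi>)) = exp (- (2 * pi * Im z * \<xi>))" by (simp add: norm_exp_eq_Re)
  also have "- (2 * pi * Im z * \<xi>) \<le> 2 * pi * \<bar>Im z\<bar> * \<bar>\<xi>\<bar>"
    using abs_ge_minus_self[of "2 * pi * Im z * \<xi>"] by (simp add: abs_mult)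
  finally have "norm (exp (2 * pi * \<i> * z * of_real \<xi>)) \<le> exp (2 * pi * \<bar>Im z\<bar> * \<bar>\<xi>\<bar>)" by simp
  then have "norm (exp (2 * pi * \<i> * z * of_real \<xi>)) * norm (F \<xi>) \<le> exp (2 * pi * \<bar>Im z\<bar> * \<bar>\<xi>\<bar>) * (C * exp (- b * \<bar>\<xi>\<bar>))"
    by (intro mult_mono F) auto
  also have "\<dots> = C * exp (- (b - 2 * pi * \<bar>Im z\<bar>) * \<bar>\<xi>\<bar>)" by (simp add: exp_add[symmetric] algebra_simps)
  finally show ?thesis by (simp add: norm_mult)
qed

text \<open>Exponential decay of \<open>F\<close> at rate \<open>b\<close> leaves room for \<open>|exp (2\<pi>iz\<xi>)| = exp (-2\<pi> Im z \<xi>)\<close> as long as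
\<open>2\<pi>|Im z| < b\<close>. Differentiation under the integral sign is justified by dominated convergence of the
difference quotients.\<close>

lemma fourier_laplace_holomorphic:
  fixes F :: "real \<Rightarrow> complex"
  assumes [measurable]: "F \<in> borel_measurable borel" and b: "b > 0"
    and F: "\<And>\<xi>. norm (F \<xi>) \<le> C * exp (- b * \<bar>\<xi>\<bar>)"
  shows "(\<lambda>z. LINT \<xi>|lborel. exp (2 * pi * \<i> * z * of_real \<xi>) * F \<xi>) holomorphic_on {z. \<bar>Im z\<bar> < b / (2 * pi)}"
proof -
  let ?G = "\<lambda>z. LINT \<xi>|lborel. exp (2 * pi * \<i> * z * of_real \<xi>) * F \<xi>"
  have C0: "C \<ge> 0" using F[of 0] by (simp add: order_trans[OF norm_ge_zero])
  have "(?G has_field_derivative (LINT \<xi>|lborel. 2 * pi * \<i> * of_real \<xi> * (exp (2 * pi * \<i> * z * of_real \<xi>) * F \<xi>))) (at z)"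
    if z: "\<bar>Im z\<bar> < b / (2 * pi)" for z
  proof -
    define d where "d = b - 2 * pi * \<bar>Im z\<bar>"
    have d: "d > 0" using z by (simp add: d_def field_simps)
    have eb: "norm (exp (2 * pi * \<i> * z * of_real \<xi>) * F \<xi>) \<le> C * exp (- d * \<bar>\<xi>\<bar>)" for \<xi>
      unfolding d_def by (rule fourier_laplace_integrand_bound[OF F])
    have Gi: "integrable lborel (\<lambda>\<xi>. exp (2 * pi * \<i> * w * of_real \<xi>) * F \<xi>)" if w: "\<bar>Im w\<bar> < b / (2 * pi)" for w
    proof -
      define d where "d = b - 2 * pi * \<bar>Im w\<bar>"
      have d: "d > 0" using w by (simp add: d_def field_simps)
      have eb: "norm (exp (2 * pi * \<i> * w * of_real \<xi>) * F \<xi>) \<le> C * exp (- d * \<bar>\<xi>\<bar>)" for \<xi>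
        unfolding d_def by (rule fourier_laplace_integrand_bound[OF F])
      show ?thesis
        by (rule Bochner_Integration.integrable_bound[OF integrable_mult_right[OF integrable_exp_abs[OF d], of C]])
          (use eb C0 in auto)
    qed
    \<comment> \<open>With \<open>|w| < d / (8\<pi>)\<close> the factor \<open>exp (2\<pi>|w||\<xi>|)\<close> costs \<open>d/4\<close> of the rate \<open>d\<close>, the factor
      \<open>|\<xi>|\<close> from differentiation another \<open>d/4\<close>, so that the rate \<open>d/2\<close> is left.\<close>
    define \<epsilon> where "\<epsilon> = d / (8 * pi)"
    have \<epsilon>: "\<epsilon> > 0" using d by (simp add: \<epsilon>_def)
    have "((\<lambda>w. (?G w - ?G z) / (w - z)) \<longlongrightarrow> (LINT \<xi>|lborel. 2 * pi * \<i> * of_real \<xi> * (exp (2 * pi * \<i> * z * of_real \<xi>) * F \<xi>)))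
       (at z within ball z \<epsilon>)"
      unfolding tendsto_at_iff_sequentially o_def
    proof (intro allI impI)
      fix X assume X: "\<forall>i. X i \<in> ball z \<epsilon> - {z}" "X \<longlonglongrightarrow> z"
      have Xs: "\<bar>Im (X i)\<bar> < b / (2 * pi)" "X i \<noteq> z" "norm (X i - z) < \<epsilon>" for i
      proof -
        show *: "X i \<noteq> z" "norm (X i - z) < \<epsilon>" using X(1) by (auto simp: dist_norm norm_minus_commute)
        have "\<bar>Im (X i)\<bar> \<le> \<bar>Im z\<bar> + norm (X i - z)" using abs_Im_le_cmod[of "X i - z"] by simp
        also have "\<dots> < \<bar>Im z\<bar> + d / (2 * pi)" using *(2) d pi_gt_zero by (simp add: \<epsilon>_def field_simps)
        also have "\<dots> = b / (2 * pi)" by (simp add: d_def field_simps)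
        finally show "\<bar>Im (X i)\<bar> < b / (2 * pi)" .
      qed
      let ?q = "\<lambda>i \<xi>. (exp (2 * pi * \<i> * X i * of_real \<xi>) * F \<xi> - exp (2 * pi * \<i> * z * of_real \<xi>) * F \<xi>) / (X i - z)"
      have eq: "(?G (X i) - ?G z) / (X i - z) = (LINT \<xi>|lborel. ?q i \<xi>)" for i
        by (simp only: Bochner_Integration.integral_diff[OF Gi[OF Xs(1)] Gi[OF z], symmetric] integral_divide_zero)
      have "(\<lambda>i. LINT \<xi>|lborel. ?q i \<xi>) \<longlonglongrightarrow>
         (LINT \<xi>|lborel. 2 * pi * \<i> * of_real \<xi> * (exp (2 * pi * \<i> * z * of_real \<xi>) * F \<xi>))"
      proof (rule integral_dominated_convergence[where w = "\<lambda>\<xi>. (8 * pi / d * C) * exp (- (d / 2) * \<bar>\<xi>\<bar>)"])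
        show "integrable lborel (\<lambda>\<xi>. (8 * pi / d * C) * exp (- (d / 2) * \<bar>\<xi>\<bar>))"
          using d by (intro integrable_mult_right integrable_exp_abs) auto
        show "AE \<xi> in lborel. (\<lambda>i. ?q i \<xi>) \<longlonglongrightarrow> 2 * pi * \<i> * of_real \<xi> * (exp (2 * pi * \<i> * z * of_real \<xi>) * F \<xi>)"
        proof (rule AE_I2)
          fix \<xi>
          have "((\<lambda>w. exp (2 * pi * \<i> * w * of_real \<xi>) * F \<xi>) has_field_derivative
             2 * pi * \<i> * of_real \<xi> * (exp (2 * pi * \<i> * z * of_real \<xi>) * F \<xi>)) (at z)"
            by (auto intro!: derivative_eq_intros)
          then have "((\<lambda>w. (exp (2 * pi * \<i> * w * of_real \<xi>) * F \<xi> - exp (2 * pi * \<i> * z * of_real \<xi>) * F \<xi>) / (w - z)) \<longlongrightarrow>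
             2 * pi * \<i> * of_real \<xi> * (exp (2 * pi * \<i> * z * of_real \<xi>) * F \<xi>)) (at z)"
            by (simp add: has_field_derivative_iff)
          then show "(\<lambda>i. ?q i \<xi>) \<longlonglongrightarrow> 2 * pi * \<i> * of_real \<xi> * (exp (2 * pi * \<i> * z * of_real \<xi>) * F \<xi>)"
            using X Xs(2) unfolding tendsto_at_iff_sequentially o_def by auto
        qed
        show "AE \<xi> in lborel. norm (?q i \<xi>) \<le> (8 * pi / d * C) * exp (- (d / 2) * \<bar>\<xi>\<bar>)" for i
        proof (rule AE_I2)
          fix \<xi>
          define w where "w = X i - z"
          have w: "w \<noteq> 0" "norm w < \<epsilon>" using Xs(2,3)[of i] by (auto simp: w_def)
          have Xw: "X i = z + w" by (simp add: w_def)
          have "?q i \<xi> = (exp (2 * pi * \<i> * w * of_real \<xi>) - 1) / w * (exp (2 * pi * \<i> * z * of_real \<xi>) * F \<xi>)"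
            unfolding Xw by (simp add: exp_add[symmetric] algebra_simps diff_divide_distrib)
          then have "norm (?q i \<xi>) = norm (exp (2 * pi * \<i> * w * of_real \<xi>) - 1) / norm w * norm (exp (2 * pi * \<i> * z * of_real \<xi>) * F \<xi>)"
            by (simp add: norm_mult norm_divide)
          also have "\<dots> \<le> (2 * pi * \<bar>\<xi>\<bar> * exp (d / 4 * \<bar>\<xi>\<bar>)) * (C * exp (- d * \<bar>\<xi>\<bar>))"
          proof (intro mult_mono eb)
            have n: "norm (2 * pi * \<i> * w * of_real \<xi>) = 2 * pi * \<bar>\<xi>\<bar> * norm w" by (simp add: norm_mult)
            have "norm (exp (2 * pi * \<i> * w * of_real \<xi>) - 1) \<le> 2 * pi * \<bar>\<xi>\<bar> * norm w * exp (2 * pi * \<bar>\<xi>\<bar> * norm w)"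
              using norm_exp_minus_one_le[of "2 * pi * \<i> * w * of_real \<xi>"] n by simp
            also have "\<dots> \<le> 2 * pi * \<bar>\<xi>\<bar> * norm w * exp (d / 4 * \<bar>\<xi>\<bar>)"
            proof (rule mult_left_mono)
              have "2 * pi * norm w \<le> 2 * pi * \<epsilon>" using w by simp
              also have "\<dots> = d / 4" by (simp add: \<epsilon>_def)
              finally have "2 * pi * norm w * \<bar>\<xi>\<bar> \<le> d / 4 * \<bar>\<xi>\<bar>" by (rule mult_right_mono) simp
              then show "exp (2 * pi * \<bar>\<xi>\<bar> * norm w) \<le> exp (d / 4 * \<bar>\<xi>\<bar>)" by (simp add: mult_ac)
            qed auto
            finally show "norm (exp (2 * pi * \<i> * w * of_real \<xi>) - 1) / norm w \<le> 2 * pi * \<bar>\<xi>\<bar> * exp (d / 4 * \<bar>\<xi>\<bar>)"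
              using w by (simp add: field_simps)
          qed auto
          also have "\<dots> \<le> (2 * pi * (4 / d * exp (d / 4 * \<bar>\<xi>\<bar>)) * exp (d / 4 * \<bar>\<xi>\<bar>)) * (C * exp (- d * \<bar>\<xi>\<bar>))"
          proof (intro mult_right_mono mult_left_mono)
            have "d / 4 * \<bar>\<xi>\<bar> \<le> exp (d / 4 * \<bar>\<xi>\<bar>)" using exp_ge_add_one_self[of "d / 4 * \<bar>\<xi>\<bar>"] by linarith
            then show "\<bar>\<xi>\<bar> \<le> 4 / d * exp (d / 4 * \<bar>\<xi>\<bar>)" using d by (simp add: field_simps)
          qed (use C0 in auto)
          also have "\<dots> = (8 * pi / d * C) * (exp (d / 4 * \<bar>\<xi>\<bar>) * exp (d / 4 * \<bar>\<xi>\<bar>) * exp (- d * \<bar>\<xi>\<bar>))" by simp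
          also have "exp (d / 4 * \<bar>\<xi>\<bar>) * exp (d / 4 * \<bar>\<xi>\<bar>) * exp (- d * \<bar>\<xi>\<bar>) = exp (- (d / 2) * \<bar>\<xi>\<bar>)"
            by (simp add: exp_add[symmetric] field_simps)
          finally show "norm (?q i \<xi>) \<le> (8 * pi / d * C) * exp (- (d / 2) * \<bar>\<xi>\<bar>)" .
        qed
      qed measurable
      then show "(\<lambda>i. (?G (X i) - ?G z) / (X i - z)) \<longlonglongrightarrow>
         (LINT \<xi>|lborel. 2 * pi * \<i> * of_real \<xi> * (exp (2 * pi * \<i> * z * of_real \<xi>) * F \<xi>))" by (simp only: eq)
    qed
    then show ?thesis using \<epsilon> unfolding has_field_derivative_iff by (simp add: at_within_open[of z "ball z \<epsilon>"])
  qed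
  then show ?thesis
    unfolding holomorphic_on_def field_differentiable_def using has_field_derivative_at_within by blast
qed

lemma fourier_laplace_bounded:
  fixes F :: "real \<Rightarrow> complex"
  assumes [measurable]: "F \<in> borel_measurable borel"
    and b: "b > 0" and F: "\<And>\<xi>. norm (F \<xi>) \<le> C * exp (- b * \<bar>\<xi>\<bar>)" and z: "\<bar>Im z\<bar> \<le> b / (4 * pi)"
  shows "norm (LINT \<xi>|lborel. exp (2 * pi * \<i> * z * of_real \<xi>) * F \<xi>) \<le> (LINT \<xi>|lborel. C * exp (- (b / 2) * \<bar>\<xi>\<bar>))"
proof -
  have C0: "C \<ge> 0" using F[of 0] by (simp add: order_trans[OF norm_ge_zero])
  have i: "integrable lborel (\<lambda>\<xi>. C * exp (- (b / 2) * \<bar>\<xi>\<bar>))"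
    using b by (intro integrable_mult_right integrable_exp_abs) auto
  have le: "norm (exp (2 * pi * \<i> * z * of_real \<xi>) * F \<xi>) \<le> C * exp (- (b / 2) * \<bar>\<xi>\<bar>)" for \<xi>
  proof -
    have "2 * pi * \<bar>Im z\<bar> \<le> b / 2" using z by (simp add: field_simps)
    then have "(b / 2) * \<bar>\<xi>\<bar> \<le> (b - 2 * pi * \<bar>Im z\<bar>) * \<bar>\<xi>\<bar>" by (intro mult_right_mono) auto
    then have "C * exp (- (b - 2 * pi * \<bar>Im z\<bar>) * \<bar>\<xi>\<bar>) \<le> C * exp (- (b / 2) * \<bar>\<xi>\<bar>)"
      using C0 by (intro mult_left_mono) (simp_all add: algebra_simps)
    then show ?thesis using fourier_laplace_integrand_bound[where F = F and z = z, OF F[of \<xi>]] by linarith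
  qed
  have "integrable lborel (\<lambda>\<xi>. exp (2 * pi * \<i> * z * of_real \<xi>) * F \<xi>)"
    by (rule Bochner_Integration.integrable_bound[OF i]) (use le C0 in \<open>auto intro!: AE_I2\<close>)
  then have "(LINT \<xi>|lborel. norm (exp (2 * pi * \<i> * z * of_real \<xi>) * F \<xi>)) \<le> (LINT \<xi>|lborel. C * exp (- (b / 2) * \<bar>\<xi>\<bar>))"
    using le by (intro integral_mono i integrable_norm)
  then show ?thesis by (rule order_trans[OF integral_norm_bound])
qed

text \<open>A Phragmen-Lindelof argument. The function \<open>W\<close> decays on the real half-line and is merely bounded on the
edge \<open>\<sigma> Im z = r\<close>; the decay at intermediate heights interpolates linearly. To see this, multiply \<open>W\<close> by a
holomorphic function whose modulus is the inverse of the claimed bound, and apply the maximum principle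
on large rectangles. The sign \<open>\<sigma>\<close> selects the upper or the lower half of the strip.\<close>

lemma half_strip_decay:
  fixes W :: "complex \<Rightarrow> complex"
  assumes hol: "W holomorphic_on {z. \<bar>Im z\<bar> < r0}" and r: "0 < r" "r < r0" and a: "a > 0"
    and M: "\<And>z. \<bar>Im z\<bar> \<le> r \<Longrightarrow> norm (W z) \<le> M"
    and dec: "\<And>x. x \<ge> 0 \<Longrightarrow> norm (W (of_real x)) \<le> M * exp (- a * x)"
    and \<sigma>: "\<sigma> = 1 \<or> \<sigma> = -1"
    and x: "Re z \<ge> 0" and y: "0 \<le> \<sigma> * Im z" "\<sigma> * Im z \<le> r"
  shows "norm (W z) \<le> M * exp (- a * Re z * (1 - \<sigma> * Im z / r))"
proof -
  have M0: "M \<ge> 0" using M[of 0] r by (simp add: order_trans[OF norm_ge_zero])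
  \<comment> \<open>On the edge \<open>Im z = \<sigma> r\<close> the quadratic term cancels the growth of \<open>exp (a z)\<close>, on the real axis
    it has modulus one; the term with \<open>\<eta>\<close> provides decay at infinity.\<close>
  let ?E = "\<lambda>\<eta> z. exp (of_real a * z + \<i> * of_real (\<sigma> * a / (2 * r)) * z\<^sup>2 - of_real \<eta> * z\<^sup>2)"
  have nE: "norm (?E \<eta> w) = exp (a * Re w * (1 - \<sigma> * Im w / r) - \<eta> * ((Re w)\<^sup>2 - (Im w)\<^sup>2))" for \<eta> w
    using r by (simp add: norm_exp_eq_Re power2_eq_square field_simps)
  have *: "norm (W z) * exp (a * Re z * (1 - \<sigma> * Im z / r)) * exp (- \<eta> * ((Re z)\<^sup>2 - (Im z)\<^sup>2)) \<le> M * exp (\<eta> * r\<^sup>2)"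
    if \<eta>: "\<eta> > 0" for \<eta>
  proof -
    \<comment> \<open>Beyond \<open>Re z = a / \<eta>\<close> the decay \<open>exp (- \<eta> (Re z)\<^sup>2)\<close> beats \<open>exp (a Re z)\<close>, so the right edge of
      the rectangle is harmless.\<close>
    define R where "R = max (a / \<eta>) (Re z)"
    have "a / \<eta> > 0" using \<eta> a by simp
    then have R: "R > 0" "R \<ge> Re z" unfolding R_def by linarith+
    have "\<eta> * (a / \<eta>) \<le> \<eta> * R" using \<eta> by (intro mult_left_mono) (auto simp: R_def)
    then have R3: "\<eta> * R \<ge> a" using \<eta> by simp
    let ?S = "cbox (Complex 0 (min 0 (\<sigma> * r))) (Complex R (max 0 (\<sigma> * r)))"
    have S: "w \<in> ?S \<longleftrightarrow> 0 \<le> Re w \<and> Re w \<le> R \<and> 0 \<le> \<sigma> * Im w \<and> \<sigma> * Im w \<le> r" for w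
      using \<sigma> r by (auto simp: in_cbox_complex_iff)
    have sub: "?S \<subseteq> {z. \<bar>Im z\<bar> < r0}" using S \<sigma> r by auto
    have hol': "(\<lambda>w. W w * ?E \<eta> w) holomorphic_on {z. \<bar>Im z\<bar> < r0}" by (intro holomorphic_intros hol)
    have "norm (W z * ?E \<eta> z) \<le> M * exp (\<eta> * r\<^sup>2)"
    proof (rule maximum_modulus_frontier[where S = ?S and f = "\<lambda>w. W w * ?E \<eta> w" and \<xi> = z])
      show "(\<lambda>w. W w * ?E \<eta> w) holomorphic_on interior ?S"
        by (rule holomorphic_on_subset[OF hol' order_trans[OF interior_subset sub]])
      show "continuous_on (closure ?S) (\<lambda>w. W w * ?E \<eta> w)"
        using holomorphic_on_imp_continuous_on[OF holomorphic_on_subset[OF hol' sub]] by simp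
      show "z \<in> ?S" unfolding S using x y R by auto
      fix w assume "w \<in> frontier ?S"
      then have w: "w \<in> ?S" and nb: "w \<notin> box (Complex 0 (min 0 (\<sigma> * r))) (Complex R (max 0 (\<sigma> * r)))"
        by (auto simp: frontier_def)
      have w': "0 \<le> Re w" "Re w \<le> R" "0 \<le> \<sigma> * Im w" "\<sigma> * Im w \<le> r" using w S by auto
      have cs: "Re w = 0 \<or> Re w = R \<or> Im w = 0 \<or> \<sigma> * Im w = r"
        using nb w' \<sigma> r by (auto simp: in_box_complex_iff)
      have imw: "\<bar>Im w\<bar> \<le> r" using w' \<sigma> by auto
      then have im2: "(Im w)\<^sup>2 \<le> r\<^sup>2" using power_mono[of "\<bar>Im w\<bar>" r 2] by simp
      have WM: "norm (W w) \<le> M" using M imw by auto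
      have "norm (W w) * exp (a * Re w * (1 - \<sigma> * Im w / r) - \<eta> * ((Re w)\<^sup>2 - (Im w)\<^sup>2)) \<le> M * exp (\<eta> * r\<^sup>2)"
      proof (cases "Im w = 0")
        case True
        then have "w = of_real (Re w)" by (simp add: complex_eq_iff)
        then have "norm (W w) \<le> M * exp (- a * Re w)" using dec[OF w'(1)] by simp
        then have "norm (W w) * exp (a * Re w - \<eta> * (Re w)\<^sup>2) \<le> M * exp (- a * Re w) * exp (a * Re w - \<eta> * (Re w)\<^sup>2)"
          by (intro mult_right_mono) auto
        also have "\<dots> = M * exp (- (\<eta> * (Re w)\<^sup>2))" by (simp add: exp_add[symmetric])
        also have "\<dots> \<le> M * exp (\<eta> * r\<^sup>2)"
          using M0 \<eta> zero_le_power2[of r] zero_le_power2[of "Re w"] by (intro mult_left_mono) (auto intro: order_trans[of _ 0])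
        finally show ?thesis using True by simp
      next
        case False
        have "a * Re w * (1 - \<sigma> * Im w / r) \<le> \<eta> * (Re w)\<^sup>2"
        proof (cases "Re w = R")
          case True
          have "a * R * (1 - \<sigma> * Im w / r) \<le> a * R * 1" using a R w' r by (intro mult_left_mono) auto
          also have "\<dots> \<le> \<eta> * R * R" using mult_right_mono[OF R3, of R] R by simp
          finally show ?thesis using True by (simp add: power2_eq_square)
        next
          case False
          then consider "Re w = 0" | "\<sigma> * Im w = r" using cs \<open>Im w \<noteq> 0\<close> by auto
          then show ?thesis using \<eta> r by cases auto
        qed
        then have "a * Re w * (1 - \<sigma> * Im w / r) - \<eta> * ((Re w)\<^sup>2 - (Im w)\<^sup>2) \<le> \<eta> * r\<^sup>2"
          using mult_left_mono[OF im2, of \<eta>] \<eta> by (simp only: right_diff_distrib[of \<eta>]) linarith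
        then show ?thesis using WM M0 by (intro mult_mono) auto
      qed
      then show "norm (W w * ?E \<eta> w) \<le> M * exp (\<eta> * r\<^sup>2)" by (simp only: norm_mult nE)
    qed simp
    then have "norm (W z) * exp (a * Re z * (1 - \<sigma> * Im z / r) - \<eta> * ((Re z)\<^sup>2 - (Im z)\<^sup>2)) \<le> M * exp (\<eta> * r\<^sup>2)"
      by (simp only: norm_mult nE)
    then show ?thesis by (simp add: exp_add[symmetric] exp_diff exp_minus divide_inverse mult.assoc)
  qed
  \<comment> \<open>Let \<open>\<eta>\<close> tend to zero at the fixed point \<open>z\<close>.\<close>
  have "norm (W z) * exp (a * Re z * (1 - \<sigma> * Im z / r)) \<le> M"
  proof (rule tendsto_le)
    show "((\<lambda>\<eta>. M * exp (\<eta> * r\<^sup>2)) \<longlongrightarrow> M) (at_right 0)" by (auto intro!: tendsto_eq_intros)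
    show "((\<lambda>\<eta>. norm (W z) * exp (a * Re z * (1 - \<sigma> * Im z / r)) * exp (- \<eta> * ((Re z)\<^sup>2 - (Im z)\<^sup>2))) \<longlongrightarrow>
      norm (W z) * exp (a * Re z * (1 - \<sigma> * Im z / r))) (at_right 0)" by (auto intro!: tendsto_eq_intros)
    show "\<forall>\<^sub>F \<eta> in at_right 0. norm (W z) * exp (a * Re z * (1 - \<sigma> * Im z / r)) * exp (- \<eta> * ((Re z)\<^sup>2 - (Im z)\<^sup>2)) \<le> M * exp (\<eta> * r\<^sup>2)"
      using * by (auto simp: eventually_at_right_field intro: exI[of _ 1])
  qed simp
  then have "norm (W z) * exp (a * Re z * (1 - \<sigma> * Im z / r)) * exp (- (a * Re z * (1 - \<sigma> * Im z / r))) \<le>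
      M * exp (- (a * Re z * (1 - \<sigma> * Im z / r)))"
    by (rule mult_right_mono) simp
  then show ?thesis by (simp only: mult.assoc mult_exp_exp) simp
qed

text \<open>Halfway up, half of the rate survives. The left half-plane is reached by \<open>z \<mapsto> -z\<close>.\<close>

lemma strip_decay:
  fixes W :: "complex \<Rightarrow> complex"
  assumes hol: "W holomorphic_on {z. \<bar>Im z\<bar> < r0}" and r: "0 < r" "r < r0" and a: "a > 0"
    and M: "\<And>z. \<bar>Im z\<bar> \<le> r \<Longrightarrow> norm (W z) \<le> M"
    and dec: "\<And>x. norm (W (of_real x)) \<le> M * exp (- a * \<bar>x\<bar>)"
    and z: "\<bar>Im z\<bar> \<le> r / 2"
  shows "norm (W z) \<le> M * exp (- (a / 2) * \<bar>Re z\<bar>)"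
proof -
  have M0: "M \<ge> 0" using M[of 0] r by (simp add: order_trans[OF norm_ge_zero])
  have pos: "norm (V z) \<le> M * exp (- (a / 2) * Re z)"
    if hol: "V holomorphic_on {z. \<bar>Im z\<bar> < r0}" and M: "\<And>z. \<bar>Im z\<bar> \<le> r \<Longrightarrow> norm (V z) \<le> M"
    and dec: "\<And>x. norm (V (of_real x)) \<le> M * exp (- a * \<bar>x\<bar>)"
    and z: "\<bar>Im z\<bar> \<le> r / 2" and re: "Re z \<ge> 0" for V z
  proof -
    define \<sigma> :: real where "\<sigma> = (if Im z \<ge> 0 then 1 else -1)"
    have \<sigma>: "\<sigma> = 1 \<or> \<sigma> = -1" "\<sigma> * Im z = \<bar>Im z\<bar>" by (auto simp: \<sigma>_def)
    have "norm (V z) \<le> M * exp (- a * Re z * (1 - \<sigma> * Im z / r))"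
    proof (rule half_strip_decay[OF hol r a M _ \<sigma>(1) re])
      show "norm (V (of_real x)) \<le> M * exp (- a * x)" if "x \<ge> 0" for x using dec[of x] that by simp
    qed (use z \<sigma>(2) r in auto)
    also have "\<dots> \<le> M * exp (- (a / 2) * Re z)"
    proof -
      have "1 / 2 \<le> 1 - \<sigma> * Im z / r" using z \<sigma> r by (simp add: field_simps)
      then have "a * Re z * (1 / 2) \<le> a * Re z * (1 - \<sigma> * Im z / r)" using a re by (intro mult_left_mono) auto
      then show ?thesis using M0 by (intro mult_left_mono) auto
    qed
    finally show ?thesis .
  qed
  show ?thesis
  proof (cases "Re z \<ge> 0")
    case True
    then show ?thesis using pos[OF hol M dec z] by simp
  next
    case False
    have "(\<lambda>z. W (- z)) holomorphic_on {z. \<bar>Im z\<bar> < r0}"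
      by (rule holomorphic_on_compose_gen[OF _ hol, of uminus, unfolded o_def]) (auto intro!: holomorphic_intros)
    moreover have "norm (W (- of_real x)) \<le> M * exp (- a * \<bar>x\<bar>)" for x using dec[of "-x"] by simp
    ultimately have "norm (W (- (- z))) \<le> M * exp (- (a / 2) * Re (- z))"
      using z False by (intro pos) (auto intro: M)
    then show ?thesis using False by simp
  qed
qed

text \<open>The decay of the Fourier transform extends \<open>\<psi>\<close> to a bounded holomorphic function on a strip, by Fourier
inversion; the decay of \<open>\<psi>\<close> on the real line spreads to a thinner strip; Cauchy's estimates on circles
inside it bound all derivatives. The exponential decay of every derivative with analytic constants is the
only property of the window, besides orthonormality and completeness, that the rest of the proof uses.\<close>

lemma window_derivatives:
  fixes \<psi> :: "real \<Rightarrow> real"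
  assumes cont: "continuous_on UNIV \<psi>" and a: "a > 0" and b: "b > 0"
    and dec: "\<And>x. \<bar>\<psi> x\<bar> \<le> C * exp (- a * \<bar>x\<bar>)"
    and fdec: "\<And>\<xi>. norm (fourier (\<lambda>x. of_real (\<psi> x)) \<xi>) \<le> C * exp (- b * \<bar>\<xi>\<bar>)"
  obtains D :: "nat \<Rightarrow> real \<Rightarrow> real" and K A c where "D 0 = \<psi>" "K > 0" "A > 0" "c > 0"
    "\<And>k x. (D k has_real_derivative D (Suc k) x) (at x)"
    "\<And>k x. \<bar>D k x\<bar> \<le> K * A ^ k * fact k * exp (- c * \<bar>x\<bar>)"
proof -
  have C0: "C \<ge> 0" using dec[of 0] by simp
  let ?f = "\<lambda>x. complex_of_real (\<psi> x)"
  let ?F = "fourier ?f"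
  have fcont: "continuous_on UNIV ?f" by (intro continuous_intros cont)
  have [measurable]: "?f \<in> borel_measurable borel" by (rule borel_measurable_continuous_onI[OF fcont])
  have Fm [measurable]: "?F \<in> borel_measurable borel"
  proof -
    have "(\<lambda>\<xi>. LINT x|lborel. exp (- 2 * of_real pi * \<i> * of_real \<xi> * of_real x) * ?f x) \<in> borel_measurable borel"
      by (rule lborel.borel_measurable_lebesgue_integral) measurable
    then show ?thesis by (simp add: fourier_def[abs_def])
  qed
  have fint: "integrable lborel ?f"
    by (rule Bochner_Integration.integrable_bound[OF integrable_mult_right[OF integrable_exp_abs[OF a], of C]])
      (use dec C0 in auto)
  have Fint: "integrable lborel ?F"
    by (rule Bochner_Integration.integrable_bound[OF integrable_mult_right[OF integrable_exp_abs[OF b], of C]])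
      (use fdec C0 in auto)
  define W where "W z = (LINT \<xi>|lborel. exp (2 * pi * \<i> * z * of_real \<xi>) * ?F \<xi>)" for z
  \<comment> \<open>The integral converges for \<open>|Im z| < r0\<close> and is uniformly bounded for \<open>|Im z| \<le> r\<close>.\<close>
  define r0 where "r0 = b / (2 * pi)"
  define r where "r = b / (4 * pi)"
  have r: "0 < r" "r < r0" using b by (auto simp: r_def r0_def field_simps)
  have hol: "W holomorphic_on {z. \<bar>Im z\<bar> < r0}"
    unfolding W_def r0_def by (rule fourier_laplace_holomorphic[OF Fm b fdec])
  have W\<psi>: "W (of_real x) = of_real (\<psi> x)" for x
  proof -
    have "of_real (\<psi> x) = (LINT \<xi>|lborel. iexp (2 * pi * x * \<xi>) * ?F \<xi>)"
    proof (rule fourier_inversion[OF fcont _ fint Fint])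
      show "norm (?f x) \<le> C" for x :: real
      proof -
        have "C * exp (- a * \<bar>x\<bar>) \<le> C * 1" using C0 a by (intro mult_left_mono) auto
        then show ?thesis using dec[of x] by simp
      qed
    qed
    also have "\<dots> = W (of_real x)" unfolding W_def
      by (rule Bochner_Integration.integral_cong[OF refl]) (simp add: mult_ac)
    finally show ?thesis by simp
  qed
  define M where "M = max C (LINT \<xi>|lborel. C * exp (- (b / 2) * \<bar>\<xi>\<bar>)) + 1"
  have M: "M > 0" using C0 by (auto simp: M_def)
  have Wd: "norm (W z) \<le> M * exp (- (a / 2) * \<bar>Re z\<bar>)" if "\<bar>Im z\<bar> \<le> r / 2" for z
  proof (rule strip_decay[OF hol r a _ _ that])
    show "norm (W z) \<le> M" if "\<bar>Im z\<bar> \<le> r" for z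
      using fourier_laplace_bounded[OF Fm b fdec that[unfolded r_def]] by (simp add: W_def M_def)
    show "norm (W (of_real x)) \<le> M * exp (- a * \<bar>x\<bar>)" for x
    proof -
      have "C * exp (- a * \<bar>x\<bar>) \<le> M * exp (- a * \<bar>x\<bar>)" by (intro mult_right_mono) (auto simp: M_def)
      then show ?thesis unfolding W\<psi> norm_of_real using dec[of x] by linarith
    qed
  qed
  \<comment> \<open>Radius of the circles for Cauchy's estimates: they stay in the strip where \<open>W\<close> decays.\<close>
  define \<rho> where "\<rho> = r / 2"
  have \<rho>: "\<rho> > 0" "\<rho> < r0" using r by (auto simp: \<rho>_def)
  define D where "D k x = Re ((deriv ^^ k) W (of_real x))" for k x
  have op: "open {z. \<bar>Im z\<bar> < r0}" by (intro open_Collect_less continuous_intros)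
  show ?thesis
  proof
    show "D 0 = \<psi>" by (auto simp: D_def W\<psi>)
    show "M * exp (a / 2 * \<rho>) > 0" "1 / \<rho> > 0" "a / 2 > 0" using M \<rho> a by auto
    fix k x
    have "(deriv ^^ k) W holomorphic_on {z. \<bar>Im z\<bar> < r0}" by (rule holomorphic_higher_deriv[OF hol op])
    then have "((deriv ^^ k) W has_field_derivative deriv ((deriv ^^ k) W) (of_real x)) (at (of_real x))"
      using r by (intro holomorphic_derivI[OF _ op]) auto
    then have "((\<lambda>x. (deriv ^^ k) W (of_real x)) has_vector_derivative (deriv ^^ Suc k) W (of_real x)) (at x)"
      by (intro has_vector_derivative_real_field) simp
    then have "((\<lambda>x. Re ((deriv ^^ k) W (of_real x))) has_vector_derivative Re ((deriv ^^ Suc k) W (of_real x))) (at x)"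
      by (rule bounded_linear.has_vector_derivative[OF bounded_linear_Re])
    then show "(D k has_real_derivative D (Suc k) x) (at x)"
      by (simp add: D_def[abs_def] has_real_derivative_iff_has_vector_derivative)
    have cb: "cball (of_real x) \<rho> \<subseteq> {z. \<bar>Im z\<bar> < r0}"
    proof
      fix z :: complex assume "z \<in> cball (of_real x) \<rho>"
      then have "\<bar>Im z\<bar> \<le> \<rho>" using abs_Im_le_cmod[of "of_real x - z"] by (simp add: dist_norm)
      then show "z \<in> {z. \<bar>Im z\<bar> < r0}" using \<rho> by simp
    qed
    have "norm ((deriv ^^ k) W (of_real x)) \<le> fact k * (M * exp (- (a / 2) * (\<bar>x\<bar> - \<rho>))) / \<rho> ^ k"
    proof (rule Cauchy_inequality[OF _ _ \<rho>(1)])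
      show "W holomorphic_on ball (of_real x) \<rho>"
        by (rule holomorphic_on_subset[OF hol order_trans[OF ball_subset_cball cb]])
      show "continuous_on (cball (of_real x) \<rho>) W"
        by (rule holomorphic_on_imp_continuous_on[OF holomorphic_on_subset[OF hol cb]])
      fix z :: complex assume z: "norm (of_real x - z) = \<rho>"
      have "\<bar>Im z\<bar> \<le> \<rho>" "\<bar>x - Re z\<bar> \<le> \<rho>"
        using abs_Im_le_cmod[of "of_real x - z"] abs_Re_le_cmod[of "of_real x - z"] z by auto
      then have "norm (W z) \<le> M * exp (- (a / 2) * \<bar>Re z\<bar>)" "\<bar>x\<bar> - \<rho> \<le> \<bar>Re z\<bar>"
        using Wd[of z] unfolding \<rho>_def by linarith+
      moreover from this(2) have "M * exp (- (a / 2) * \<bar>Re z\<bar>) \<le> M * exp (- (a / 2) * (\<bar>x\<bar> - \<rho>))"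
        using M a by (intro mult_left_mono) auto
      ultimately show "norm (W z) \<le> M * exp (- (a / 2) * (\<bar>x\<bar> - \<rho>))" by linarith
    qed
    also have "\<dots> = M * exp (a / 2 * \<rho>) * (1 / \<rho>) ^ k * fact k * exp (- (a / 2) * \<bar>x\<bar>)"
      by (simp add: exp_add[symmetric] power_one_over field_simps)
    finally show "\<bar>D k x\<bar> \<le> M * exp (a / 2 * \<rho>) * (1 / \<rho>) ^ k * fact k * exp (- (a / 2) * \<bar>x\<bar>)"
      using abs_Re_le_cmod[of "(deriv ^^ k) W (of_real x)"] by (simp add: D_def)
  qed
qed

section \<open>One-dimensional Wilson functions\<close>

text \<open>Binomial coefficients are at least one.\<close>

lemma fact_powr_mult_le:
  assumes "s \<ge> (0::real)"
  shows "fact j powr s * fact k powr s \<le> (fact (j + k) :: real) powr s"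
proof -
  have "(fact j * fact k :: real) \<le> fact (j + k)"
  proof -
    have "fact j * fact k dvd (fact (j + k) :: nat)" by (rule fact_fact_dvd_fact)
    then have "fact j * fact k \<le> (fact (j + k) :: nat)" by (rule dvd_imp_le) simp
    then have "real (fact j * fact k) \<le> real (fact (j + k))" by (simp only: of_nat_le_iff)
    then show ?thesis by simp
  qed
  then show ?thesis using assms by (simp add: powr_mult[symmetric] powr_mono2)
qed

locale analytic_window =
  fixes \<psi> :: "real \<Rightarrow> real" and D :: "nat \<Rightarrow> real \<Rightarrow> real" and K A c :: real
  assumes D_0: "D 0 = \<psi>" and K_pos: "K > 0" and A_pos: "A > 0" and c_pos: "c > 0"
    and D_deriv: "\<And>k x. (D k has_real_derivative D (Suc k) x) (at x)"
    and D_bound: "\<And>k x. \<bar>D k x\<bar> \<le> K * A ^ k * fact k * exp (- c * \<bar>x\<bar>)"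
begin

text \<open>The \<open>j\<close>-th derivative of a cosine of frequency \<open>L\<close> times the \<open>k\<close>-th derivative of the shifted window. A
derivative raises \<open>j\<close> or \<open>k\<close>, so iterated derivatives are given by a recursion that has the Leibniz
formula built in.\<close>

definition modulated :: "real \<Rightarrow> real \<Rightarrow> real \<Rightarrow> nat \<Rightarrow> nat \<Rightarrow> real \<Rightarrow> real" where
  "modulated L \<theta> p j k x = L ^ j * cos (L * x + \<theta> + real j * pi / 2) * D k (x - p)"

primrec modulated_deriv :: "real \<Rightarrow> real \<Rightarrow> real \<Rightarrow> nat \<Rightarrow> nat \<Rightarrow> nat \<Rightarrow> real \<Rightarrow> real" where
  "modulated_deriv L \<theta> p 0 j k x = modulated L \<theta> p j k x"
| "modulated_deriv L \<theta> p (Suc m) j k x =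
     modulated_deriv L \<theta> p m (Suc j) k x + modulated_deriv L \<theta> p m j (Suc k) x"

lemma modulated_has_deriv:
  "(modulated L \<theta> p j k has_real_derivative modulated L \<theta> p (Suc j) k x + modulated L \<theta> p j (Suc k) x) (at x)"
proof -
  have d: "((\<lambda>x. D k (x - p)) has_real_derivative D (Suc k) (x - p)) (at x)"
  proof -
    have "((\<lambda>x. x - p) has_real_derivative 1) (at x)" by (auto intro!: derivative_eq_intros)
    from DERIV_chain2[OF D_deriv this, of k] show ?thesis by simp
  qed
  have "((\<lambda>x. L ^ j * cos (L * x + \<theta> + real j * pi / 2) * D k (x - p)) has_real_derivative
      L ^ j * (- sin (L * x + \<theta> + real j * pi / 2) * L) * D k (x - p) +
      L ^ j * cos (L * x + \<theta> + real j * pi / 2) * D (Suc k) (x - p)) (at x)"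
    by (auto intro!: derivative_eq_intros d simp: algebra_simps)
  moreover have "cos (L * x + \<theta> + real (Suc j) * pi / 2) = - sin (L * x + \<theta> + real j * pi / 2)"
    using minus_sin_cos_eq[of "L * x + \<theta> + real j * pi / 2"] by (simp add: field_simps)
  ultimately show ?thesis by (simp add: modulated_def[abs_def] mult_ac)
qed

lemma modulated_deriv_has_deriv:
  "(modulated_deriv L \<theta> p m j k has_real_derivative modulated_deriv L \<theta> p (Suc m) j k x) (at x)"
proof (induction m arbitrary: j k)
  case 0
  have "modulated_deriv L \<theta> p 0 j k = modulated L \<theta> p j k" by auto
  then show ?case using modulated_has_deriv by simp
next
  case (Suc m)
  have "modulated_deriv L \<theta> p (Suc m) j k = (\<lambda>x. modulated_deriv L \<theta> p m (Suc j) k x + modulated_deriv L \<theta> p m j (Suc k) x)"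
    by auto
  then show ?case using DERIV_add[OF Suc[of "Suc j" k] Suc[of j "Suc k"]] by simp
qed

lemma modulated_deriv_bound:
  assumes "s \<ge> 0" "q \<ge> 0" and le: "\<And>j k. \<bar>modulated L \<theta> p j k x\<bar> \<le> B * q ^ (j + k) * fact (j + k) powr s"
  shows "\<bar>modulated_deriv L \<theta> p m j k x\<bar> \<le> B * (2 * q) ^ m * q ^ (j + k) * fact (j + k + m) powr s"
proof (induction m arbitrary: j k)
  case 0
  then show ?case using le by simp
next
  case (Suc m)
  have "\<bar>modulated_deriv L \<theta> p (Suc m) j k x\<bar> \<le> \<bar>modulated_deriv L \<theta> p m (Suc j) k x\<bar> + \<bar>modulated_deriv L \<theta> p m j (Suc k) x\<bar>"
    by simp
  also have "\<dots> \<le> B * (2 * q) ^ m * q ^ (Suc j + k) * fact (Suc j + k + m) powr s +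
      B * (2 * q) ^ m * q ^ (j + Suc k) * fact (j + Suc k + m) powr s"
    by (intro add_mono Suc)
  also have "\<dots> = B * (2 * q) ^ Suc m * q ^ (j + k) * fact (j + k + Suc m) powr s"
    by simp
  finally show ?case .
qed

text \<open>The three cases in the definition of a Wilson basis are one formula: an amplitude times a cosine with a
phase times a translate of the window, see \<open>wilson1_eq\<close>.\<close>

definition amp :: "nat \<Rightarrow> real" where "amp l = (if l = 0 then 1 else sqrt 2)"
definition phase :: "nat \<Rightarrow> int \<Rightarrow> real" where "phase l n = (if l = 0 \<or> even (int l + n) then 0 else - pi / 2)"
definition centre :: "nat \<Rightarrow> int \<Rightarrow> real" where "centre l n = (if l = 0 then of_int n else of_int n / 2)"

text \<open>The derivative of order \<open>m\<close> of the basis function with frequency \<open>l\<close> and position \<open>n\<close>.\<close>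

definition wilson1_deriv :: "nat \<Rightarrow> nat \<Rightarrow> int \<Rightarrow> real \<Rightarrow> real" where
  "wilson1_deriv m l n x = amp l * modulated_deriv (2 * pi * real l) (phase l n) (centre l n) m 0 0 x"

lemma amp_bounds: "1 \<le> amp l" "amp l \<le> 2"
  by (auto simp: amp_def real_le_lsqrt)

lemma centre_bounds: "\<bar>centre l n\<bar> \<le> \<bar>of_int n\<bar>" "\<bar>of_int n\<bar> \<le> 2 * \<bar>centre l n\<bar>"
  by (auto simp: centre_def)

lemma wilson1_eq: "wilson1 \<psi> l n x = amp l * (cos (2 * pi * real l * x + phase l n) * D 0 (x - centre l n))"
  by (auto simp: wilson1_def amp_def phase_def centre_def D_0 cos_diff)

lemma wilson1_deriv_0: "wilson1_deriv 0 l n = wilson1 \<psi> l n"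
  by (auto simp: wilson1_deriv_def wilson1_eq modulated_def)

lemma wilson1_deriv_has_deriv: "(wilson1_deriv m l n has_real_derivative wilson1_deriv (Suc m) l n x) (at x)"
  unfolding wilson1_deriv_def[abs_def] by (intro DERIV_cmult modulated_deriv_has_deriv)

lemma wilson1_bound: "\<bar>wilson1 \<psi> l n x\<bar> \<le> 2 * K * exp (- c * \<bar>x - centre l n\<bar>)"
proof -
  have "\<bar>D 0 (x - centre l n)\<bar> \<le> K * exp (- c * \<bar>x - centre l n\<bar>)" using D_bound[of 0] by simp
  moreover have "\<bar>cos (2 * pi * real l * x + phase l n)\<bar> \<le> 1" by simp
  ultimately have "\<bar>cos (2 * pi * real l * x + phase l n)\<bar> * \<bar>D 0 (x - centre l n)\<bar> \<le> 1 * (K * exp (- c * \<bar>x - centre l n\<bar>))"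
    by (intro mult_mono) auto
  then have "\<bar>amp l\<bar> * (\<bar>cos (2 * pi * real l * x + phase l n)\<bar> * \<bar>D 0 (x - centre l n)\<bar>) \<le> 2 * (1 * (K * exp (- c * \<bar>x - centre l n\<bar>)))"
    using amp_bounds[of l] by (intro mult_mono[of "\<bar>amp l\<bar>"]) auto
  then show ?thesis by (simp add: wilson1_eq abs_mult)
qed

text \<open>Each factor \<open>l^j\<close> from the cosine and each factor \<open>|n|^\<alpha>\<close> from the position is turned by
\<open>power_le_gevrey\<close> into a Gevrey constant times a stretched exponential; the derivatives and moments of
the window itself fit into the Gevrey constants by \<open>analytic_le_gevrey\<close>. As \<open>q\<close> is arbitrary, the basis functions
lie in the spaces of both types, with explicit growth in \<open>l\<close> and \<open>n\<close>.\<close>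

lemma wilson1_deriv_gevrey_bound:
  assumes s: "s > 1" and q: "q > 0"
  obtains C where "C > 0"
    "\<And>\<alpha> \<beta> l n x. \<bar>x\<bar> ^ \<alpha> * \<bar>wilson1_deriv \<beta> l n x\<bar> \<le> C * (2 * q) ^ (\<alpha> + \<beta>) * (fact \<alpha> * fact \<beta>) powr s *
       exp (s * (2 * pi * real l / q) powr (1/s) + s * (\<bar>of_int n\<bar> / q) powr (1/s))"
proof -
  \<comment> \<open>\<open>C1\<close> absorbs the analytic growth of the derivatives of the window, \<open>C2\<close> that of the moments of
    the exponential \<open>exp (- c |x|)\<close>.\<close>
  obtain C1 where C1: "C1 \<ge> 1" "\<And>m. A ^ m * fact m \<le> C1 * q ^ m * fact m powr s"
    using analytic_le_gevrey[OF A_pos q s] by blast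
  obtain C2 where C2: "C2 \<ge> 1" "\<And>m. (1/c) ^ m * fact m \<le> C2 * q ^ m * fact m powr s"
    using analytic_le_gevrey[of "1/c" q s] c_pos q s by auto
  define C where "C = 2 * K * C1 * (C2 + 1)"
  have Cp: "C > 0" using C1 C2 K_pos by (simp add: C_def)
  have "\<bar>x\<bar> ^ \<alpha> * \<bar>wilson1_deriv \<beta> l n x\<bar> \<le> C * (2 * q) ^ (\<alpha> + \<beta>) * (fact \<alpha> * fact \<beta>) powr s *
       exp (s * (2 * pi * real l / q) powr (1/s) + s * (\<bar>of_int n\<bar> / q) powr (1/s))" for \<alpha> \<beta> l n x
  proof -
    define L where "L = 2 * pi * real l"
    have L: "L \<ge> 0" by (simp add: L_def)
    define p where "p = centre l n"
    define EL where "EL = exp (s * (L / q) powr (1/s))"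
    define En where "En = exp (s * (\<bar>of_int n\<bar> / q) powr (1/s))"
    have En1: "En \<ge> 1" using s by (simp add: En_def)
    define B where "B = K * C1 * EL * exp (- c * \<bar>x - p\<bar>)"
    have B0: "B \<ge> 0" using K_pos C1 by (simp add: B_def EL_def)
    have P: "\<bar>modulated L (phase l n) p j k x\<bar> \<le> B * q ^ (j + k) * fact (j + k) powr s" for j k
    proof -
      have "\<bar>modulated L (phase l n) p j k x\<bar> = L ^ j * (\<bar>cos (L * x + phase l n + real j * pi / 2)\<bar> * \<bar>D k (x - p)\<bar>)"
        using L by (simp add: modulated_def abs_mult)
      also have "\<dots> \<le> (q ^ j * fact j powr s * EL) * (1 * (K * A ^ k * fact k * exp (- c * \<bar>x - p\<bar>)))"
        using power_le_gevrey[OF L q, of s j] s q L by (intro mult_mono D_bound) (auto simp: EL_def)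
      also have "\<dots> = (q ^ j * fact j powr s * EL * K * exp (- c * \<bar>x - p\<bar>)) * (A ^ k * fact k)" by simp
      also have "\<dots> \<le> (q ^ j * fact j powr s * EL * K * exp (- c * \<bar>x - p\<bar>)) * (C1 * q ^ k * fact k powr s)"
        using q K_pos by (intro mult_left_mono C1) (auto simp: EL_def)
      also have "\<dots> = B * q ^ (j + k) * (fact j powr s * fact k powr s)" by (simp add: B_def power_add mult_ac)
      also have "\<dots> \<le> B * q ^ (j + k) * fact (j + k) powr s"
        using s q B0 by (intro mult_left_mono fact_powr_mult_le) auto
      finally show ?thesis .
    qed
    have "\<bar>wilson1_deriv \<beta> l n x\<bar> \<le> 2 * (B * (2 * q) ^ \<beta> * fact \<beta> powr s)"
    proof -
      have "\<bar>modulated_deriv L (phase l n) p \<beta> 0 0 x\<bar> \<le> B * (2 * q) ^ \<beta> * q ^ (0 + 0) * fact (0 + 0 + \<beta>) powr s"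
        using s q by (intro modulated_deriv_bound P) auto
      then have "\<bar>amp l\<bar> * \<bar>modulated_deriv L (phase l n) p \<beta> 0 0 x\<bar> \<le> 2 * (B * (2 * q) ^ \<beta> * fact \<beta> powr s)"
        using amp_bounds[of l] by (intro mult_mono) auto
      then show ?thesis by (simp add: wilson1_deriv_def abs_mult L_def p_def)
    qed
    then have "\<bar>x\<bar> ^ \<alpha> * \<bar>wilson1_deriv \<beta> l n x\<bar> \<le> \<bar>x\<bar> ^ \<alpha> * (2 * (B * (2 * q) ^ \<beta> * fact \<beta> powr s))"
      by (intro mult_left_mono) auto
    also have "\<dots> = (2 * K * C1 * EL * (2 * q) ^ \<beta> * fact \<beta> powr s) * (\<bar>x\<bar> ^ \<alpha> * exp (- c * \<bar>x - p\<bar>))"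
      by (simp add: B_def)
    also have "\<dots> \<le> (2 * K * C1 * EL * (2 * q) ^ \<beta> * fact \<beta> powr s) * (2 ^ \<alpha> * ((C2 + 1) * (q ^ \<alpha> * fact \<alpha> powr s) * En))"
    proof (intro mult_left_mono)
      \<comment> \<open>Moments about \<open>0\<close> are reduced to moments about the centre \<open>p\<close>; the price is the factor
        \<open>2 ^ \<alpha>\<close> and the contribution of \<open>|p| \<le> |n|\<close>.\<close>
      have "\<bar>x\<bar> \<le> 2 * max \<bar>x - p\<bar> \<bar>p\<bar>" using abs_triangle_ineq[of "x - p" p] by (simp add: max_def)
      then have "\<bar>x\<bar> ^ \<alpha> \<le> (2 * max \<bar>x - p\<bar> \<bar>p\<bar>) ^ \<alpha>" by (intro power_mono) auto
      also have "\<dots> = 2 ^ \<alpha> * (max \<bar>x - p\<bar> \<bar>p\<bar>) ^ \<alpha>" by (simp add: power_mult_distrib)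
      also have "\<dots> \<le> 2 ^ \<alpha> * (\<bar>x - p\<bar> ^ \<alpha> + \<bar>p\<bar> ^ \<alpha>)" by (intro mult_left_mono) (auto simp: max_def)
      finally have "\<bar>x\<bar> ^ \<alpha> * exp (- c * \<bar>x - p\<bar>) \<le> 2 ^ \<alpha> * (\<bar>x - p\<bar> ^ \<alpha> + \<bar>p\<bar> ^ \<alpha>) * exp (- c * \<bar>x - p\<bar>)"
        by (intro mult_right_mono) auto
      also have "\<dots> = 2 ^ \<alpha> * (\<bar>x - p\<bar> ^ \<alpha> * exp (- c * \<bar>x - p\<bar>) + \<bar>p\<bar> ^ \<alpha> * exp (- c * \<bar>x - p\<bar>))"
        by (simp add: algebra_simps)
      also have "\<dots> \<le> 2 ^ \<alpha> * (C2 * (q ^ \<alpha> * fact \<alpha> powr s) * En + (q ^ \<alpha> * fact \<alpha> powr s) * En * 1)"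
      proof (intro mult_left_mono add_mono)
        have "\<bar>x - p\<bar> ^ \<alpha> * exp (- c * \<bar>x - p\<bar>) \<le> (1/c) ^ \<alpha> * fact \<alpha>"
        proof -
          have "(c * \<bar>x - p\<bar>) ^ \<alpha> \<le> 1 ^ \<alpha> * fact \<alpha> powr 1 * exp (1 * (c * \<bar>x - p\<bar> / 1) powr (1 / 1))"
            using c_pos by (intro power_le_gevrey) auto
          then have "(c * \<bar>x - p\<bar>) ^ \<alpha> \<le> fact \<alpha> * exp (c * \<bar>x - p\<bar>)" using c_pos by simp
          then show ?thesis using c_pos by (simp add: exp_minus power_mult_distrib field_simps)
        qed
        also have "\<dots> \<le> C2 * (q ^ \<alpha> * fact \<alpha> powr s)" using C2(2)[of \<alpha>] by (simp add: mult.assoc)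
        also have "\<dots> \<le> C2 * (q ^ \<alpha> * fact \<alpha> powr s) * En" 
          using En1 C2 q mult_left_mono[OF En1, of "C2 * (q ^ \<alpha> * fact \<alpha> powr s)"] by simp
        finally show "\<bar>x - p\<bar> ^ \<alpha> * exp (- c * \<bar>x - p\<bar>) \<le> C2 * (q ^ \<alpha> * fact \<alpha> powr s) * En" .
        have "\<bar>p\<bar> ^ \<alpha> \<le> \<bar>of_int n\<bar> ^ \<alpha>" using centre_bounds(1)[of l n] by (intro power_mono) (auto simp: p_def)
        also have "\<dots> \<le> (q ^ \<alpha> * fact \<alpha> powr s) * En"
          using power_le_gevrey[of "\<bar>of_int n\<bar>" q s \<alpha>] q s by (simp add: En_def)
        finally show "\<bar>p\<bar> ^ \<alpha> * exp (- c * \<bar>x - p\<bar>) \<le> (q ^ \<alpha> * fact \<alpha> powr s) * En * 1"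
          using q c_pos by (intro mult_mono) (auto simp: En_def)
      qed auto
      also have "\<dots> = 2 ^ \<alpha> * ((C2 + 1) * (q ^ \<alpha> * fact \<alpha> powr s) * En)" by (simp add: algebra_simps)
      finally show "\<bar>x\<bar> ^ \<alpha> * exp (- c * \<bar>x - p\<bar>) \<le> 2 ^ \<alpha> * ((C2 + 1) * (q ^ \<alpha> * fact \<alpha> powr s) * En)" .
    qed (use K_pos C1 q in \<open>auto simp: EL_def\<close>)
    also have "\<dots> = C * (2 * q) ^ (\<alpha> + \<beta>) * (fact \<alpha> * fact \<beta>) powr s * (EL * En)"
      by (simp add: C_def power_add power_mult_distrib powr_mult mult_ac)
    also have "EL * En = exp (s * (2 * pi * real l / q) powr (1/s) + s * (\<bar>of_int n\<bar> / q) powr (1/s))"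
      by (simp add: EL_def En_def L_def exp_add)
    finally show ?thesis .
  qed
  then show ?thesis using that Cp by blast
qed

end

section \<open>Derivatives of tensor products and multi-indices\<close>

lemma vec_line_component: "(x + t *\<^sub>R axis i 1) $ k = x $ k + (if k = i then t else (0::real))"
  by (simp add: axis_def)

lemma tensor_line_deriv:
  fixes f :: "'d::finite \<Rightarrow> nat \<Rightarrow> real \<Rightarrow> real"
  assumes f: "\<And>i m x. (f i m has_real_derivative f i (Suc m) x) (at x)"
  shows "((\<lambda>t. complex_of_real (\<Prod>k\<in>UNIV. f k (m k) ((x + t *\<^sub>R axis i 1) $ k))) has_vector_derivative
     of_real (\<Prod>k\<in>UNIV. f k (if k = i then Suc (m k) else m k) (x $ k))) (at 0)"
proof -
  have split: "(\<Prod>k\<in>UNIV. g k) = g i * (\<Prod>k\<in>UNIV - {i}. g k)" for g :: "'d \<Rightarrow> real"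
    by (rule prod.remove) auto
  let ?c = "\<Prod>k\<in>UNIV - {i}. f k (m k) (x $ k)"
  have "((\<lambda>t. x $ i + t) has_real_derivative 1) (at 0)" by (auto intro!: derivative_eq_intros)
  from DERIV_chain2[OF f this, of i "m i"]
  have "((\<lambda>t. f i (m i) (x $ i + t)) has_real_derivative f i (Suc (m i)) (x $ i)) (at 0)" by simp
  then have "((\<lambda>t. f i (m i) (x $ i + t) * ?c) has_real_derivative f i (Suc (m i)) (x $ i) * ?c) (at 0)"
    by (rule DERIV_cmult_right)
  then have "((\<lambda>t. complex_of_real (f i (m i) (x $ i + t) * ?c)) has_vector_derivative
      complex_of_real (f i (Suc (m i)) (x $ i) * ?c)) (at 0)"
    by (intro has_vector_derivative_of_real) (simp add: has_real_derivative_iff_has_vector_derivative)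
  moreover have "f i (m i) (x $ i + t) * ?c = (\<Prod>k\<in>UNIV. f k (m k) ((x + t *\<^sub>R axis i 1) $ k))" for t
    unfolding split vec_line_component by (auto intro!: prod.cong)
  moreover have "f i (Suc (m i)) (x $ i) * ?c = (\<Prod>k\<in>UNIV. f k (if k = i then Suc (m k) else m k) (x $ k))"
    unfolding split by (auto intro!: prod.cong)
  ultimately show ?thesis by simp
qed

text \<open>A derivative of a tensor product is the tensor product of derivatives; in particular the order of
differentiation does not matter.\<close>

lemma iter_deriv_tensor:
  fixes f :: "'d::finite \<Rightarrow> nat \<Rightarrow> real \<Rightarrow> real"
  assumes f: "\<And>i m x. (f i m has_real_derivative f i (Suc m) x) (at x)"
  shows "iter_deriv is (\<lambda>x. of_real (\<Prod>k\<in>UNIV. f k 0 (x $ k))) = (\<lambda>x. of_real (\<Prod>k\<in>UNIV. f k (count_list is k) (x $ k)))"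
proof (induction "is")
  case (Cons i "is")
  show ?case
  proof
    fix x
    have "iter_deriv (i # is) (\<lambda>x. complex_of_real (\<Prod>k\<in>UNIV. f k 0 (x $ k))) x =
      vector_derivative (\<lambda>t. complex_of_real (\<Prod>k\<in>UNIV. f k (count_list is k) ((x + t *\<^sub>R axis i 1) $ k))) (at 0)"
      by (simp only: iter_deriv.simps partial_deriv_def Cons.IH)
    also have "\<dots> = of_real (\<Prod>k\<in>UNIV. f k (if k = i then Suc (count_list is k) else count_list is k) (x $ k))"
      by (rule vector_derivative_at[OF tensor_line_deriv[where f = f, OF f]])
    also have "\<dots> = of_real (\<Prod>k\<in>UNIV. f k (count_list (i # is) k) (x $ k))"
      by (intro arg_cong[where f = complex_of_real] prod.cong) auto
    finally show "iter_deriv (i # is) (\<lambda>x. complex_of_real (\<Prod>k\<in>UNIV. f k 0 (x $ k))) x =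
      of_real (\<Prod>k\<in>UNIV. f k (count_list (i # is) k) (x $ k))" .
  qed
qed simp

lemma smooth_tensor:
  fixes f :: "'d::finite \<Rightarrow> nat \<Rightarrow> real \<Rightarrow> real"
  assumes f: "\<And>i m x. (f i m has_real_derivative f i (Suc m) x) (at x)"
  shows "smooth (\<lambda>x. of_real (\<Prod>k\<in>UNIV. f k 0 (x $ k)))"
  unfolding smooth_def iter_deriv_tensor[where f = f, OF f]
proof (intro allI conjI)
  fix "is" :: "'d list" and i x
  have c: "continuous_on UNIV (f k m)" for k m
    by (rule DERIV_continuous_on[of _ _ "f k (Suc m)"]) (use f has_field_derivative_at_within in blast)
  show "continuous_on UNIV (\<lambda>x. complex_of_real (\<Prod>k\<in>UNIV. f k (count_list is k) (x $ k)))"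
    by (intro continuous_intros continuous_on_compose2[OF c]) auto
  show "(\<lambda>t. complex_of_real (\<Prod>k\<in>UNIV. f k (count_list is k) ((x + t *\<^sub>R axis i 1) $ k))) differentiable at 0"
    using tensor_line_deriv[where f = f, OF f] by (rule differentiableI_vector)
qed

lemma count_list_replicate_eq: "count_list (replicate n a) b = (if a = b then n else 0)"
  by (induction n) auto

lemma prod_single_index: "(\<Prod>j\<in>UNIV. g (if j = i then m else 0)) = g m"
  if "g 0 = 1" for g :: "nat \<Rightarrow> real" and i :: "'d::finite"
proof -
  have "(\<Prod>j\<in>UNIV. g (if j = i then m else 0)) = (\<Prod>j\<in>UNIV. if j = i then g m else 1)"
    using that by (intro prod.cong) auto
  then show ?thesis by (simp add: prod.delta)
qed

text \<open>This makes the choice in the definition of \<open>multi_deriv\<close> meaningful.\<close>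

lemma exists_list_with_counts: "\<exists>is. \<forall>i. count_list is i = m i" for m :: "'d::finite \<Rightarrow> nat"
proof -
  obtain xs :: "'d list" where xs: "set xs = UNIV" "distinct xs" using finite_distinct_list[of "UNIV :: 'd set"] by auto
  have c: "count_list (concat (map (\<lambda>i. replicate (m i) i) ys)) j = (if j \<in> set ys then m j else 0)" if "distinct ys" for ys j
    using that by (induction ys) (auto simp: count_list_append count_list_replicate_eq)
  show ?thesis using c[OF xs(2)] xs(1) by (intro exI[of _ "concat (map (\<lambda>i. replicate (m i) i) xs)"]) auto
qed

lemma multi_deriv_eq:
  obtains "is" where "\<And>i. count_list is i = \<beta> $ i" "multi_deriv \<beta> = iter_deriv is"
proof -
  have "\<forall>i. count_list (SOME is. \<forall>i. count_list is i = \<beta> $ i) i = \<beta> $ i"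
    by (rule someI_ex) (rule exists_list_with_counts)
  then show ?thesis using that unfolding multi_deriv_def by blast
qed

text \<open>For a pure derivative in one direction there is only one list to choose, so
that it is an iterated derivative along a line.\<close>

lemma multi_deriv_single: "multi_deriv (\<chi> j. if j = i then m else 0) = iter_deriv (replicate m i)"
proof -
  obtain "is" where "is": "\<And>j. count_list is j = (if j = i then m else 0)"
     "multi_deriv (\<chi> j. if j = i then m else 0) = iter_deriv is"
    using multi_deriv_eq[of "\<chi> j. if j = i then m else 0"] by auto
  have "set is \<subseteq> {i}"
  proof
    fix j assume "j \<in> set is"
    then have "count_list is j \<noteq> 0" by (simp add: count_list_0_iff)
    then show "j \<in> {i}" using "is"(1)[of j] by (auto split: if_splits)
  qed
  then have *: "is = replicate (length is) i" by (intro replicate_eqI) auto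
  have "count_list (replicate (length is) i) i = length is" by (simp add: count_list_replicate_eq)
  then have "length is = m" using "is"(1)[of i] * by simp
  then show ?thesis using "is"(2) * by simp
qed

section \<open>Gelfand-Shilov norms\<close>

definition monomial :: "nat^'d::finite \<Rightarrow> real^'d \<Rightarrow> real" where
  "monomial \<alpha> x = (\<Prod>i\<in>UNIV. x $ i ^ (\<alpha> $ i))"

text \<open>The denominators in the norm: the size allowed for \<open>x\<^sup>\<alpha> \<partial>\<^sup>\<beta> f\<close>.\<close>

definition gs_weight :: "real \<Rightarrow> real \<Rightarrow> nat^'d::finite \<Rightarrow> nat^'d \<Rightarrow> real" where
  "gs_weight s h \<alpha> \<beta> = h ^ (\<Sum>i\<in>UNIV. \<alpha> $ i + \<beta> $ i) *
        ((\<Prod>i\<in>UNIV. fact (\<alpha> $ i)) * (\<Prod>i\<in>UNIV. fact (\<beta> $ i))) powr s"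

lemma gs_weight_pos: "h > 0 \<Longrightarrow> gs_weight s h \<alpha> \<beta> > 0"
  unfolding gs_weight_def by (intro mult_pos_pos) (auto intro!: prod_pos)

lemma gs_weight_prod:
  "gs_weight s h \<alpha> \<beta> = (\<Prod>i\<in>UNIV. h ^ (\<alpha> $ i + \<beta> $ i) * (fact (\<alpha> $ i) * fact (\<beta> $ i)) powr s)"
  unfolding gs_weight_def by (simp add: power_sum prod.distrib[symmetric] prod_powr_distrib)

lemma gs_norm_alt: "gs_norm s h f = (SUP \<alpha>. SUP \<beta>. SUP x.
     ennreal (norm (of_real (monomial \<alpha> x) * multi_deriv \<beta> f x) / gs_weight s h \<alpha> \<beta>))"
  unfolding gs_norm_def monomial_def gs_weight_def ..

lemma gs_norm_leI:
  assumes "h > 0" "\<And>\<alpha> \<beta> x. norm (of_real (monomial \<alpha> x) * multi_deriv \<beta> f x) \<le> B * gs_weight s h \<alpha> \<beta>"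
  shows "gs_norm s h f \<le> ennreal B"
  unfolding gs_norm_alt
  using assms by (intro SUP_least ennreal_leI) (auto simp: pos_divide_le_eq gs_weight_pos)

lemma gs_norm_bound:
  assumes h: "h > 0" and fin: "gs_norm s h f < \<infinity>"
  shows "norm (of_real (monomial \<alpha> x) * multi_deriv \<beta> f x) \<le> enn2real (gs_norm s h f) * gs_weight s h \<alpha> \<beta>"
proof -
  have "ennreal (norm (of_real (monomial \<alpha> x) * multi_deriv \<beta> f x) / gs_weight s h \<alpha> \<beta>) \<le> gs_norm s h f"
    unfolding gs_norm_alt by (intro SUP_upper2[of \<alpha>] SUP_upper2[of \<beta>] SUP_upper2[of x]) auto
  then have "norm (of_real (monomial \<alpha> x) * multi_deriv \<beta> f x) / gs_weight s h \<alpha> \<beta> \<le> enn2real (gs_norm s h f)"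
    using enn2real_mono[of "ennreal (norm (of_real (monomial \<alpha> x) * multi_deriv \<beta> f x) / gs_weight s h \<alpha> \<beta>)"] fin gs_weight_pos[OF h, of s \<alpha> \<beta>]
    by simp
  then show ?thesis using gs_weight_pos[OF h, of s \<alpha> \<beta>] by (simp add: pos_divide_le_eq)
qed

text \<open>The input from \<open>f\<close> for the integrations by parts in \<open>coef_frequency_decay\<close>.\<close>

lemma gs_norm_deriv_bound:
  assumes h: "h > 0" and fin: "gs_norm s h f < \<infinity>"
  shows "norm (iter_deriv (replicate m i) f x) \<le> enn2real (gs_norm s h f) * h ^ m * fact m powr s"
proof -
  have "(\<Sum>j\<in>UNIV. (if j = i then m else 0)) = m" "(\<Prod>j\<in>UNIV. fact (if j = i then m else 0)) = (fact m :: real)"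
    using prod_single_index[of fact] by simp_all
  then show ?thesis
    using gs_norm_bound[OF h fin, of 0 x "\<chi> j. if j = i then m else 0"]
    by (simp add: multi_deriv_single monomial_def gs_weight_def mult.assoc)
qed

lemma multi_deriv_0: "multi_deriv 0 f = f"
proof -
  obtain "is" where "is": "\<And>i. count_list is i = (0 :: nat^'a) $ i" "multi_deriv (0 :: nat^'a) = iter_deriv is"
    using multi_deriv_eq by metis
  have "is = []" using "is"(1) by (cases "is") (auto split: if_splits, metis One_nat_def add_gr_0 less_numeral_extra(1,3))
  then show ?thesis using "is"(2) by simp
qed

lemma gs_norm_moment_bound:
  assumes h: "h > 0" and fin: "gs_norm s h f < \<infinity>"
  shows "norm (of_real (monomial \<alpha> x) * f x) \<le> enn2real (gs_norm s h f) * gs_weight s h \<alpha> 0"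
  using gs_norm_bound[OF h fin, of \<alpha> x 0] by (simp add: multi_deriv_0)

lemma gs_norm_power_bound:
  assumes h: "h > 0" and fin: "gs_norm s h f < \<infinity>"
  shows "\<bar>x $ i\<bar> ^ m * norm (f x) \<le> enn2real (gs_norm s h f) * h ^ m * fact m powr s"
proof -
  have 1: "(\<Sum>j\<in>UNIV. (if j = i then m else 0)) = m" "(\<Prod>j\<in>UNIV. fact (if j = i then m else 0)) = (fact m :: real)"
    using prod_single_index[of fact] by simp_all
  have "monomial (\<chi> j. if j = i then m else 0) x = (\<Prod>j\<in>UNIV. if j = i then x $ i ^ m else 1)"
    unfolding monomial_def by (rule prod.cong) auto
  also have "\<dots> = x $ i ^ m" by (simp add: prod.delta)
  finally show ?thesis
    using gs_norm_moment_bound[OF h fin, of "\<chi> j. if j = i then m else 0" x] 1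
    by (simp add: gs_weight_def norm_mult norm_power mult.assoc)
qed

section \<open>Linear structure of the Gelfand-Shilov spaces\<close>

lemma smooth_line_deriv:
  assumes "smooth f"
  shows "((\<lambda>t. iter_deriv is f (x + t *\<^sub>R axis i 1)) has_vector_derivative iter_deriv (i # is) f x) (at 0)"
  using assms unfolding smooth_def by (auto simp: partial_deriv_def[abs_def] intro!: vector_derivative_works[THEN iffD1])

lemma smooth_continuous: "smooth f \<Longrightarrow> continuous_on UNIV (iter_deriv is f)"
  unfolding smooth_def by blast

lemma iter_deriv_add:
  assumes "smooth f" "smooth g"
  shows "iter_deriv is (\<lambda>x. f x + g x) = (\<lambda>x. iter_deriv is f x + iter_deriv is g x)"
proof (induction "is")
  case (Cons i "is")
  show ?case
    by (rule ext) (simp only: iter_deriv.simps(2) Cons partial_deriv_def[of i "\<lambda>x. iter_deriv is f x + iter_deriv is g x"]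
      vector_derivative_at[OF has_vector_derivative_add[OF smooth_line_deriv[OF assms(1)] smooth_line_deriv[OF assms(2)]]])
qed simp

lemma smooth_add:
  assumes "smooth f" "smooth g"
  shows "smooth (\<lambda>x. f x + g x)"
  unfolding smooth_def iter_deriv_add[OF assms]
proof (intro allI conjI)
  fix "is" i x
  show "continuous_on UNIV (\<lambda>x. iter_deriv is f x + iter_deriv is g x)"
    by (intro continuous_intros smooth_continuous assms)
  show "(\<lambda>t. iter_deriv is f (x + t *\<^sub>R axis i 1) + iter_deriv is g (x + t *\<^sub>R axis i 1)) differentiable at 0"
    by (rule differentiableI_vector[OF has_vector_derivative_add[OF smooth_line_deriv[OF assms(1)] smooth_line_deriv[OF assms(2)]]])
qed

lemma iter_deriv_cmult:
  assumes "smooth f"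
  shows "iter_deriv is (\<lambda>x. c * f x) = (\<lambda>x. c * iter_deriv is f x)"
proof (induction "is")
  case (Cons i "is")
  show ?case
    by (rule ext) (simp only: iter_deriv.simps(2) Cons partial_deriv_def[of i "\<lambda>x. c * iter_deriv is f x"]
      vector_derivative_at[OF has_vector_derivative_mult_right[OF smooth_line_deriv[OF assms(1)]]])
qed simp

lemma smooth_cmult:
  assumes "smooth f"
  shows "smooth (\<lambda>x. c * f x)"
  unfolding smooth_def iter_deriv_cmult[OF assms]
proof (intro allI conjI)
  fix "is" i x
  show "continuous_on UNIV (\<lambda>x. c * iter_deriv is f x)"
    by (intro continuous_intros smooth_continuous assms)
  show "(\<lambda>t. c * iter_deriv is f (x + t *\<^sub>R axis i 1)) differentiable at 0"
    by (rule differentiableI_vector[OF has_vector_derivative_mult_right[OF smooth_line_deriv[OF assms(1)]]])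
qed

lemma multi_deriv_add: "smooth f \<Longrightarrow> smooth g \<Longrightarrow> multi_deriv \<beta> (\<lambda>x. f x + g x) x = multi_deriv \<beta> f x + multi_deriv \<beta> g x"
  unfolding multi_deriv_def by (simp add: iter_deriv_add)

lemma multi_deriv_cmult: "smooth f \<Longrightarrow> multi_deriv \<beta> (\<lambda>x. c * f x) x = c * multi_deriv \<beta> f x"
  unfolding multi_deriv_def by (simp add: iter_deriv_cmult)

lemma gs_norm_add:
  assumes "smooth f" "smooth g" "h > 0"
  shows "gs_norm s h (\<lambda>x. f x + g x) \<le> gs_norm s h f + gs_norm s h g"
proof (cases "gs_norm s h f < \<infinity> \<and> gs_norm s h g < \<infinity>")
  case True
  have "gs_norm s h (\<lambda>x. f x + g x) \<le> ennreal (enn2real (gs_norm s h f) + enn2real (gs_norm s h g))"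
  proof (rule gs_norm_leI[OF assms(3)])
    fix \<alpha> \<beta> x
    have "norm (of_real (monomial \<alpha> x) * multi_deriv \<beta> (\<lambda>x. f x + g x) x) \<le>
        norm (of_real (monomial \<alpha> x) * multi_deriv \<beta> f x) + norm (of_real (monomial \<alpha> x) * multi_deriv \<beta> g x)"
      unfolding multi_deriv_add[OF assms(1,2)] distrib_left by (rule norm_triangle_ineq)
    also have "\<dots> \<le> enn2real (gs_norm s h f) * gs_weight s h \<alpha> \<beta> + enn2real (gs_norm s h g) * gs_weight s h \<alpha> \<beta>"
      using True by (intro add_mono gs_norm_bound assms) auto
    finally show "norm (of_real (monomial \<alpha> x) * multi_deriv \<beta> (\<lambda>x. f x + g x) x) \<le>
       (enn2real (gs_norm s h f) + enn2real (gs_norm s h g)) * gs_weight s h \<alpha> \<beta>" by (simp add: distrib_right)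
  qed
  then show ?thesis using True by (simp add: ennreal_plus)
next
  case False
  then show ?thesis by (auto simp: less_top[symmetric])
qed

lemma gs_norm_cmult_le:
  assumes "smooth f" "h > 0" "gs_norm s h f < \<infinity>"
  shows "gs_norm s h (\<lambda>x. c * f x) \<le> ennreal (norm c * enn2real (gs_norm s h f))"
proof (rule gs_norm_leI[OF assms(2)])
  fix \<alpha> \<beta> x
  have "norm (of_real (monomial \<alpha> x) * multi_deriv \<beta> (\<lambda>x. c * f x) x) = norm c * norm (of_real (monomial \<alpha> x) * multi_deriv \<beta> f x)"
    unfolding multi_deriv_cmult[OF assms(1)] by (simp add: norm_mult)
  also have "\<dots> \<le> norm c * (enn2real (gs_norm s h f) * gs_weight s h \<alpha> \<beta>)"
    by (intro mult_left_mono gs_norm_bound assms) auto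
  finally show "norm (of_real (monomial \<alpha> x) * multi_deriv \<beta> (\<lambda>x. c * f x) x) \<le> norm c * enn2real (gs_norm s h f) * gs_weight s h \<alpha> \<beta>"
    by (simp add: mult.assoc)
qed

lemma gs_step_add: "h > 0 \<Longrightarrow> f \<in> gs_step s h \<Longrightarrow> g \<in> gs_step s h \<Longrightarrow> (\<lambda>x. f x + g x) \<in> gs_step s h"
  unfolding gs_step_def using gs_norm_add[of f g h s] by (auto simp: smooth_add intro: le_less_trans)

lemma gs_step_cmult: "h > 0 \<Longrightarrow> f \<in> gs_step s h \<Longrightarrow> (\<lambda>x. c * f x) \<in> gs_step s h"
  unfolding gs_step_def using gs_norm_cmult_le[of f h s c] by (auto simp: smooth_cmult intro: le_less_trans)

lemma gs_norm_antimono: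
  fixes f :: "real^'d::finite \<Rightarrow> complex"
  assumes "0 < h" "h \<le> h'" shows "gs_norm s h' f \<le> gs_norm s h f"
proof (cases "gs_norm s h f < \<infinity>")
  case True
  have "gs_norm s h' f \<le> ennreal (enn2real (gs_norm s h f))"
  proof (rule gs_norm_leI)
    fix \<alpha> \<beta> :: "nat^'d" and x
    have "gs_weight s h \<alpha> \<beta> \<le> gs_weight s h' \<alpha> \<beta>"
      unfolding gs_weight_def using assms by (intro mult_right_mono power_mono) auto
    then show "norm (of_real (monomial \<alpha> x) * multi_deriv \<beta> f x) \<le> enn2real (gs_norm s h f) * gs_weight s h' \<alpha> \<beta>"
      by (intro order_trans[OF gs_norm_bound[OF assms(1) True] mult_left_mono]) auto
  qed (use assms in auto)
  then show ?thesis using True by simp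
next
  case False then show ?thesis by (auto simp: less_top[symmetric])
qed

lemma gs_step_mono: "0 < h \<Longrightarrow> h \<le> h' \<Longrightarrow> gs_step s h \<subseteq> gs_step s h'"
  unfolding gs_step_def using gs_norm_antimono[of h h' s] by (auto intro: le_less_trans)

lemma zero_in_gs_step: "(\<lambda>x. 0) \<in> gs_step s h"
  by (simp add: gs_step_def gs_norm_zero smooth_def iter_deriv_zero)

lemma gs_roumieu_eq: "gs_roumieu s = (\<Union>h\<in>{0<..}. gs_step s h)"
  by (auto simp: gs_roumieu_def gs_step_def)

lemma gs_beurling_eq: "gs_beurling s = (\<Inter>h\<in>{0<..}. gs_step s h)"
  by (auto simp: gs_beurling_def gs_step_def) (metis greaterThan_iff zero_less_one)

lemma gs_roumieu_add:
  assumes "f \<in> gs_roumieu s" "g \<in> gs_roumieu s"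
  shows "(\<lambda>x. f x + g x) \<in> gs_roumieu s"
proof -
  obtain h1 h2 where h: "h1 > 0" "h2 > 0" "f \<in> gs_step s h1" "g \<in> gs_step s h2"
    using assms by (auto simp: gs_roumieu_eq)
  then have "f \<in> gs_step s (max h1 h2)" "g \<in> gs_step s (max h1 h2)"
    using gs_step_mono[of h1 "max h1 h2" s] gs_step_mono[of h2 "max h1 h2" s] by auto
  then have "(\<lambda>x. f x + g x) \<in> gs_step s (max h1 h2)" using h by (intro gs_step_add) auto
  then show ?thesis using h unfolding gs_roumieu_eq by (intro UN_I[of "max h1 h2"]) auto
qed

text \<open>The norm takes extended values; its real part is a seminorm on functions for which it is finite.
Homogeneity follows from the inequality, applied to \<open>c\<close> and to \<open>1/c\<close>.\<close>

lemma seminorm_on_gs_norm: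
  assumes "h > 0" "V \<subseteq> gs_step s h"
  shows "seminorm_on V (\<lambda>f. enn2real (gs_norm s h f))"
  unfolding seminorm_on_def
proof (intro conjI ballI allI)
  fix f c assume "f \<in> V"
  then have f: "smooth f" "gs_norm s h f < \<infinity>" using assms by (auto simp: gs_step_def)
  have le: "enn2real (gs_norm s h (\<lambda>x. c * f x)) \<le> norm c * enn2real (gs_norm s h f)"
    by (rule enn2real_leI[OF _ gs_norm_cmult_le[OF f(1) assms(1) f(2)]]) simp
  show "enn2real (gs_norm s h (\<lambda>x. c * f x)) = norm c * enn2real (gs_norm s h f)"
  proof (cases "c = 0")
    case True then show ?thesis by (simp add: gs_norm_zero)
  next
    case False
    have f': "smooth (\<lambda>x. c * f x)" "gs_norm s h (\<lambda>x. c * f x) < \<infinity>"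
      using smooth_cmult[OF f(1)] gs_norm_cmult_le[OF f(1) assms(1) f(2), of c] by (auto intro: le_less_trans)
    have "enn2real (gs_norm s h (\<lambda>x. (1/c) * (c * f x))) \<le> norm (1/c) * enn2real (gs_norm s h (\<lambda>x. c * f x))"
      by (rule enn2real_leI[OF _ gs_norm_cmult_le[OF f'(1) assms(1) f'(2)]]) simp
    then have "norm c * enn2real (gs_norm s h f) \<le> enn2real (gs_norm s h (\<lambda>x. c * f x))"
      using False by (simp add: norm_divide field_simps)
    then show ?thesis using le by simp
  qed
next
  fix f g assume "f \<in> V" "g \<in> V"
  then have f: "smooth f" "gs_norm s h f < \<infinity>" "smooth g" "gs_norm s h g < \<infinity>" using assms by (auto simp: gs_step_def)
  have "gs_norm s h (\<lambda>x. f x + g x) \<le> ennreal (enn2real (gs_norm s h f) + enn2real (gs_norm s h g))"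
    using gs_norm_add[OF f(1,3) assms(1), of s] f by (simp add: ennreal_plus)
  then show "enn2real (gs_norm s h (\<lambda>x. f x + g x)) \<le> enn2real (gs_norm s h f) + enn2real (gs_norm s h g)"
    by (intro enn2real_leI) auto
qed simp

section \<open>Integration of tensor products and integration by parts\<close>

text \<open>Fubini: the Lebesgue measure is the image of the product measure over \<open>Basis\<close>, and \<open>ix\<close> translates
unit vectors into coordinate indices.\<close>

lemma
  fixes f :: "'d::finite \<Rightarrow> real \<Rightarrow> 'b::{real_normed_field,banach,second_countable_topology}"
  assumes f: "\<And>i. integrable lborel (f i)"
  shows integrable_tensor: "integrable lborel (\<lambda>x::real^'d. \<Prod>i\<in>UNIV. f i (x $ i))"
    and integral_tensor: "(LINT x|lborel. (\<Prod>i\<in>UNIV. f i ((x::real^'d) $ i))) = (\<Prod>i\<in>UNIV. (LINT t|lborel. f i t))"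
proof -
  define ix :: "real^'d \<Rightarrow> 'd" where "ix = the_inv (\<lambda>i. axis i 1)"
  have inj: "inj (\<lambda>i::'d. axis i (1::real))" by (auto simp: inj_def axis_eq_axis)
  have ix: "ix (axis i 1) = i" for i unfolding ix_def by (rule the_inv_f_f[OF inj])
  have B: "(Basis :: (real^'d) set) = range (\<lambda>i. axis i 1)" by (auto simp: Basis_vec_def)
  have re: "(\<Prod>b\<in>Basis. g (ix b)) = (\<Prod>i\<in>UNIV. g i)" for g :: "'d \<Rightarrow> 'b"
    unfolding B by (subst prod.reindex[OF inj]) (simp add: ix)
  interpret product_sigma_finite "\<lambda>_::real^'d. lborel :: real measure" ..
  let ?T = "\<lambda>\<phi>::real^'d \<Rightarrow> real. \<Sum>b\<in>Basis. \<phi> b *\<^sub>R b"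
  have comp: "?T \<phi> $ i = \<phi> (axis i 1)" for \<phi> i
  proof -
    have "?T \<phi> \<bullet> axis i 1 = \<phi> (axis i 1)" by (rule inner_sum_left_Basis) (auto simp: B)
    then show ?thesis by (simp add: cart_eq_inner_axis)
  qed
  have prodeq: "(\<Prod>i\<in>UNIV. f i (?T \<phi> $ i)) = (\<Prod>b\<in>Basis. f (ix b) (\<phi> b))" for \<phi>
  proof -
    have "(\<Prod>b\<in>Basis. f (ix b) (\<phi> b)) = (\<Prod>i\<in>UNIV. f (ix (axis i 1)) (\<phi> (axis i 1)))"
      unfolding B by (subst prod.reindex[OF inj]) simp
    then show ?thesis by (simp only: comp ix)
  qed
  have [measurable]: "f i \<in> borel_measurable borel" for i using f[of i] by auto
  have m: "(\<lambda>x::real^'d. \<Prod>i\<in>UNIV. f i (x $ i)) \<in> borel_measurable borel" by measurable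
  have Tm: "?T \<in> measurable (Pi\<^sub>M Basis (\<lambda>_. lborel)) borel" by measurable
  have le: "lborel = distr (Pi\<^sub>M (Basis :: (real^'d) set) (\<lambda>_. lborel)) borel ?T" by (rule lborel_eq)
  have i1: "integrable (Pi\<^sub>M Basis (\<lambda>_. lborel)) (\<lambda>\<phi>. \<Prod>b\<in>Basis. f (ix b) (\<phi> b))"
    by (rule product_integrable_prod) (auto intro: f)
  show "integrable lborel (\<lambda>x::real^'d. \<Prod>i\<in>UNIV. f i (x $ i))"
    by (subst le, subst integrable_distr_eq[OF Tm m]) (simp only: prodeq i1)
  have "(LINT x|lborel. (\<Prod>i\<in>UNIV. f i ((x::real^'d) $ i))) = (LINT \<phi>|(Pi\<^sub>M Basis (\<lambda>_. lborel)). (\<Prod>b\<in>Basis. f (ix b) (\<phi> b)))"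
    by (subst le, subst integral_distr[OF Tm m]) (simp only: prodeq)
  also have "\<dots> = (\<Prod>b\<in>Basis. (LINT t|lborel. f (ix b) t))"
    by (rule product_integral_prod) (auto intro: f)
  also have "\<dots> = (\<Prod>i\<in>UNIV. (LINT t|lborel. f i t))" by (rule re)
  finally show "(LINT x|lborel. (\<Prod>i\<in>UNIV. f i ((x::real^'d) $ i))) = (\<Prod>i\<in>UNIV. (LINT t|lborel. f i t))" .
qed

text \<open>The integrable majorant of a basis function centred at \<open>p\<close>. Its integral does not depend on \<open>p\<close>, which
makes all estimates uniform in the position, and it changes by a bounded factor under unit shifts.\<close>

definition exp_tensor :: "real \<Rightarrow> ('d::finite \<Rightarrow> real) \<Rightarrow> real^'d \<Rightarrow> real" where
  "exp_tensor c p x = (\<Prod>i\<in>UNIV. exp (- c * \<bar>x $ i - p i\<bar>))"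

lemma exp_tensor_pos: "exp_tensor c p x > 0"
  unfolding exp_tensor_def by (intro prod_pos) auto

lemma integrable_exp_abs_shift: "c > 0 \<Longrightarrow> integrable lborel (\<lambda>t::real. exp (- c * \<bar>t - p\<bar>))"
  using lborel_integrable_real_affine[OF integrable_exp_abs[of c], of 1 "-p"] by simp

lemma integrable_exp_tensor: "c > 0 \<Longrightarrow> integrable lborel (exp_tensor c p)"
  unfolding exp_tensor_def[abs_def] by (intro integrable_tensor integrable_exp_abs_shift)

lemma integral_exp_tensor: "c > 0 \<Longrightarrow> (LINT x|lborel. exp_tensor c (p :: 'd::finite \<Rightarrow> real) x) = (LINT t|lborel. exp (- c * \<bar>t\<bar>)) ^ CARD('d)"
proof -
  assume c: "c > 0"
  have "(LINT t|lborel. exp (- c * \<bar>t - p\<bar>)) = (LINT t|lborel. exp (- c * \<bar>t\<bar>))" for p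
    using lborel_integral_real_affine[of 1 "\<lambda>t. exp (- c * \<bar>t - p\<bar>)" p] by simp
  then show ?thesis
    unfolding exp_tensor_def using integrable_exp_abs_shift[OF c] by (subst integral_tensor) auto
qed

lemma exp_tensor_shift:
  assumes "c > 0" "\<bar>t\<bar> \<le> 1"
  shows "exp_tensor c p (x + t *\<^sub>R axis i 1) \<le> exp c * exp_tensor c p x"
proof -
  have split: "(\<Prod>k\<in>UNIV. g k) = g i * (\<Prod>k\<in>UNIV - {i}. g k)" for g :: "'a \<Rightarrow> real"
    by (rule prod.remove) auto
  have "exp (- c * \<bar>x $ i + t - p i\<bar>) \<le> exp c * exp (- c * \<bar>x $ i - p i\<bar>)"
  proof -
    have "\<bar>x $ i - p i\<bar> \<le> \<bar>x $ i + t - p i\<bar> + 1" using assms(2) by linarith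
    then have "c * \<bar>x $ i - p i\<bar> \<le> c * (\<bar>x $ i + t - p i\<bar> + 1)" using assms(1) by (intro mult_left_mono) auto
    then show ?thesis by (simp add: exp_add[symmetric] algebra_simps)
  qed
  then have "exp (- c * \<bar>x $ i + t - p i\<bar>) * (\<Prod>k\<in>UNIV - {i}. exp (- c * \<bar>x $ k - p k\<bar>)) \<le>
     exp c * exp (- c * \<bar>x $ i - p i\<bar>) * (\<Prod>k\<in>UNIV - {i}. exp (- c * \<bar>x $ k - p k\<bar>))"
    by (intro mult_right_mono prod_nonneg) auto
  then show ?thesis unfolding exp_tensor_def split vec_line_component by simp
qed

text \<open>Integration by parts in the form \<open>\<integral> \<partial>\<^sub>e F = 0\<close>. Difference quotients of \<open>F\<close> have integral zero by
translation invariance, and they converge dominatedly.\<close>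

lemma integral_line_deriv_zero:
  fixes F F' :: "'a::euclidean_space \<Rightarrow> complex" and \<mu> :: "'a \<Rightarrow> real"
  assumes deriv: "\<And>x. ((\<lambda>t. F (x + t *\<^sub>R e)) has_vector_derivative F' x) (at 0)"
    and [measurable]: "F \<in> borel_measurable borel" "F' \<in> borel_measurable borel"
    and F: "\<And>x. norm (F x) \<le> B * \<mu> x" and F': "\<And>x. norm (F' x) \<le> B * \<mu> x"
    and \<mu>: "integrable lborel \<mu>" "\<And>x t. \<bar>t\<bar> \<le> 1 \<Longrightarrow> \<mu> (x + t *\<^sub>R e) \<le> M * \<mu> x" and B: "B \<ge> 0"
  shows "(LINT x|lborel. F' x) = 0"
proof -
  have d: "((\<lambda>t. F (x + t *\<^sub>R e)) has_vector_derivative F' (x + t *\<^sub>R e)) (at t)" for x t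
  proof -
    have "((\<lambda>r. r - t) has_vector_derivative 1) (at t)" by (auto intro!: derivative_eq_intros)
    moreover have "((\<lambda>r. F ((x + t *\<^sub>R e) + r *\<^sub>R e)) has_vector_derivative F' (x + t *\<^sub>R e)) (at (t - t))"
      using deriv[of "x + t *\<^sub>R e"] by simp
    ultimately have "((\<lambda>r. F ((x + t *\<^sub>R e) + r *\<^sub>R e)) \<circ> (\<lambda>r. r - t) has_vector_derivative 1 *\<^sub>R F' (x + t *\<^sub>R e)) (at t)"
      by (rule vector_diff_chain_at)
    then show ?thesis by (simp add: o_def algebra_simps)
  qed
  define h where "h k = 1 / real (Suc k)" for k
  have h: "h k > 0" "h k \<le> 1" for k by (auto simp: h_def)
  have h0: "h \<longlonglongrightarrow> 0" unfolding h_def using LIMSEQ_inverse_real_of_nat by (simp add: inverse_eq_divide)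
  let ?q = "\<lambda>k x. (F (x + h k *\<^sub>R e) - F x) /\<^sub>R h k"
  have Fi: "integrable lborel F"
    by (rule Bochner_Integration.integrable_bound[OF integrable_mult_right[OF \<mu>(1), of B]]) (use F in \<open>auto intro!: AE_I2 order_trans[OF F]\<close>)
  \<comment> \<open>Translation invariance: every difference quotient has integral zero.\<close>
  have zero: "(LINT x|lborel. ?q k x) = 0" for k
  proof -
    have le: "lborel = distr lborel borel ((+) (h k *\<^sub>R e))" by (rule lborel_distr_plus[symmetric])
    have i: "integrable lborel (\<lambda>x. F (h k *\<^sub>R e + x))"
      using Fi by (subst (asm) le, subst (asm) integrable_distr_eq) auto
    have "(LINT x|lborel. F x) = (LINT x|lborel. F (h k *\<^sub>R e + x))"
      by (subst le, subst integral_distr) auto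
    then have "(LINT x|lborel. F (h k *\<^sub>R e + x) - F x) = 0"
      using Bochner_Integration.integral_diff[OF i Fi] by simp
    then show ?thesis by (simp add: add.commute)
  qed
  \<comment> \<open>Majorant from the mean value theorem: \<open>\<mu>\<close> at a point at distance at most one along \<open>e\<close> is
    bounded by \<open>M * \<mu> x\<close>.\<close>
  have "(\<lambda>k. LINT x|lborel. ?q k x) \<longlonglongrightarrow> (LINT x|lborel. F' x)"
  proof (rule integral_dominated_convergence[where w = "\<lambda>x. B * (M * \<mu> x)"])
    show "integrable lborel (\<lambda>x. B * (M * \<mu> x))" by (intro integrable_mult_right \<mu>)
    show "AE x in lborel. (\<lambda>k. ?q k x) \<longlonglongrightarrow> F' x"
    proof (rule AE_I2)
      fix x
      have "((\<lambda>t. norm (F (x + t *\<^sub>R e) - F x - t *\<^sub>R F' x) / norm t) \<longlongrightarrow> 0) (at 0)"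
        using deriv[of x] by (simp add: has_vector_derivative_def has_derivative_at)
      moreover have "filterlim h (at 0) sequentially"
        using h(1) by (auto simp: filterlim_at h0 intro!: always_eventually less_imp_neq[symmetric])
      ultimately have "(\<lambda>k. norm (F (x + h k *\<^sub>R e) - F x - h k *\<^sub>R F' x) / norm (h k)) \<longlonglongrightarrow> 0"
        by (rule filterlim_compose)
      moreover have "norm (F (x + h k *\<^sub>R e) - F x - h k *\<^sub>R F' x) / norm (h k) = norm (?q k x - F' x)" for k
      proof -
        have "?q k x - F' x = (F (x + h k *\<^sub>R e) - F x - h k *\<^sub>R F' x) /\<^sub>R h k"
          using h(1)[of k] by (simp add: scaleR_right_diff_distrib)
        then show ?thesis by (simp add: divide_inverse mult.commute)
      qed
      ultimately show "(\<lambda>k. ?q k x) \<longlonglongrightarrow> F' x"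
        by (simp add: tendsto_norm_zero_iff LIM_zero_iff)
    qed
    show "AE x in lborel. norm (?q k x) \<le> B * (M * \<mu> x)" for k
    proof (rule AE_I2)
      fix x
      have "norm (F (x + h k *\<^sub>R e) - F (x + 0 *\<^sub>R e)) \<le> (B * (M * \<mu> x)) * norm (h k - 0)"
      proof (rule differentiable_bound)
        show "((\<lambda>t. F (x + t *\<^sub>R e)) has_derivative (\<lambda>r. r *\<^sub>R F' (x + t *\<^sub>R e))) (at t within {0..h k})" for t
          using has_vector_derivative_at_within[OF d] by (simp add: has_vector_derivative_def)
        show "onorm (\<lambda>r. r *\<^sub>R F' (x + t *\<^sub>R e)) \<le> B * (M * \<mu> x)" if "t \<in> {0..h k}" for t
        proof -
          have "\<mu> (x + t *\<^sub>R e) \<le> M * \<mu> x" using that h(2)[of k] by (intro \<mu>(2)) auto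
          then have "B * \<mu> (x + t *\<^sub>R e) \<le> B * (M * \<mu> x)" using B by (intro mult_left_mono) auto
          then have le: "norm (F' (x + t *\<^sub>R e)) \<le> B * (M * \<mu> x)" using F'[of "x + t *\<^sub>R e"] by linarith
          show ?thesis
            using mult_right_mono[OF le] by (intro onorm_bound order_trans[OF norm_ge_zero le]) (simp add: mult.commute)
        qed
      qed (use h(1)[of k] in auto)
      then have "norm (F (x + h k *\<^sub>R e) - F x) \<le> (B * (M * \<mu> x)) * h k" using h(1)[of k] by simp
      moreover have "norm (?q k x) = norm (F (x + h k *\<^sub>R e) - F x) / h k"
        using h(1)[of k] by (simp add: divide_inverse mult.commute)
      ultimately show "norm (?q k x) \<le> B * (M * \<mu> x)" using h(1)[of k] by (simp only: pos_divide_le_eq)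
    qed
  qed measurable
  then have "(\<lambda>k::nat. 0) \<longlonglongrightarrow> (LINT x|lborel. F' x)" by (simp only: zero)
  then show ?thesis by (simp only: LIMSEQ_const_iff)
qed

section \<open>Growth of the norms of the Wilson basis\<close>

context analytic_window begin

text \<open>The quantity \<open>|n/2| + |l|\<close> from the weights: the distance of the index from the origin of phase space.\<close>

definition rho :: "(nat^'d::finite) \<times> (int^'d) \<Rightarrow> real" where
  "rho k = norm (\<chi> i. of_int (snd k $ i) / 2 :: real^'d) + norm (\<chi> i. of_nat (fst k $ i) :: real^'d)"

lemma rho_nonneg: "rho k \<ge> 0" by (simp add: rho_def)

text \<open>Any norm of the coordinates is comparable with \<open>rho\<close>; this and the next lemma pass between \<open>rho\<close> and
single coordinates.\<close>

lemma rho_ge: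
  fixes k :: "(nat^'d::finite) \<times> (int^'d)"
  shows "\<bar>of_int (snd k $ i)\<bar> / 2 \<le> rho k" "of_nat (fst k $ i) \<le> rho k"
  using component_le_norm_cart[of "\<chi> i. of_int (snd k $ i) / 2 :: real^'d" i]
    component_le_norm_cart[of "\<chi> i. of_nat (fst k $ i) :: real^'d" i]
  by (auto simp: rho_def intro: add_increasing add_increasing2)

lemma rho_le:
  fixes k :: "(nat^'d::finite) \<times> (int^'d)"
  shows "rho k \<le> (\<Sum>i\<in>UNIV. \<bar>of_int (snd k $ i)\<bar> / 2 + of_nat (fst k $ i))"
  using norm_le_l1_cart[of "\<chi> i. of_int (snd k $ i) / 2 :: real^'d"] norm_le_l1_cart[of "\<chi> i. of_nat (fst k $ i) :: real^'d"]
  by (simp add: rho_def sum.distrib)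

lemma wilson_eq: "wilson \<psi> k = (\<lambda>x. of_real (\<Prod>i\<in>UNIV. wilson1_deriv 0 (fst k $ i) (snd k $ i) (x $ i)))"
  by (cases k) (simp add: wilson_def wilson1_deriv_0)

lemma smooth_wilson: "smooth (wilson \<psi> k)"
  unfolding wilson_eq by (rule smooth_tensor[of "\<lambda>i m. wilson1_deriv m (fst k $ i) (snd k $ i)"]) (rule wilson1_deriv_has_deriv)

lemma iter_deriv_wilson:
  "iter_deriv is (wilson \<psi> k) = (\<lambda>x. of_real (\<Prod>i\<in>UNIV. wilson1_deriv (count_list is i) (fst k $ i) (snd k $ i) (x $ i)))"
  unfolding wilson_eq by (rule iter_deriv_tensor[of "\<lambda>i m. wilson1_deriv m (fst k $ i) (snd k $ i)"]) (rule wilson1_deriv_has_deriv)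

text \<open>The first basic estimate: growth of the norms of the basis functions. It is the product over the
coordinates of \<open>wilson1_deriv_gevrey_bound\<close>. The constant \<open>\<kappa>\<close> does not depend on \<open>h\<close>; the dependence on \<open>h\<close> is only
through \<open>rho k / h\<close>.\<close>

lemma gs_norm_wilson:
  assumes s: "s > 1"
  obtains \<kappa> where "\<kappa> > 0"
    "\<And>h. h > 0 \<Longrightarrow> \<exists>C>0. \<forall>k :: (nat^'d::finite) \<times> (int^'d). gs_norm s h (wilson \<psi> k) \<le> ennreal (C * exp (\<kappa> * (rho k / h) powr (1/s)))"
proof -
  define \<kappa> where "\<kappa> = real CARD('d) * (2 * s * (4 * pi) powr (1/s))"
  have \<kappa>: "\<kappa> > 0" using s by (simp add: \<kappa>_def)
  have "\<exists>C>0. \<forall>k :: (nat^'d) \<times> (int^'d). gs_norm s h (wilson \<psi> k) \<le> ennreal (C * exp (\<kappa> * (rho k / h) powr (1/s)))"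
    if h: "h > 0" for h
  proof -
    \<comment> \<open>The one-dimensional bound for \<open>q = h / 2\<close> carries powers of \<open>2 * q = h\<close>.\<close>
    have h2: "h / 2 > 0" using h by simp
    obtain C where C: "C > 0" "\<And>\<alpha> \<beta> l n x. \<bar>x\<bar> ^ \<alpha> * \<bar>wilson1_deriv \<beta> l n x\<bar> \<le> C * (2 * (h/2)) ^ (\<alpha> + \<beta>) * (fact \<alpha> * fact \<beta>) powr s *
       exp (s * (2 * pi * real l / (h/2)) powr (1/s) + s * (\<bar>of_int n\<bar> / (h/2)) powr (1/s))"
      using wilson1_deriv_gevrey_bound[OF s h2] by blast
    have "gs_norm s h (wilson \<psi> k) \<le> ennreal (C ^ CARD('d) * exp (\<kappa> * (rho k / h) powr (1/s)))"
      for k :: "(nat^'d) \<times> (int^'d)"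
    proof (rule gs_norm_leI[OF h])
      fix \<alpha> \<beta> :: "nat^'d" and x
      define E where "E = exp (2 * s * (4 * pi) powr (1/s) * (rho k / h) powr (1/s))"
      have Ei: "exp (s * (2 * pi * real (fst k $ i) / (h/2)) powr (1/s) + s * (\<bar>of_int (snd k $ i)\<bar> / (h/2)) powr (1/s)) \<le> E" for i
      proof -
        have "(2 * pi * real (fst k $ i) / (h/2)) powr (1/s) \<le> (4 * pi * (rho k / h)) powr (1/s)"
          using rho_ge(2)[of k i] h s by (intro powr_mono2) (auto simp: field_simps)
        moreover have "(\<bar>of_int (snd k $ i)\<bar> / (h/2)) powr (1/s) \<le> (4 * pi * (rho k / h)) powr (1/s)"
        proof -
          have "\<bar>of_int (snd k $ i)\<bar> / (h/2) = 4 * (\<bar>of_int (snd k $ i)\<bar> / 2 / h)" by simp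
          also have "\<dots> \<le> 4 * (rho k / h)" using rho_ge(1)[of k i] h by (intro mult_left_mono divide_right_mono) auto
          also have "\<dots> \<le> 4 * pi * (rho k / h)" using pi_ge_two rho_nonneg[of k] h by (intro mult_right_mono) auto
          finally show ?thesis using h s by (intro powr_mono2) auto
        qed
        ultimately have "(2 * pi * real (fst k $ i) / (h/2)) powr (1/s) + (\<bar>of_int (snd k $ i)\<bar> / (h/2)) powr (1/s) \<le>
          2 * (4 * pi * (rho k / h)) powr (1/s)" by linarith
        also have "\<dots> = 2 * ((4 * pi) powr (1/s) * (rho k / h) powr (1/s))"
          using rho_nonneg[of k] h by (subst powr_mult) auto
        finally have "s * ((2 * pi * real (fst k $ i) / (h/2)) powr (1/s) + (\<bar>of_int (snd k $ i)\<bar> / (h/2)) powr (1/s)) \<le>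
          s * (2 * ((4 * pi) powr (1/s) * (rho k / h) powr (1/s)))" using s by (intro mult_left_mono) auto
        then show ?thesis unfolding E_def by (simp add: algebra_simps)
      qed
      obtain "is" where "is": "\<And>i. count_list is i = \<beta> $ i" "multi_deriv \<beta> = iter_deriv is" using multi_deriv_eq by blast
      have "norm (of_real (monomial \<alpha> x) * multi_deriv \<beta> (wilson \<psi> k) x) =
        (\<Prod>i\<in>UNIV. \<bar>x $ i\<bar> ^ (\<alpha> $ i) * \<bar>wilson1_deriv (\<beta> $ i) (fst k $ i) (snd k $ i) (x $ i)\<bar>)"
        unfolding "is"(2) iter_deriv_wilson monomial_def "is"(1)
        by (simp add: norm_mult prod.distrib abs_prod power_abs flip: of_real_prod)
      also have "\<dots> \<le> (\<Prod>i\<in>UNIV. C * (h ^ (\<alpha> $ i + \<beta> $ i) * (fact (\<alpha> $ i) * fact (\<beta> $ i)) powr s) * E)"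
      proof (rule prod_mono, rule conjI)
        fix i
        have "\<bar>x $ i\<bar> ^ (\<alpha> $ i) * \<bar>wilson1_deriv (\<beta> $ i) (fst k $ i) (snd k $ i) (x $ i)\<bar> \<le>
          C * (2 * (h/2)) ^ (\<alpha> $ i + \<beta> $ i) * (fact (\<alpha> $ i) * fact (\<beta> $ i)) powr s *
          exp (s * (2 * pi * real (fst k $ i) / (h/2)) powr (1/s) + s * (\<bar>of_int (snd k $ i)\<bar> / (h/2)) powr (1/s))"
          by (rule C(2))
        also have "\<dots> \<le> C * (2 * (h/2)) ^ (\<alpha> $ i + \<beta> $ i) * (fact (\<alpha> $ i) * fact (\<beta> $ i)) powr s * E"
          using C(1) h by (intro mult_left_mono Ei) auto
        finally show "\<bar>x $ i\<bar> ^ (\<alpha> $ i) * \<bar>wilson1_deriv (\<beta> $ i) (fst k $ i) (snd k $ i) (x $ i)\<bar> \<le>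
           C * (h ^ (\<alpha> $ i + \<beta> $ i) * (fact (\<alpha> $ i) * fact (\<beta> $ i)) powr s) * E" by simp
      qed auto
      also have "\<dots> = C ^ CARD('d) * E ^ CARD('d) * gs_weight s h \<alpha> \<beta>"
        unfolding prod.distrib gs_weight_prod by simp
      also have "E ^ CARD('d) = exp (\<kappa> * (rho k / h) powr (1/s))"
        unfolding E_def exp_of_nat_mult[symmetric] \<kappa>_def by (simp add: mult.assoc)
      finally show "norm (of_real (monomial \<alpha> x) * multi_deriv \<beta> (wilson \<psi> k) x) \<le>
        C ^ CARD('d) * exp (\<kappa> * (rho k / h) powr (1/s)) * gs_weight s h \<alpha> \<beta>" .
    qed
    then show ?thesis using C(1) by (intro exI[of _ "C ^ CARD('d)"]) auto
  qed
  then show ?thesis using that \<kappa> by blast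
qed

section \<open>Decay of Wilson coefficients\<close>

text \<open>The coefficient \<open>\<langle>f, \<psi>\<^sub>k\<rangle>\<close>; the basis functions are real.\<close>

definition coef :: "(real^'d::finite \<Rightarrow> complex) \<Rightarrow> (nat^'d) \<times> (int^'d) \<Rightarrow> complex" where
  "coef f k = (LINT x|lborel. wilson \<psi> k x * f x)"

abbreviation centres :: "(nat^'d::finite) \<times> (int^'d) \<Rightarrow> 'd \<Rightarrow> real" where
  "centres k \<equiv> \<lambda>i. centre (fst k $ i) (snd k $ i)"

lemma wilson_bound: "norm (wilson \<psi> (k :: (nat^'d::finite) \<times> (int^'d)) x) \<le> (2 * K) ^ CARD('d) * exp_tensor c (centres k) x"
proof -
  have "norm (wilson \<psi> k x) = (\<Prod>i\<in>UNIV. \<bar>wilson1_deriv 0 (fst k $ i) (snd k $ i) (x $ i)\<bar>)"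
    unfolding wilson_eq by (simp add: abs_prod flip: of_real_prod)
  also have "\<dots> \<le> (\<Prod>i\<in>UNIV. (2 * K) * exp (- c * \<bar>x $ i - centres k i\<bar>))"
    unfolding wilson1_deriv_0 by (intro prod_mono conjI wilson1_bound) auto
  also have "\<dots> = (2 * K) ^ CARD('d) * exp_tensor c (centres k) x"
    unfolding prod.distrib exp_tensor_def by simp
  finally show ?thesis .
qed

lemma continuous_wilson: "continuous_on UNIV (wilson \<psi> k)"
  using smooth_continuous[OF smooth_wilson, of "[]"] by simp

lemma borel_wilson [measurable]: "wilson \<psi> k \<in> borel_measurable borel"
  by (rule borel_measurable_continuous_onI[OF continuous_wilson])

lemma integrable_wilson: "integrable lborel (wilson \<psi> (k :: (nat^'d::finite) \<times> (int^'d)))"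
proof (rule Bochner_Integration.integrable_bound)
  show "integrable lborel (\<lambda>x. (2 * K) ^ CARD('d) * exp_tensor c (centres k) x)"
    by (intro integrable_mult_right integrable_exp_tensor c_pos)
  show "AE x in lborel. norm (wilson \<psi> k x) \<le> norm ((2 * K) ^ CARD('d) * exp_tensor c (centres k) x)"
    unfolding real_norm_def by (rule AE_I2) (rule order_trans[OF wilson_bound abs_ge_self])
qed measurable

lemma integrable_wilson_mult:
  assumes "f \<in> borel_measurable borel" "\<And>x. norm (f x) \<le> B"
  shows "integrable lborel (\<lambda>x. wilson \<psi> k x * f x)"
proof (rule Bochner_Integration.integrable_bound[OF integrable_mult_right[OF integrable_wilson, of B]])
  show "AE x in lborel. norm (wilson \<psi> k x * f x) \<le> norm (complex_of_real B * wilson \<psi> k x)"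
  proof (rule AE_I2)
    fix x
    have "norm (f x) \<le> \<bar>B\<bar>" using assms(2)[of x] by linarith
    then show "norm (wilson \<psi> k x * f x) \<le> norm (complex_of_real B * wilson \<psi> k x)"
      by (simp add: norm_mult mult.commute mult_right_mono)
  qed
qed (use assms(1) in measurable)

text \<open>The basis function is concentrated near \<open>n/2\<close>, and \<open>f\<close> has all moments with Gevrey constants: a power
of \<open>n\<^sub>i\<close> can be distributed to the two factors of the integrand.\<close>

lemma coef_spatial_decay:
  assumes s: "s > 1" and h: "h > 0"
  obtains B where "B > 0" "\<And>f (k :: (nat^'d::finite) \<times> (int^'d)) i m. f \<in> gs_step s h \<Longrightarrow>
      \<bar>of_int (snd k $ i)\<bar> ^ m * norm (coef f k) \<le> B * enn2real (gs_norm s h f) * (4 * h) ^ m * fact m powr s"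
proof -
  obtain C2 where C2: "C2 \<ge> 1" "\<And>m. (2/c) ^ m * fact m \<le> C2 * h ^ m * fact m powr s"
    using analytic_le_gevrey[of "2/c" h s] c_pos h s by auto
  define I where "I = (LINT t|lborel. exp (- (c/2) * \<bar>t\<bar>)) ^ CARD('d)"
  have c2: "c / 2 > 0" using c_pos by simp
  define B where "B = (2 * K) ^ CARD('d) * (1 + C2) * I"
  have "I \<ge> 0" unfolding I_def by (intro zero_le_power integral_nonneg_AE) auto
  then have B: "B \<ge> 0" using K_pos C2 by (simp add: B_def)
  have "\<bar>of_int (snd k $ i)\<bar> ^ m * norm (coef f k) \<le> B * enn2real (gs_norm s h f) * (4 * h) ^ m * fact m powr s"
    if f: "f \<in> gs_step s h" for f and k :: "(nat^'d) \<times> (int^'d)" and i m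
  proof -
    define N where "N = enn2real (gs_norm s h f)"
    have N0: "N \<ge> 0" by (simp add: N_def)
    have fs: "smooth f" "gs_norm s h f < \<infinity>" using f by (auto simp: gs_step_def)
    have [measurable]: "f \<in> borel_measurable borel"
      using smooth_continuous[OF fs(1), of "[]"] by (intro borel_measurable_continuous_onI) simp
    have fb: "norm (f x) \<le> N" for x using gs_norm_power_bound[OF h fs(2), of x i 0] by (simp add: N_def)
    let ?p = "centres k"
    let ?n = "\<bar>of_int (snd k $ i)\<bar> :: real"
    let ?G = "4 ^ m * (N * (h ^ m * fact m powr s) * ((2 * K) ^ CARD('d) * (1 + C2)))"
    have pt: "norm (of_real (?n ^ m) * (wilson \<psi> k x * f x)) \<le> ?G * exp_tensor (c/2) ?p x" for x
    proof -
      let ?y = "\<bar>x $ i - ?p i\<bar>"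
      \<comment> \<open>Either the argument of \<open>f\<close> is of size \<open>|n|/4\<close>, where \<open>f\<close> is small, or the point is that far
        from the centre, where the basis function is small.\<close>
      have n4: "?n \<le> 4 * max \<bar>x $ i\<bar> ?y" 
      proof -
        have "\<bar>?p i\<bar> \<le> \<bar>x $ i\<bar> + ?y" by linarith
        moreover have "\<bar>x $ i\<bar> + ?y \<le> 2 * max \<bar>x $ i\<bar> ?y" by (simp add: max_def)
        ultimately show ?thesis using centre_bounds(2)[of "snd k $ i" "fst k $ i"] by linarith
      qed
      have "?n ^ m \<le> (4 * max \<bar>x $ i\<bar> ?y) ^ m" using n4 by (intro power_mono) auto
      also have "\<dots> \<le> 4 ^ m * (\<bar>x $ i\<bar> ^ m + ?y ^ m)" by (simp add: power_mult_distrib max_def)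
      finally have nm: "?n ^ m \<le> 4 ^ m * (\<bar>x $ i\<bar> ^ m + ?y ^ m)" .
      \<comment> \<open>Half of the exponential is kept for integrability, the other half pays for the moment.\<close>
      have e2: "exp_tensor c ?p x \<le> exp_tensor (c/2) ?p x * exp (- (c/2) * ?y)"
      proof -
        have eq: "exp_tensor c ?p x = exp_tensor (c/2) ?p x * exp_tensor (c/2) ?p x"
          unfolding exp_tensor_def prod.distrib[symmetric] by (simp add: exp_add[symmetric])
        have "exp_tensor (c/2) ?p x \<le> exp (- (c/2) * ?y)"
        proof -
          have "exp_tensor (c/2) ?p x = exp (- (c/2) * ?y) * (\<Prod>j\<in>UNIV - {i}. exp (- (c/2) * \<bar>x $ j - ?p j\<bar>))"
            unfolding exp_tensor_def by (rule prod.remove) auto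
          also have "\<dots> \<le> exp (- (c/2) * ?y) * 1"
            using c_pos by (intro mult_left_mono prod_le_1) auto
          finally show ?thesis by simp
        qed
        then show ?thesis unfolding eq by (intro mult_left_mono less_imp_le[OF exp_tensor_pos])
      qed
      have ym: "?y ^ m * exp (- (c/2) * ?y) \<le> C2 * (h ^ m * fact m powr s)"
      proof -
        have "(c/2 * ?y) ^ m \<le> 1 ^ m * fact m powr 1 * exp (1 * (c/2 * ?y / 1) powr (1 / 1))"
          using c_pos by (intro power_le_gevrey) auto
        then have "(c/2 * ?y) ^ m \<le> fact m * exp (c/2 * ?y)" using c_pos by simp
        then have "(2/c) ^ m * ((c/2 * ?y) ^ m * exp (- (c/2 * ?y))) \<le> (2/c) ^ m * fact m"
          using c_pos by (intro mult_left_mono) (auto simp: exp_minus field_simps)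
        moreover have "(2/c) ^ m * (c/2 * ?y) ^ m = ?y ^ m"
          using c_pos by (simp add: power_mult_distrib[symmetric])
        ultimately have "?y ^ m * exp (- (c/2) * ?y) \<le> (2/c) ^ m * fact m" by (simp add: mult.assoc[symmetric])
        then show ?thesis using C2(2)[of m] by (simp add: mult.assoc)
      qed
      have xm: "\<bar>x $ i\<bar> ^ m * norm (f x) \<le> N * (h ^ m * fact m powr s)"
        using gs_norm_power_bound[OF h fs(2), of x i m] by (simp add: N_def mult.assoc)
      have e1: "exp (- (c/2) * ?y) \<le> 1" using c_pos by simp
      have "(\<bar>x $ i\<bar> ^ m + ?y ^ m) * (exp (- (c/2) * ?y) * norm (f x)) =
         (\<bar>x $ i\<bar> ^ m * norm (f x)) * exp (- (c/2) * ?y) + (?y ^ m * exp (- (c/2) * ?y)) * norm (f x)"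
        by (simp add: algebra_simps)
      also have "\<dots> \<le> (N * (h ^ m * fact m powr s)) * 1 + (C2 * (h ^ m * fact m powr s)) * N"
        using N0 h C2(1) by (intro add_mono mult_mono xm ym fb e1) auto
      also have "\<dots> = N * (h ^ m * fact m powr s) * (1 + C2)" by (simp add: algebra_simps)
      finally have main: "(\<bar>x $ i\<bar> ^ m + ?y ^ m) * (exp (- (c/2) * ?y) * norm (f x)) \<le> N * (h ^ m * fact m powr s) * (1 + C2)" .
      have "norm (of_real (?n ^ m) * (wilson \<psi> k x * f x)) = ?n ^ m * norm (wilson \<psi> k x) * norm (f x)"
        by (simp add: norm_mult norm_power)
      also have "\<dots> \<le> (4 ^ m * (\<bar>x $ i\<bar> ^ m + ?y ^ m)) * ((2 * K) ^ CARD('d) * (exp_tensor (c/2) ?p x * exp (- (c/2) * ?y))) * norm (f x)"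
      proof (intro mult_right_mono mult_mono nm)
        have "(2 * K) ^ CARD('d) * exp_tensor c ?p x \<le> (2 * K) ^ CARD('d) * (exp_tensor (c/2) ?p x * exp (- (c/2) * ?y))"
          using K_pos by (intro mult_left_mono e2) auto
        then show "norm (wilson \<psi> k x) \<le> (2 * K) ^ CARD('d) * (exp_tensor (c/2) ?p x * exp (- (c/2) * ?y))"
          using wilson_bound[of k x] by linarith
      qed auto
      also have "\<dots> = (4 ^ m * (2 * K) ^ CARD('d) * exp_tensor (c/2) ?p x) * ((\<bar>x $ i\<bar> ^ m + ?y ^ m) * (exp (- (c/2) * ?y) * norm (f x)))"
        by (simp add: mult_ac)
      also have "\<dots> \<le> (4 ^ m * (2 * K) ^ CARD('d) * exp_tensor (c/2) ?p x) * (N * (h ^ m * fact m powr s) * (1 + C2))"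
        using K_pos exp_tensor_pos[of "c/2" ?p x] by (intro mult_left_mono main) auto
      also have "\<dots> = ?G * exp_tensor (c/2) ?p x" by (simp add: mult_ac)
      finally show ?thesis .
    qed
    have "?n ^ m * norm (coef f k) = norm (LINT x|lborel. of_real (?n ^ m) * (wilson \<psi> k x * f x))"
      unfolding coef_def by (simp add: norm_mult norm_power)
    also have "\<dots> \<le> (LINT x|lborel. ?G * exp_tensor (c/2) ?p x)"
      by (intro Bochner_Integration.integral_norm_bound_integral[OF integrable_mult_right[OF integrable_wilson_mult[OF _ fb]]] pt
          integrable_mult_right integrable_exp_tensor c2) measurable
    also have "\<dots> = ?G * I" using integral_exp_tensor[OF c2, of ?p] by (simp add: I_def)
    also have "\<dots> = B * N * (4 * h) ^ m * fact m powr s"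
      by (simp add: B_def power_mult_distrib mult_ac)
    finally show ?thesis by (simp add: N_def)
  qed
  then have "\<bar>of_int (snd k $ i)\<bar> ^ m * norm (coef f k) \<le> (B + 1) * enn2real (gs_norm s h f) * (4 * h) ^ m * fact m powr s"
    if f: "f \<in> gs_step s h" for f and k :: "(nat^'d) \<times> (int^'d)" and i m
    by (rule order_trans[OF _ mult_right_mono[OF mult_right_mono[OF mult_right_mono]]]) (use that h in auto)
  then show ?thesis using that[of "B + 1"] B by auto
qed

lemma continuous_D: "continuous_on S (D k)"
  by (rule DERIV_continuous_on[of _ _ "D (Suc k)"]) (use D_deriv has_field_derivative_at_within in blast)

lemma continuous_wd: "continuous_on S (wilson1_deriv m l n)"
  by (rule DERIV_continuous_on[of _ _ "wilson1_deriv (Suc m) l n"]) (use wilson1_deriv_has_deriv has_field_derivative_at_within in blast)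

text \<open>The analogue on the Fourier side, by \<open>m\<close> integrations by parts in the direction \<open>i\<close>. Each one gains the
frequency \<open>L = 2\<pi>l\<^sub>i\<close> of the cosine and puts a derivative either on \<open>f\<close> or on the window; both bear it
with Gevrey constants. The family of integrals \<open>J\<close> is closed under this step, which makes the induction possible.\<close>

lemma coef_frequency_decay:
  assumes s: "s > 1" and h: "h > 0"
  obtains B where "B > 0" "\<And>f (k :: (nat^'d::finite) \<times> (int^'d)) i m. f \<in> gs_step s h \<Longrightarrow>
      real (fst k $ i) ^ m * norm (coef f k) \<le> B * enn2real (gs_norm s h f) * (2 * h) ^ m * fact m powr s"
proof -
  obtain C1 where C1: "C1 \<ge> 1" "\<And>m. A ^ m * fact m \<le> C1 * h ^ m * fact m powr s"
    using analytic_le_gevrey[OF A_pos h s] by blast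
  define I where "I = (LINT t|lborel. exp (- c * \<bar>t\<bar>)) ^ CARD('d)"
  define M0 where "M0 = (2 * K) ^ (CARD('d) - 1)"
  have M0: "M0 \<ge> 0" using K_pos by (simp add: M0_def)
  define B where "B = 2 * (K * M0 * I * C1)"
  have I0: "I \<ge> 0" unfolding I_def by (intro zero_le_power integral_nonneg_AE) auto
  then have B: "B \<ge> 0" using K_pos C1 M0 by (simp add: B_def)
  have "real (fst k $ i) ^ m * norm (coef f k) \<le> B * enn2real (gs_norm s h f) * (2 * h) ^ m * fact m powr s"
    if f: "f \<in> gs_step s h" for f and k :: "(nat^'d) \<times> (int^'d)" and i m
  proof -
    define N where "N = enn2real (gs_norm s h f)"
    have N0: "N \<ge> 0" by (simp add: N_def)
    have fs: "smooth f" "gs_norm s h f < \<infinity>" using f by (auto simp: gs_step_def)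
    define L where "L = 2 * pi * real (fst k $ i)"
    have L: "L \<ge> 0" "real (fst k $ i) \<le> L" using pi_ge_two by (auto simp: L_def mult_le_cancel_right1)
    let ?p = "centres k"
    define rest where "rest x = (\<Prod>j\<in>UNIV - {i}. wilson1_deriv 0 (fst k $ j) (snd k $ j) (x $ j))" for x :: "real^'d"
    \<comment> \<open>\<open>\<psi>\<^sub>k\<close> is \<open>g\<close> with \<open>\<kappa> = 0\<close> up to the amplitude. In \<open>J \<theta> j \<kappa>\<close> below, \<open>j\<close> counts the derivatives
      that have reached \<open>f\<close> and \<open>\<kappa>\<close> those on the window.\<close>
    define g where "g \<theta> \<kappa> x = cos (L * x $ i + \<theta>) * D \<kappa> (x $ i - ?p i) * rest x" for \<theta> \<kappa> and x :: "real^'d"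
    define u where "u j = iter_deriv (replicate j i) f" for j
    have rest_bound: "\<bar>rest x\<bar> \<le> M0 * (\<Prod>j\<in>UNIV - {i}. exp (- c * \<bar>x $ j - ?p j\<bar>))" for x
    proof -
      have "\<bar>rest x\<bar> \<le> (\<Prod>j\<in>UNIV - {i}. (2 * K) * exp (- c * \<bar>x $ j - ?p j\<bar>))"
        unfolding rest_def abs_prod wilson1_deriv_0 by (intro prod_mono conjI wilson1_bound) auto
      also have "\<dots> = M0 * (\<Prod>j\<in>UNIV - {i}. exp (- c * \<bar>x $ j - ?p j\<bar>))"
        unfolding prod.distrib M0_def by (simp add: card_Diff_singleton)
      finally show ?thesis .
    qed
    have g_bound: "\<bar>g \<theta> \<kappa> x\<bar> \<le> (K * A ^ \<kappa> * fact \<kappa> * M0) * exp_tensor c ?p x" for \<theta> \<kappa> x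
    proof -
      have "\<bar>g \<theta> \<kappa> x\<bar> = \<bar>cos (L * x $ i + \<theta>)\<bar> * \<bar>D \<kappa> (x $ i - ?p i)\<bar> * \<bar>rest x\<bar>" by (simp add: g_def abs_mult)
      also have "\<dots> \<le> 1 * (K * A ^ \<kappa> * fact \<kappa> * exp (- c * \<bar>x $ i - ?p i\<bar>)) * (M0 * (\<Prod>j\<in>UNIV - {i}. exp (- c * \<bar>x $ j - ?p j\<bar>)))"
        using K_pos A_pos by (intro mult_mono[OF mult_mono] D_bound rest_bound) auto
      also have "\<dots> = (K * A ^ \<kappa> * fact \<kappa> * M0) * (exp (- c * \<bar>x $ i - ?p i\<bar>) * (\<Prod>j\<in>UNIV - {i}. exp (- c * \<bar>x $ j - ?p j\<bar>)))"
        by (simp add: mult_ac)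
      also have "exp (- c * \<bar>x $ i - ?p i\<bar>) * (\<Prod>j\<in>UNIV - {i}. exp (- c * \<bar>x $ j - ?p j\<bar>)) = exp_tensor c ?p x"
        unfolding exp_tensor_def by (rule prod.remove[symmetric]) auto
      finally show ?thesis .
    qed
    have u_bound: "norm (u j x) \<le> N * h ^ j * fact j powr s" for j x
      unfolding u_def N_def by (rule gs_norm_deriv_bound[OF h fs(2)])
    have u_cont: "continuous_on UNIV (u j)" for j unfolding u_def by (rule smooth_continuous[OF fs(1)])
    have g_cont: "continuous_on UNIV (g \<theta> \<kappa>)" for \<theta> \<kappa>
      unfolding g_def[abs_def] rest_def
      by (intro continuous_intros continuous_on_compose2[OF continuous_D[of UNIV]] continuous_on_compose2[OF continuous_wd[of UNIV]]) auto
    have [measurable]: "u j \<in> borel_measurable borel" for j by (rule borel_measurable_continuous_onI[OF u_cont])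
    have [measurable]: "g \<theta> \<kappa> \<in> borel_measurable borel" for \<theta> \<kappa> by (rule borel_measurable_continuous_onI[OF g_cont])
    define J where "J \<theta> j \<kappa> = (LINT x|lborel. u j x * of_real (g \<theta> \<kappa> x))" for \<theta> j \<kappa>
    define b where "b j \<kappa> = (N * h ^ j * fact j powr s) * (K * A ^ \<kappa> * fact \<kappa> * M0)" for j \<kappa>
    have b0: "b j \<kappa> \<ge> 0" for j \<kappa> using N0 h K_pos A_pos M0 by (simp add: b_def)
    have ug: "norm (u j x * of_real (g \<theta> \<kappa> x)) \<le> b j \<kappa> * exp_tensor c ?p x" for j \<theta> \<kappa> x
    proof -
      have "norm (u j x * of_real (g \<theta> \<kappa> x)) = norm (u j x) * \<bar>g \<theta> \<kappa> x\<bar>" by (simp add: norm_mult)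
      also have "\<dots> \<le> (N * h ^ j * fact j powr s) * ((K * A ^ \<kappa> * fact \<kappa> * M0) * exp_tensor c ?p x)"
        using N0 h by (intro mult_mono u_bound g_bound) auto
      finally show ?thesis by (simp add: b_def mult.assoc)
    qed
    have int: "integrable lborel (\<lambda>x. u j x * of_real (g \<theta> \<kappa> x))" for j \<theta> \<kappa>
    proof (rule Bochner_Integration.integrable_bound)
      show "integrable lborel (\<lambda>x. b j \<kappa> * exp_tensor c ?p x)"
        by (intro integrable_mult_right integrable_exp_tensor c_pos)
      show "AE x in lborel. norm (u j x * of_real (g \<theta> \<kappa> x)) \<le> norm (b j \<kappa> * exp_tensor c ?p x)"
        unfolding real_norm_def by (rule AE_I2) (rule order_trans[OF ug abs_ge_self])
    qed measurable
    have J_bound: "norm (J \<theta> j \<kappa>) \<le> (N * K * M0 * I * C1) * h ^ (j + \<kappa>) * fact (j + \<kappa>) powr s" for \<theta> j \<kappa>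
    proof -
      have "norm (J \<theta> j \<kappa>) \<le> (LINT x|lborel. b j \<kappa> * exp_tensor c ?p x)"
        unfolding J_def by (intro Bochner_Integration.integral_norm_bound_integral int integrable_mult_right integrable_exp_tensor c_pos ug)
      also have "\<dots> = (N * h ^ j * fact j powr s * K * M0 * I) * (A ^ \<kappa> * fact \<kappa>)"
        using integral_exp_tensor[OF c_pos, of ?p] by (simp add: I_def b_def)
      also have "\<dots> \<le> (N * h ^ j * fact j powr s * K * M0 * I) * (C1 * h ^ \<kappa> * fact \<kappa> powr s)"
        using N0 h K_pos M0 I0 by (intro mult_left_mono C1) auto
      also have "\<dots> = (N * K * M0 * I * C1 * h ^ (j + \<kappa>)) * (fact j powr s * fact \<kappa> powr s)"
        by (simp add: power_add mult_ac)
      also have "\<dots> \<le> (N * K * M0 * I * C1 * h ^ (j + \<kappa>)) * fact (j + \<kappa>) powr s"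
        using N0 h K_pos M0 I0 C1 s by (intro mult_left_mono fact_powr_mult_le) auto
      finally show ?thesis .
    qed
    \<comment> \<open>Integration by parts of the cosine, which is \<open>1/L\<close> times the derivative of the cosine with phase
      shifted by \<open>- pi / 2\<close>. The product rule is applied inside \<open>?F'\<close>, whose integral vanishes.\<close>
    have step: "L * norm (J \<theta> j \<kappa>) \<le> norm (J (\<theta> - pi / 2) (Suc j) \<kappa>) + norm (J (\<theta> - pi / 2) j (Suc \<kappa>))" for \<theta> j \<kappa>
    proof -
      let ?\<theta> = "\<theta> - pi / 2"
      let ?F = "\<lambda>x. u j x * of_real (g ?\<theta> \<kappa> x)"
      let ?F' = "\<lambda>x. u j x * of_real (L * g \<theta> \<kappa> x + g ?\<theta> (Suc \<kappa>) x) + u (Suc j) x * of_real (g ?\<theta> \<kappa> x)"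
      have F'eq: "?F' x = of_real L * (u j x * of_real (g \<theta> \<kappa> x)) + u j x * of_real (g ?\<theta> (Suc \<kappa>) x) + u (Suc j) x * of_real (g ?\<theta> \<kappa> x)" for x
        by (simp add: algebra_simps)
      have "(LINT x|lborel. ?F' x) = 0"
      proof (rule integral_line_deriv_zero[where F = ?F and e = "axis i 1" and \<mu> = "exp_tensor c ?p" and M = "exp c"
            and B = "b j \<kappa> + (L * b j \<kappa> + b j (Suc \<kappa>) + b (Suc j) \<kappa>)"])
        fix x :: "real^'d"
        have rc: "rest (x + t *\<^sub>R axis i 1) = rest x" for t
          unfolding rest_def vec_line_component by (intro prod.cong) auto
        have "((\<lambda>t. g ?\<theta> \<kappa> (x + t *\<^sub>R axis i 1)) has_real_derivative L * g \<theta> \<kappa> x + g ?\<theta> (Suc \<kappa>) x) (at 0)"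
        proof -
          have "((\<lambda>t. x $ i + t - ?p i) has_real_derivative 1) (at 0)" by (auto intro!: derivative_eq_intros)
          from DERIV_chain2[OF D_deriv this, of \<kappa>]
          have d1: "((\<lambda>t. D \<kappa> (x $ i + t - ?p i)) has_real_derivative D (Suc \<kappa>) (x $ i - ?p i)) (at 0)" by simp
          have d2: "((\<lambda>t. cos (L * (x $ i + t) + ?\<theta>)) has_real_derivative L * cos (L * x $ i + \<theta>)) (at 0)"
          proof -
            have "((\<lambda>t. cos (L * (x $ i + t) + ?\<theta>)) has_real_derivative - sin (L * x $ i + ?\<theta>) * L) (at 0)"
              by (auto intro!: derivative_eq_intros)
            moreover have "- sin (L * x $ i + ?\<theta>) = cos (L * x $ i + \<theta>)"
              using minus_sin_cos_eq[of "L * x $ i + ?\<theta>"] by simp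
            ultimately show ?thesis by (simp add: mult.commute)
          qed
          have "((\<lambda>t. cos (L * (x $ i + t) + ?\<theta>) * D \<kappa> (x $ i + t - ?p i) * rest x) has_real_derivative
             (L * cos (L * x $ i + \<theta>) * D \<kappa> (x $ i - ?p i) + D (Suc \<kappa>) (x $ i - ?p i) * cos (L * x $ i + ?\<theta>)) * rest x) (at 0)"
            using DERIV_cmult_right[OF DERIV_mult[OF d2 d1], of "rest x"] by simp
          moreover have "(L * cos (L * x $ i + \<theta>) * D \<kappa> (x $ i - ?p i) + D (Suc \<kappa>) (x $ i - ?p i) * cos (L * x $ i + ?\<theta>)) * rest x =
             L * g \<theta> \<kappa> x + g ?\<theta> (Suc \<kappa>) x" by (simp add: g_def algebra_simps)
          ultimately show ?thesis unfolding g_def rc by (simp add: vec_line_component)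
        qed
        then have "((\<lambda>t. complex_of_real (g ?\<theta> \<kappa> (x + t *\<^sub>R axis i 1))) has_vector_derivative of_real (L * g \<theta> \<kappa> x + g ?\<theta> (Suc \<kappa>) x)) (at 0)"
          by (intro has_vector_derivative_of_real) (simp add: has_real_derivative_iff_has_vector_derivative)
        moreover have "((\<lambda>t. u j (x + t *\<^sub>R axis i 1)) has_vector_derivative u (Suc j) x) (at 0)"
          using smooth_line_deriv[OF fs(1), of "replicate j i" x i] by (simp add: u_def)
        ultimately show "((\<lambda>t. ?F (x + t *\<^sub>R axis i 1)) has_vector_derivative ?F' x) (at 0)"
          using has_vector_derivative_mult by fastforce
        have e0: "exp_tensor c ?p x \<ge> 0" using exp_tensor_pos[of c ?p x] by simp
        show "norm (?F x) \<le> (b j \<kappa> + (L * b j \<kappa> + b j (Suc \<kappa>) + b (Suc j) \<kappa>)) * exp_tensor c ?p x"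
          using ug[of j x ?\<theta> \<kappa>] L b0 e0 by (simp add: distrib_right add_increasing2)
        have "norm (?F' x) \<le> L * norm (u j x * of_real (g \<theta> \<kappa> x)) + norm (u j x * of_real (g ?\<theta> (Suc \<kappa>) x)) + norm (u (Suc j) x * of_real (g ?\<theta> \<kappa> x))"
          unfolding F'eq using L(1) norm_mult[of "of_real L" "u j x * of_real (g \<theta> \<kappa> x)"]
          by (intro norm_triangle_le add_mono) auto
        also have "\<dots> \<le> L * (b j \<kappa> * exp_tensor c ?p x) + b j (Suc \<kappa>) * exp_tensor c ?p x + b (Suc j) \<kappa> * exp_tensor c ?p x"
          using L by (intro add_mono mult_left_mono ug)
        finally show "norm (?F' x) \<le> (b j \<kappa> + (L * b j \<kappa> + b j (Suc \<kappa>) + b (Suc j) \<kappa>)) * exp_tensor c ?p x"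
          using mult_nonneg_nonneg[OF b0[of j \<kappa>] e0] by (simp add: algebra_simps)
      next
        show "exp_tensor c ?p (x + t *\<^sub>R axis i 1) \<le> exp c * exp_tensor c ?p x" if "\<bar>t\<bar> \<le> 1" for x t
          by (rule exp_tensor_shift[OF c_pos that])
        show "integrable lborel (exp_tensor c ?p)" by (rule integrable_exp_tensor[OF c_pos])
        show "0 \<le> b j \<kappa> + (L * b j \<kappa> + b j (Suc \<kappa>) + b (Suc j) \<kappa>)" using L b0 by (intro add_nonneg_nonneg mult_nonneg_nonneg)
      qed measurable
      then have "of_real L * J \<theta> j \<kappa> + J ?\<theta> j (Suc \<kappa>) + J ?\<theta> (Suc j) \<kappa> = 0"
        unfolding F'eq J_def using int by simp
      then have "of_real L * J \<theta> j \<kappa> = - (J ?\<theta> (Suc j) \<kappa> + J ?\<theta> j (Suc \<kappa>))"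
        by (simp add: add_eq_0_iff algebra_simps)
      then have "norm (of_real L * J \<theta> j \<kappa>) \<le> norm (J ?\<theta> (Suc j) \<kappa>) + norm (J ?\<theta> j (Suc \<kappa>))"
        by (simp only: norm_minus_cancel norm_triangle_ineq)
      then show ?thesis using L(1) by (simp add: norm_mult)
    qed
    \<comment> \<open>Each of the \<open>m\<close> steps doubles the number of terms, whence \<open>(2 * h) ^ m\<close>.\<close>
    have iter: "L ^ m * norm (J \<theta> j \<kappa>) \<le> (N * K * M0 * I * C1) * (2 * h) ^ m * h ^ (j + \<kappa>) * fact (j + \<kappa> + m) powr s" for m \<theta> j \<kappa>
    proof (induction m arbitrary: \<theta> j \<kappa>)
      case 0
      then show ?case using J_bound by simp
    next
      case (Suc m)
      have "L ^ Suc m * norm (J \<theta> j \<kappa>) = L ^ m * (L * norm (J \<theta> j \<kappa>))" by simp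
      also have "\<dots> \<le> L ^ m * (norm (J (\<theta> - pi / 2) (Suc j) \<kappa>) + norm (J (\<theta> - pi / 2) j (Suc \<kappa>)))"
        using L by (intro mult_left_mono step) auto
      also have "\<dots> = L ^ m * norm (J (\<theta> - pi / 2) (Suc j) \<kappa>) + L ^ m * norm (J (\<theta> - pi / 2) j (Suc \<kappa>))"
        by (simp add: distrib_left)
      also have "\<dots> \<le> (N * K * M0 * I * C1) * (2 * h) ^ m * h ^ (Suc j + \<kappa>) * fact (Suc j + \<kappa> + m) powr s +
          (N * K * M0 * I * C1) * (2 * h) ^ m * h ^ (j + Suc \<kappa>) * fact (j + Suc \<kappa> + m) powr s"
        by (intro add_mono Suc)
      also have "\<dots> = (N * K * M0 * I * C1) * (2 * h) ^ Suc m * h ^ (j + \<kappa>) * fact (j + \<kappa> + Suc m) powr s"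
        by simp
      finally show ?case .
    qed
    have "coef f k = of_real (amp (fst k $ i)) * J (phase (fst k $ i) (snd k $ i)) 0 0"
    proof -
      have "wilson \<psi> k x * f x = of_real (amp (fst k $ i)) * (u 0 x * of_real (g (phase (fst k $ i) (snd k $ i)) 0 x))" for x
      proof -
        have "(\<Prod>j\<in>UNIV. wilson1_deriv 0 (fst k $ j) (snd k $ j) (x $ j)) = wilson1_deriv 0 (fst k $ i) (snd k $ i) (x $ i) * rest x"
          unfolding rest_def by (rule prod.remove) auto
        then show ?thesis unfolding wilson_eq by (simp add: wilson1_deriv_0 wilson1_eq g_def L_def u_def mult_ac del: of_real_prod)
      qed
      then show ?thesis unfolding coef_def J_def by simp
    qed
    then have "norm (coef f k) = amp (fst k $ i) * norm (J (phase (fst k $ i) (snd k $ i)) 0 0)"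
      using amp_bounds(1)[of "fst k $ i"] by (simp add: norm_mult)
    also have "\<dots> \<le> 2 * norm (J (phase (fst k $ i) (snd k $ i)) 0 0)"
      using amp_bounds(2) by (intro mult_right_mono) auto
    finally have "real (fst k $ i) ^ m * norm (coef f k) \<le> L ^ m * (2 * norm (J (phase (fst k $ i) (snd k $ i)) 0 0))"
      using L by (intro mult_mono power_mono) auto
    also have "\<dots> \<le> 2 * ((N * K * M0 * I * C1) * (2 * h) ^ m * h ^ (0 + 0) * fact (0 + 0 + m) powr s)"
      using iter[of m "phase (fst k $ i) (snd k $ i)" 0 0] by simp
    also have "\<dots> = B * N * (2 * h) ^ m * fact m powr s" by (simp add: B_def mult_ac)
    finally show ?thesis by (simp add: N_def)
  qed
  then have "real (fst k $ i) ^ m * norm (coef f k) \<le> (B + 1) * enn2real (gs_norm s h f) * (2 * h) ^ m * fact m powr s"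
    if f: "f \<in> gs_step s h" for f and k :: "(nat^'d) \<times> (int^'d)" and i m
    by (rule order_trans[OF _ mult_right_mono[OF mult_right_mono[OF mult_right_mono]]]) (use that h in auto)
  then show ?thesis using that[of "B + 1"] B by auto
qed

text \<open>The second basic estimate, the counterpart of \<open>gs_norm_wilson\<close> with the opposite sign in the exponent:
moment bounds for all orders \<open>m\<close> mean stretched exponential decay, by \<open>gevrey_decay\<close>.\<close>

lemma coef_decay:
  assumes s: "s > 1"
  obtains \<kappa> where "\<kappa> > 0"
    "\<And>h. h > 0 \<Longrightarrow> \<exists>C>0. \<forall>f\<in>gs_step s h. \<forall>k :: (nat^'d::finite) \<times> (int^'d).
       norm (coef f k) \<le> C * enn2real (gs_norm s h f) * exp (- \<kappa> * (rho k / h) powr (1/s))"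
proof -
  define \<kappa> where "\<kappa> = s / 2 * (1 / (8 * real CARD('d))) powr (1/s)"
  have \<kappa>: "\<kappa> > 0" using s by (simp add: \<kappa>_def)
  have "\<exists>C>0. \<forall>f\<in>gs_step s h. \<forall>k :: (nat^'d::finite) \<times> (int^'d).
       norm (coef f k) \<le> C * enn2real (gs_norm s h f) * exp (- \<kappa> * (rho k / h) powr (1/s))" if h: "h > 0" for h
  proof -
    obtain B1 where B1: "B1 > 0" "\<And>f (k :: (nat^'d::finite) \<times> (int^'d)) i m. f \<in> gs_step s h \<Longrightarrow>
      \<bar>of_int (snd k $ i)\<bar> ^ m * norm (coef f k) \<le> B1 * enn2real (gs_norm s h f) * (4 * h) ^ m * fact m powr s"
      using coef_spatial_decay[OF s h] by metis
    obtain B2 where B2: "B2 > 0" "\<And>f (k :: (nat^'d::finite) \<times> (int^'d)) i m. f \<in> gs_step s h \<Longrightarrow>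
      real (fst k $ i) ^ m * norm (coef f k) \<le> B2 * enn2real (gs_norm s h f) * (2 * h) ^ m * fact m powr s"
      using coef_frequency_decay[OF s h] by metis
    define B where "B = B1 + B2"
    have "norm (coef f k) \<le> (2 powr s * B) * enn2real (gs_norm s h f) * exp (- \<kappa> * (rho k / h) powr (1/s))"
      if f: "f \<in> gs_step s h" for f and k :: "(nat^'d) \<times> (int^'d)"
    proof -
      define N where "N = enn2real (gs_norm s h f)"
      have N0: "N \<ge> 0" by (simp add: N_def)
      \<comment> \<open>It suffices to have moment bounds for one number \<open>y\<close> that is comparable to \<open>rho k\<close>.\<close>
      have large: "norm (coef f k) \<le> (2 powr s * B) * N * exp (- \<kappa> * (rho k / h) powr (1/s))"
        if y: "y \<ge> 0" "rho k \<le> 2 * real CARD('d) * y"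
          and le: "\<And>m. y ^ m * norm (coef f k) \<le> B * N * (4 * h) ^ m * fact m powr s" for y
      proof -
        have "norm (coef f k) \<le> 2 powr s * (B * N) * exp (- (s / 2) * (y / (4 * h)) powr (1/s))"
          using h s y le by (intro gevrey_decay) auto
        also have "\<dots> \<le> 2 powr s * (B * N) * exp (- \<kappa> * (rho k / h) powr (1/s))"
        proof (intro mult_left_mono)
          have "(1 / (8 * real CARD('d))) * (rho k / h) \<le> y / (4 * h)" using y h by (simp add: field_simps)
          then have "((1 / (8 * real CARD('d))) * (rho k / h)) powr (1/s) \<le> (y / (4 * h)) powr (1/s)"
            using s h rho_nonneg[of k] by (intro powr_mono2) auto
          then have "(1 / (8 * real CARD('d))) powr (1/s) * (rho k / h) powr (1/s) \<le> (y / (4 * h)) powr (1/s)"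
            using h rho_nonneg[of k] by (subst (asm) powr_mult) auto
          then have "s / 2 * ((1 / (8 * real CARD('d))) powr (1/s) * (rho k / h) powr (1/s)) \<le> s / 2 * (y / (4 * h)) powr (1/s)"
            using s by (intro mult_left_mono) auto
          then show "exp (- (s / 2) * (y / (4 * h)) powr (1/s)) \<le> exp (- \<kappa> * (rho k / h) powr (1/s))"
            by (simp add: \<kappa>_def mult.assoc)
        qed (use B1 B2 N0 in \<open>auto simp: B_def\<close>)
        finally show ?thesis by (simp add: mult.assoc)
      qed
      have le1: "\<bar>of_int (snd k $ i)\<bar> ^ m * norm (coef f k) \<le> B * N * (4 * h) ^ m * fact m powr s" for i m
      proof -
        have "B1 * N * (4 * h) ^ m * fact m powr s \<le> B * N * (4 * h) ^ m * fact m powr s"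
          using B2 N0 h by (intro mult_right_mono) (auto simp: B_def)
        then show ?thesis using B1(2)[OF f, of k i m] by (simp add: N_def)
      qed
      have le2: "real (fst k $ i) ^ m * norm (coef f k) \<le> B * N * (4 * h) ^ m * fact m powr s" for i m
      proof -
        have "B2 * N * (2 * h) ^ m * fact m powr s \<le> B * N * (4 * h) ^ m * fact m powr s"
          using B1 B2 N0 h by (intro mult_right_mono mult_mono power_mono) (auto simp: B_def)
        then show ?thesis using B2(2)[OF f, of k i m] by (simp add: N_def)
      qed
      \<comment> \<open>Some coordinate carries at least the average share of \<open>rho k\<close>; there the larger one of
        position and frequency serves as \<open>y\<close>.\<close>
      have "\<exists>i. rho k \<le> real CARD('d) * (\<bar>of_int (snd k $ i)\<bar> / 2 + real (fst k $ i))"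
      proof (rule ccontr)
        assume "\<not> ?thesis"
        then have "\<bar>of_int (snd k $ i)\<bar> / 2 + real (fst k $ i) < rho k / real CARD('d)" for i
          by (auto simp: field_simps not_le)
        then have "(\<Sum>i\<in>UNIV. \<bar>of_int (snd k $ i)\<bar> / 2 + real (fst k $ i)) < (\<Sum>i::'d\<in>UNIV. rho k / real CARD('d))"
          by (intro sum_strict_mono) auto
        then show False using rho_le[of k] by simp
      qed
      then obtain i where i: "rho k \<le> real CARD('d) * (\<bar>of_int (snd k $ i)\<bar> / 2 + real (fst k $ i))" ..
      show ?thesis
      proof (cases "\<bar>of_int (snd k $ i)\<bar> \<le> real (fst k $ i)")
        case True
        have "real CARD('d) * (\<bar>of_int (snd k $ i)\<bar> / 2 + real (fst k $ i)) \<le> real CARD('d) * (2 * real (fst k $ i))"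
          using True by (intro mult_left_mono) auto
        from order_trans[OF i this] have "rho k \<le> 2 * real CARD('d) * real (fst k $ i)" by (simp add: mult_ac)
        from large[OF _ this le2] show ?thesis by (simp add: N_def)
      next
        case False
        have "real CARD('d) * (\<bar>of_int (snd k $ i)\<bar> / 2 + real (fst k $ i)) \<le> real CARD('d) * (2 * \<bar>of_int (snd k $ i)\<bar>)"
          using False by (intro mult_left_mono) auto
        from order_trans[OF i this] have "rho k \<le> 2 * real CARD('d) * \<bar>of_int (snd k $ i)\<bar>" by (simp add: mult_ac)
        from large[OF _ this le1] show ?thesis by (simp add: N_def)
      qed
    qed
    then show ?thesis using B1 B2 by (intro exI[of _ "2 powr s * B"]) (auto simp: B_def)
  qed
  then show ?thesis using that \<kappa> by blast
qed

end

section \<open>Summability over the index set\<close>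

lemma inverse_square_sum_bound:
  obtains S where "\<And>A :: nat set. finite A \<Longrightarrow> (\<Sum>l\<in>A. 1 / (1 + real l)\<^sup>2) \<le> S"
    "\<And>A :: int set. finite A \<Longrightarrow> (\<Sum>n\<in>A. 1 / (1 + \<bar>of_int n\<bar> / 2)\<^sup>2) \<le> (S::real)"
proof -
  define a where "a l = 1 / (1 + real l)\<^sup>2" for l
  have sm: "summable a"
    using inverse_power_summable[of 2, where 'a = real] summable_Suc_iff[of "\<lambda>n. inverse (real n ^ 2)"]
    by (simp add: a_def[abs_def] inverse_eq_divide add.commute)
  have a0: "a l \<ge> 0" for l by (simp add: a_def)
  have le: "sum a A \<le> suminf a" if "finite A" for A
    using that sm a0 by (intro sum_le_suminf) auto
  have s0: "suminf a \<ge> 0" using sm a0 by (intro suminf_nonneg)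
  have int: "(\<Sum>n\<in>A. 1 / (1 + \<bar>of_int n\<bar> / 2)\<^sup>2) \<le> 8 * suminf a" if A: "finite A" for A :: "int set"
  proof -
    have b: "1 / (1 + \<bar>of_int n\<bar> / 2)\<^sup>2 \<le> 4 * a (nat \<bar>n\<bar>)" for n :: int
    proof -
      have "(1 + real (nat \<bar>n\<bar>)) ^ 2 \<le> (2 * (1 + \<bar>of_int n\<bar> / 2)) ^ 2" by (intro power_mono) auto
      also have "\<dots> = 4 * (1 + \<bar>of_int n\<bar> / 2)\<^sup>2" by (simp only: power_mult_distrib) simp
      finally show ?thesis by (simp add: a_def field_simps)
    qed
    have "(\<Sum>n\<in>A. 1 / (1 + \<bar>of_int n\<bar> / 2)\<^sup>2) \<le> (\<Sum>n\<in>A. 4 * a (nat \<bar>n\<bar>))" by (intro sum_mono b)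
    \<comment> \<open>On each half-line \<open>n \<mapsto> |n|\<close> is injective.\<close>
    also have "\<dots> = (\<Sum>n\<in>A \<inter> {0..}. 4 * a (nat \<bar>n\<bar>)) + (\<Sum>n\<in>A - {0..}. 4 * a (nat \<bar>n\<bar>))"
      using sum.Int_Diff[OF A] .
    also have "(\<Sum>n\<in>A \<inter> {0..}. 4 * a (nat \<bar>n\<bar>)) = (\<Sum>l\<in>(\<lambda>n. nat \<bar>n\<bar>) ` (A \<inter> {0..}). 4 * a l)"
      by (subst sum.reindex) (auto simp: inj_on_def)
    also have "(\<Sum>n\<in>A - {0..}. 4 * a (nat \<bar>n\<bar>)) = (\<Sum>l\<in>(\<lambda>n. nat \<bar>n\<bar>) ` (A - {0..}). 4 * a l)"
      by (subst sum.reindex) (auto simp: inj_on_def)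
    also have "(\<Sum>l\<in>(\<lambda>n. nat \<bar>n\<bar>) ` (A \<inter> {0..}). 4 * a l) + (\<Sum>l\<in>(\<lambda>n. nat \<bar>n\<bar>) ` (A - {0..}). 4 * a l) \<le> 4 * suminf a + 4 * suminf a"
      unfolding sum_distrib_left[symmetric] using A by (intro add_mono mult_left_mono le) auto
    finally show ?thesis by simp
  qed
  show ?thesis
  proof (rule that[of "8 * suminf a"])
    fix A :: "nat set" assume "finite A"
    then have "sum a A \<le> suminf a" by (rule le)
    then show "(\<Sum>l\<in>A. 1 / (1 + real l)\<^sup>2) \<le> 8 * suminf a" using s0 by (simp add: a_def)
  qed (rule int)
qed

context analytic_window begin

text \<open>A finite set of indices lies in a finite box, where the sum of products is a product of sums.\<close>

lemma summable_lattice_product: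
  "(\<lambda>k :: (nat^'d::finite) \<times> (int^'d). \<Prod>i\<in>UNIV. 1 / (1 + real (fst k $ i))\<^sup>2 * (1 / (1 + \<bar>of_int (snd k $ i)\<bar> / 2)\<^sup>2)) summable_on UNIV"
proof -
  obtain S where S: "\<And>A :: nat set. finite A \<Longrightarrow> (\<Sum>l\<in>A. 1 / (1 + real l)\<^sup>2) \<le> S"
    "\<And>A :: int set. finite A \<Longrightarrow> (\<Sum>n\<in>A. 1 / (1 + \<bar>of_int n\<bar> / 2)\<^sup>2) \<le> S"
    using inverse_square_sum_bound by blast
  define w where "w p = 1 / (1 + real (fst p))\<^sup>2 * (1 / (1 + \<bar>of_int (snd p)\<bar> / 2)\<^sup>2)" for p :: "nat \<times> int"
  have w0: "w p \<ge> 0" for p by (simp add: w_def)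
  have S0: "S \<ge> 0" using S(1)[of "{}"] by simp
  show ?thesis
  proof (rule nonneg_bdd_above_summable_on)
    show "bdd_above (sum (\<lambda>k :: (nat^'d) \<times> (int^'d). \<Prod>i\<in>UNIV. 1 / (1 + real (fst k $ i))\<^sup>2 * (1 / (1 + \<bar>of_int (snd k $ i)\<bar> / 2)\<^sup>2)) ` {F. F \<subseteq> UNIV \<and> finite F})"
    proof (rule bdd_aboveI2)
      fix F :: "((nat^'d) \<times> (int^'d)) set" assume "F \<in> {F. F \<subseteq> UNIV \<and> finite F}"
      then have F: "finite F" by simp
      define A where "A = (\<Union>i. (\<lambda>k. fst k $ i) ` F)"
      define B where "B = (\<Union>i. (\<lambda>k. snd k $ i) ` F)"
      have AB: "finite A" "finite B" using F by (auto simp: A_def B_def)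
      let ?g = "\<lambda>k :: (nat^'d) \<times> (int^'d). \<lambda>i. (fst k $ i, snd k $ i)"
      have inj: "inj_on ?g F" by (auto simp: inj_on_def fun_eq_iff vec_eq_iff prod_eq_iff)
      have sub: "?g ` F \<subseteq> PiE UNIV (\<lambda>_. A \<times> B)" by (auto simp: A_def B_def)
      have "(\<Sum>k\<in>F. \<Prod>i\<in>UNIV. 1 / (1 + real (fst k $ i))\<^sup>2 * (1 / (1 + \<bar>of_int (snd k $ i)\<bar> / 2)\<^sup>2)) = (\<Sum>g\<in>?g ` F. \<Prod>i\<in>UNIV. w (g i))"
        by (subst sum.reindex[OF inj]) (simp add: w_def)
      also have "\<dots> \<le> (\<Sum>g\<in>PiE (UNIV :: 'd set) (\<lambda>_. A \<times> B). \<Prod>i\<in>UNIV. w (g i))"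
      proof (rule sum_mono2[OF _ sub])
        show "finite (PiE (UNIV :: 'd set) (\<lambda>_. A \<times> B))" using AB by (intro finite_PiE) auto
      qed (intro prod_nonneg w0)
      also have "\<dots> = (\<Prod>i::'d\<in>UNIV. \<Sum>p\<in>A \<times> B. w p)"
        using AB by (intro prod_sum_PiE[symmetric]) auto
      also have "(\<Sum>p\<in>A \<times> B. w p) = (\<Sum>l\<in>A. 1 / (1 + real l)\<^sup>2) * (\<Sum>n\<in>B. 1 / (1 + \<bar>of_int n\<bar> / 2)\<^sup>2)"
        unfolding w_def sum_product sum.cartesian_product by (simp add: case_prod_unfold)
      also have "(\<Prod>i::'d\<in>UNIV. (\<Sum>l\<in>A. 1 / (1 + real l)\<^sup>2) * (\<Sum>n\<in>B. 1 / (1 + \<bar>of_int n\<bar> / 2)\<^sup>2)) \<le> (\<Prod>i::'d\<in>UNIV. S * S)"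
        using AB S0 by (intro prod_mono conjI mult_mono S mult_nonneg_nonneg sum_nonneg) auto
      finally show "(\<Sum>k\<in>F. \<Prod>i\<in>UNIV. 1 / (1 + real (fst k $ i))\<^sup>2 * (1 / (1 + \<bar>of_int (snd k $ i)\<bar> / 2)\<^sup>2)) \<le> (\<Prod>i::'d\<in>UNIV. S * S)" .
    qed
  qed (auto intro!: prod_nonneg)
qed

text \<open>A stretched exponential decays faster than any power of \<open>1 + rho k\<close>. The additional weight \<open>1 + rho k\<close>
serves the estimate of tails in \<open>coef_series_tail\<close>.\<close>

lemma summable_rho_exp:
  assumes s: "s > 0" and t: "t > 0"
  shows "(\<lambda>k :: (nat^'d::finite) \<times> (int^'d). (1 + rho k) * exp (- t * rho k powr (1/s))) summable_on UNIV"
proof -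
  \<comment> \<open>Each of the \<open>d\<close> coordinates needs a factor \<open>(1 + rho k)^4\<close>: a square for the frequency and
    one for the position. One more power comes from the weight \<open>1 + rho k\<close>.\<close>
  define N where "N = 4 * CARD('d) + 1"
  \<comment> \<open>This \<open>q\<close> turns the exponent \<open>s (y/q)^(1/s)\<close> into \<open>t y^(1/s)\<close>.\<close>
  define q where "q = (s / t) powr s"
  have q: "q > 0" using s t by (simp add: q_def)
  have qt: "s * (y / q) powr (1/s) = t * y powr (1/s)" if "y \<ge> 0" for y
  proof -
    have "q powr (1/s) = s / t" using s t by (simp add: q_def powr_powr)
    moreover have "(y / q) powr (1/s) = y powr (1/s) / q powr (1/s)" using that q by (simp add: powr_divide)
    ultimately show ?thesis using s t by simp
  qed
  define C where "C = 2 ^ N * (1 + q ^ N * fact N powr s)"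
  have C0: "C \<ge> 0" using q by (simp add: C_def)
  let ?P = "\<lambda>k :: (nat^'d) \<times> (int^'d). \<Prod>i\<in>UNIV. 1 / (1 + real (fst k $ i))\<^sup>2 * (1 / (1 + \<bar>of_int (snd k $ i)\<bar> / 2)\<^sup>2)"
  show ?thesis
  proof (rule summable_on_comparison_test)
    show "(\<lambda>k :: (nat^'d) \<times> (int^'d). C * ?P k) summable_on UNIV" by (intro summable_on_cmult_right summable_lattice_product)
    fix k :: "(nat^'d) \<times> (int^'d)"
    have r0: "rho k \<ge> 0" by (rule rho_nonneg)
    show "0 \<le> (1 + rho k) * exp (- t * rho k powr (1/s))" using r0 by simp
    have e1: "exp (t * rho k powr (1/s)) \<ge> 1" using t by simp
    have "(1 + rho k) ^ N \<le> (2 * max 1 (rho k)) ^ N" using r0 by (intro power_mono) auto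
    also have "\<dots> \<le> 2 ^ N * (1 + rho k ^ N)" using r0 by (simp add: power_mult_distrib max_def)
    also have "\<dots> \<le> 2 ^ N * (exp (t * rho k powr (1/s)) + q ^ N * fact N powr s * exp (t * rho k powr (1/s)))"
      using power_le_gevrey[OF r0 q s, of N] e1 qt[OF r0] by (intro mult_left_mono add_mono) auto
    also have "\<dots> = C * exp (t * rho k powr (1/s))" by (simp add: C_def algebra_simps)
    finally have p1: "(1 + rho k) ^ N * exp (- t * rho k powr (1/s)) \<le> C" by (simp add: exp_minus field_simps)
    have p2: "1 \<le> (1 + rho k) ^ (4 * CARD('d)) * ?P k"
    proof -
      have "(1 + rho k) ^ (4 * CARD('d)) = (\<Prod>i::'d\<in>UNIV. (1 + rho k)\<^sup>2 * (1 + rho k)\<^sup>2)"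
        by (simp add: power_mult power_add[symmetric])
      then have "(1 + rho k) ^ (4 * CARD('d)) * ?P k =
          (\<Prod>i\<in>UNIV. ((1 + rho k)\<^sup>2 * (1 + rho k)\<^sup>2) * (1 / (1 + real (fst k $ i))\<^sup>2 * (1 / (1 + \<bar>of_int (snd k $ i)\<bar> / 2)\<^sup>2)))"
        by (simp only: prod.distrib)
      also have "\<dots> \<ge> 1"
      proof (rule prod_ge_1)
        fix i
        have "(1 + real (fst k $ i))\<^sup>2 \<le> (1 + rho k)\<^sup>2" using rho_ge(2)[of k i] by (intro power_mono) auto
        then have "1 \<le> (1 + rho k)\<^sup>2 * (1 / (1 + real (fst k $ i))\<^sup>2)" by (simp add: field_simps)
        moreover have "(1 + \<bar>of_int (snd k $ i)\<bar> / 2)\<^sup>2 \<le> (1 + rho k)\<^sup>2" using rho_ge(1)[of k i] by (intro power_mono) auto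
        then have "1 \<le> (1 + rho k)\<^sup>2 * (1 / (1 + \<bar>of_int (snd k $ i)\<bar> / 2)\<^sup>2)"
        proof -
          have "(1 + \<bar>real_of_int (snd k $ i)\<bar> / 2)\<^sup>2 > 0" by (intro zero_less_power) (simp add: add_pos_nonneg)
          then show ?thesis using \<open>(1 + \<bar>of_int (snd k $ i)\<bar> / 2)\<^sup>2 \<le> (1 + rho k)\<^sup>2\<close> by (simp add: pos_le_divide_eq)
        qed
        ultimately have "1 * 1 \<le> ((1 + rho k)\<^sup>2 * (1 / (1 + real (fst k $ i))\<^sup>2)) * ((1 + rho k)\<^sup>2 * (1 / (1 + \<bar>of_int (snd k $ i)\<bar> / 2)\<^sup>2))"
          by (intro mult_mono) auto
        then show "1 \<le> ((1 + rho k)\<^sup>2 * (1 + rho k)\<^sup>2) * (1 / (1 + real (fst k $ i))\<^sup>2 * (1 / (1 + \<bar>of_int (snd k $ i)\<bar> / 2)\<^sup>2))"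
          by (simp only: mult_ac mult_1_right)
      qed
      finally show ?thesis .
    qed
    have "(1 + rho k) * exp (- t * rho k powr (1/s)) * 1 \<le> (1 + rho k) * exp (- t * rho k powr (1/s)) * ((1 + rho k) ^ (4 * CARD('d)) * ?P k)"
      using r0 by (intro mult_left_mono p2) auto
    also have "\<dots> = ((1 + rho k) ^ N * exp (- t * rho k powr (1/s))) * ?P k"
      by (simp add: N_def mult_ac)
    also have "\<dots> \<le> C * ?P k" by (intro mult_right_mono p1 prod_nonneg) auto
    finally show "(1 + rho k) * exp (- t * rho k powr (1/s)) \<le> C * ?P k" by simp
  qed
qed

lemma summable_exp_rho:
  assumes s: "s > 0" and t: "t > 0"
  shows "(\<lambda>k :: (nat^'d::finite) \<times> (int^'d). exp (- t * rho k powr (1/s))) summable_on UNIV"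
  using summable_rho_exp[OF assms]
  by (rule summable_on_comparison_test) (auto simp: rho_nonneg mult_le_cancel_right1)

lemma finite_rho_le: "finite {k :: (nat^'d::finite) \<times> (int^'d). rho k \<le> M}"
proof -
  have fin: "finite {v :: 'a^'d. \<forall>i. v $ i \<in> S}" if "finite S" for S :: "'a set"
  proof (rule finite_subset)
    show "{v :: 'a^'d. \<forall>i. v $ i \<in> S} \<subseteq> vec_lambda ` PiE UNIV (\<lambda>_. S)"
    proof
      fix v :: "'a^'d" assume "v \<in> {v. \<forall>i. v $ i \<in> S}"
      then show "v \<in> vec_lambda ` PiE UNIV (\<lambda>_. S)" by (intro image_eqI[of _ _ "\<lambda>i. v $ i"]) auto
    qed
    show "finite (vec_lambda ` PiE (UNIV :: 'd set) (\<lambda>_. S))" using that by (intro finite_imageI finite_PiE) auto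
  qed
  have n: "l \<le> nat \<lfloor>M\<rfloor>" if "real l \<le> M" for l using that by (simp add: le_nat_floor)
  have z: "n \<in> {- \<lfloor>2 * M\<rfloor>..\<lfloor>2 * M\<rfloor>}" if "\<bar>of_int n\<bar> / 2 \<le> M" for n
  proof -
    have "of_int n \<le> 2 * M" "of_int (- n) \<le> 2 * M" using that by auto
    then have "n \<le> \<lfloor>2 * M\<rfloor>" "- n \<le> \<lfloor>2 * M\<rfloor>" by (simp_all only: le_floor_iff)
    then show ?thesis by simp
  qed
  have "{k :: (nat^'d) \<times> (int^'d). rho k \<le> M} \<subseteq>
      {l. \<forall>i. l $ i \<in> {..nat \<lfloor>M\<rfloor>}} \<times> {n. \<forall>i. n $ i \<in> {- \<lfloor>2 * M\<rfloor>..\<lfloor>2 * M\<rfloor>}}"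
  proof
    fix k :: "(nat^'d) \<times> (int^'d)" assume "k \<in> {k. rho k \<le> M}"
    then have k: "rho k \<le> M" by simp
    have "fst k $ i \<in> {..nat \<lfloor>M\<rfloor>}" for i using n[OF order_trans[OF rho_ge(2) k]] by simp
    moreover have "snd k $ i \<in> {- \<lfloor>2 * M\<rfloor>..\<lfloor>2 * M\<rfloor>}" for i by (rule z[OF order_trans[OF rho_ge(1) k]])
    ultimately show "k \<in> {l. \<forall>i. l $ i \<in> {..nat \<lfloor>M\<rfloor>}} \<times> {n. \<forall>i. n $ i \<in> {- \<lfloor>2 * M\<rfloor>..\<lfloor>2 * M\<rfloor>}}"
      by (simp only: mem_Times_iff mem_Collect_eq) blast
  qed
  then show ?thesis by (rule finite_subset) (intro finite_cartesian_product fin; simp)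
qed

end

section \<open>Termwise differentiation\<close>

text \<open>Termwise differentiation of a series whose sum is already known to be differentiable. The sums of the
difference quotients converge uniformly by the Weierstrass test, so the limits may be exchanged.\<close>

lemma has_sum_vector_derivative:
  fixes b b' :: "'k \<Rightarrow> real \<Rightarrow> complex"
  assumes deriv: "\<And>k t. (b k has_vector_derivative b' k t) (at t)"
    and bound: "\<And>k t. norm (b' k t) \<le> M k" and M: "M summable_on UNIV"
    and sum: "\<And>t. ((\<lambda>k. b k t) has_sum B t) UNIV"
    and B: "(B has_vector_derivative B') (at 0)"
  shows "((\<lambda>k. b' k 0) has_sum B') UNIV"
proof -
  have quot: "((\<lambda>t. (f t - f 0) /\<^sub>R t) \<longlongrightarrow> f') (at 0)" if "(f has_vector_derivative f') (at 0)" for f f' 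
  proof -
    have "((\<lambda>t. norm (f t - f 0 - t *\<^sub>R f') / norm t) \<longlongrightarrow> 0) (at 0)"
      using that by (simp add: has_vector_derivative_def has_derivative_at)
    moreover have "eventually (\<lambda>t. norm (f t - f 0 - t *\<^sub>R f') / norm t = norm ((f t - f 0) /\<^sub>R t - f')) (at 0)"
    proof (rule eventually_mono[OF eventually_neq_at_within[of 0]])
      fix t :: real assume t: "t \<noteq> 0"
      then have "(f t - f 0) /\<^sub>R t - f' = (f t - f 0 - t *\<^sub>R f') /\<^sub>R t" by (simp add: scaleR_right_diff_distrib)
      then show "norm (f t - f 0 - t *\<^sub>R f') / norm t = norm ((f t - f 0) /\<^sub>R t - f')" by (simp add: divide_inverse mult.commute)
    qed
    ultimately have "((\<lambda>t. norm ((f t - f 0) /\<^sub>R t - f')) \<longlongrightarrow> 0) (at 0)"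
      by (rule Lim_transform_eventually)
    then show ?thesis by (simp add: tendsto_norm_zero_iff LIM_zero_iff)
  qed
  let ?q = "\<lambda>k t. (b k t - b k 0) /\<^sub>R t"
  \<comment> \<open>By the mean value theorem the difference quotients have the same majorant as the derivatives.\<close>
  have qb: "norm (?q k t) \<le> M k" for k t
  proof -
    have "norm (b k t - b k 0) \<le> M k * norm (t - 0)"
    proof (rule differentiable_bound[of UNIV])
      show "(b k has_derivative (\<lambda>r. r *\<^sub>R b' k t)) (at t within UNIV)" for t
        using deriv by (simp add: has_vector_derivative_def)
      show "onorm (\<lambda>r. r *\<^sub>R b' k t) \<le> M k" for t
        using mult_right_mono[OF bound[of k t]] by (intro onorm_bound order_trans[OF norm_ge_zero bound]) (simp add: mult.commute)
    qed auto
    moreover have "M k \<ge> 0" using bound[of k 0] order_trans[OF norm_ge_zero] by blast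
    moreover have "norm (?q k t) = norm (b k t - b k 0) / \<bar>t\<bar>" by (simp add: divide_inverse mult.commute)
    ultimately show ?thesis by (cases "t = 0") (auto simp: pos_divide_le_eq)
  qed
  have "(\<lambda>k. norm (b' k 0)) summable_on UNIV"
    by (rule summable_on_comparison_test[OF M]) (rule bound, rule norm_ge_zero)
  then have s': "((\<lambda>k. b' k 0) has_sum (\<Sum>\<^sub>\<infinity>k. b' k 0)) UNIV"
    by (rule has_sum_infsum[OF abs_summable_summable])
  have "((\<lambda>t. \<Sum>\<^sub>\<infinity>k. ?q k t) \<longlongrightarrow> (\<Sum>\<^sub>\<infinity>k. b' k 0)) (at 0 within UNIV)"
  proof (rule swap_uniform_limit)
    show "uniform_limit UNIV (\<lambda>X t. \<Sum>k\<in>X. ?q k t) (\<lambda>t. \<Sum>\<^sub>\<infinity>k. ?q k t) (finite_subsets_at_top UNIV)"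
      by (rule Weierstrass_m_test_general[OF qb M])
    show "\<forall>\<^sub>F X in finite_subsets_at_top UNIV. ((\<lambda>t. \<Sum>k\<in>X. ?q k t) \<longlongrightarrow> (\<Sum>k\<in>X. b' k 0)) (at 0 within UNIV)"
      by (intro always_eventually allI tendsto_sum) (use quot[OF deriv] in simp)
    show "((\<lambda>X. \<Sum>k\<in>X. b' k 0) \<longlongrightarrow> (\<Sum>\<^sub>\<infinity>k. b' k 0)) (finite_subsets_at_top UNIV)"
      using s' by (simp add: has_sum_def)
  qed simp
  moreover have "(\<Sum>\<^sub>\<infinity>k. ?q k t) = (B t - B 0) /\<^sub>R t" for t
  proof -
    have "((\<lambda>k. b k t - b k 0) has_sum (B t - B 0)) UNIV" 
    proof -
      have "((\<lambda>k. - b k 0) has_sum (- B 0)) UNIV" using sum[of 0] by (simp add: has_sum_uminus)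
      from has_sum_add[OF sum[of t] this] show ?thesis by simp
    qed
    then have "((\<lambda>k. (b k t - b k 0) /\<^sub>R t) has_sum ((B t - B 0) /\<^sub>R t)) UNIV"
      by (intro has_sum_scaleR)
    then show ?thesis by (rule infsumI)
  qed
  ultimately have "((\<lambda>t. (B t - B 0) /\<^sub>R t) \<longlongrightarrow> (\<Sum>\<^sub>\<infinity>k. b' k 0)) (at 0)" by simp
  with quot[OF B] have "B' = (\<Sum>\<^sub>\<infinity>k. b' k 0)" by (intro tendsto_unique[OF trivial_limit_at])
  then show ?thesis using s' by simp
qed

section \<open>Completeness of tensor products of an orthonormal basis\<close>

lemma integrable_inverse_1_plus_square': "integrable lborel (\<lambda>x::real. 1 / (1 + x\<^sup>2))"
  using integrable_inverse_1_plus_square by (simp add: set_integrable_def inverse_eq_divide)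

text \<open>Completeness of a tensor product basis, for the rapidly decreasing continuous functions at hand. One coordinate
after the other, the basis function in the test product is replaced by an arbitrary square integrable
function: this is possible because such a function is approximated in mean square by finite combinations,
and because the error is controlled by \<open>\<integral> |g(t)| / (1 + t\<^sup>2) dt\<close> and hence by the mean square of \<open>g\<close>. After
that \<open>R\<close> is orthogonal to the indicators of all boxes.\<close>

lemma tensor_completeness:
  fixes e :: "'i \<Rightarrow> real \<Rightarrow> complex" and R :: "real^'d::finite \<Rightarrow> complex"
  assumes onb: "orthonormal_basis_L2 e" and cont: "continuous_on UNIV R"
    and dec: "\<And>x. norm (R x) \<le> M * (\<Prod>i\<in>UNIV. 1 / (1 + (x $ i)\<^sup>2))"
    and orth: "\<And>\<kappa> :: 'd \<Rightarrow> 'i. (LINT x|lborel. (\<Prod>i\<in>UNIV. e (\<kappa> i) (x $ i)) * R x) = 0"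
  shows "R x = 0"
proof -
  let ?w = "\<lambda>t::real. 1 / (1 + t\<^sup>2)"
  have M0: "M \<ge> 0"
    using order_trans[OF norm_ge_zero dec[of 0]] by simp
  have [measurable]: "R \<in> borel_measurable borel" by (rule borel_measurable_continuous_onI[OF cont])
  have esq: "square_integrable (e a)" for a using onb by (simp add: orthonormal_basis_L2_def)
  have sqm: "f \<in> borel_measurable borel" if "square_integrable f" for f :: "real \<Rightarrow> complex"
    using that by (simp add: square_integrable_def)
  have w2: "?w t * ?w t \<le> ?w t" "0 \<le> ?w t" for t
  proof -
    have "?w t \<le> 1" by (simp add: divide_le_eq_1 add_pos_nonneg)
    then show "0 \<le> ?w t" "?w t * ?w t \<le> ?w t" using mult_left_le[of "?w t" "?w t"] by auto
  qed
  have wf: "integrable lborel (\<lambda>t. ?w t * norm (f t))"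
    and wf_le: "\<And>\<delta>. \<delta> > 0 \<Longrightarrow> (LINT t|lborel. ?w t * norm (f t)) \<le> \<delta> * (LINT t|lborel. ?w t) + (LINT t|lborel. (norm (f t))\<^sup>2) / \<delta>"
    if f: "square_integrable f" for f
  proof -
    note [measurable] = sqm[OF f]
    have fi: "integrable lborel (\<lambda>t. (norm (f t))\<^sup>2)" using f by (simp add: square_integrable_def)
    have le: "?w t * norm (f t) \<le> \<delta> * ?w t + (norm (f t))\<^sup>2 / \<delta>" if "\<delta> > 0" for \<delta> t
    proof -
      have "0 \<le> (\<delta> * ?w t - norm (f t))\<^sup>2" by simp
      then have "2 * \<delta> * (?w t * norm (f t)) \<le> \<delta>\<^sup>2 * (?w t * ?w t) + (norm (f t))\<^sup>2"
        by (simp add: power2_diff power2_eq_square algebra_simps)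
      also have "\<dots> \<le> \<delta>\<^sup>2 * ?w t + (norm (f t))\<^sup>2" by (intro add_right_mono mult_left_mono w2) auto
      finally have "2 * \<delta> * (?w t * norm (f t)) \<le> \<delta>\<^sup>2 * ?w t + (norm (f t))\<^sup>2" .
      moreover have "0 \<le> \<delta> * (?w t * norm (f t))" using that w2(2) by (intro mult_nonneg_nonneg) auto
      moreover have "2 * \<delta> * (?w t * norm (f t)) = 2 * (\<delta> * (?w t * norm (f t)))" by simp
      moreover have "\<delta> * (\<delta> * ?w t + (norm (f t))\<^sup>2 / \<delta>) = \<delta>\<^sup>2 * ?w t + (norm (f t))\<^sup>2"
        using that by (simp add: power2_eq_square distrib_left)
      ultimately have "\<delta> * (?w t * norm (f t)) \<le> \<delta> * (\<delta> * ?w t + (norm (f t))\<^sup>2 / \<delta>)" by linarith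
      then show ?thesis using that by (simp only: mult_le_cancel_left_pos)
    qed
    show i: "integrable lborel (\<lambda>t. ?w t * norm (f t))"
    proof (rule Bochner_Integration.integrable_bound)
      show "integrable lborel (\<lambda>t. 1 * ?w t + (norm (f t))\<^sup>2 / 1)"
        by (intro Bochner_Integration.integrable_add integrable_mult_right integrable_divide fi integrable_inverse_1_plus_square')
      show "AE t in lborel. norm (?w t * norm (f t)) \<le> norm (1 * ?w t + (norm (f t))\<^sup>2 / 1)"
        by (rule AE_I2) (use le[of 1] w2(2) in simp)
    qed measurable
    fix \<delta> :: real assume d: "\<delta> > 0"
    have "(LINT t|lborel. ?w t * norm (f t)) \<le> (LINT t|lborel. \<delta> * ?w t + (norm (f t))\<^sup>2 / \<delta>)"
      by (intro integral_mono i le d Bochner_Integration.integrable_add integrable_mult_right integrable_divide fi integrable_inverse_1_plus_square')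
    also have "\<dots> = \<delta> * (LINT t|lborel. ?w t) + (LINT t|lborel. (norm (f t))\<^sup>2) / \<delta>"
      using Bochner_Integration.integral_add[OF integrable_mult_right[OF integrable_inverse_1_plus_square', of \<delta>] integrable_divide[OF fi, of \<delta>]]
      by (simp only: integral_mult_right_zero integral_divide_zero)
    finally show "(LINT t|lborel. ?w t * norm (f t)) \<le> \<delta> * (LINT t|lborel. ?w t) + (LINT t|lborel. (norm (f t))\<^sup>2) / \<delta>" .
  qed
  have gR: "integrable lborel (\<lambda>x. (\<Prod>i\<in>UNIV. g i (x $ i)) * R x)"
    and gR_le: "norm (LINT x|lborel. (\<Prod>i\<in>UNIV. g i (x $ i)) * R x) \<le> M * (\<Prod>i\<in>UNIV. (LINT t|lborel. ?w t * norm (g i t)))"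
    if g: "\<And>i. square_integrable (g i)" for g :: "'d \<Rightarrow> real \<Rightarrow> complex"
  proof -
    have [measurable]: "g i \<in> borel_measurable borel" for i by (rule sqm[OF g])
    have le: "norm ((\<Prod>i\<in>UNIV. g i (x $ i)) * R x) \<le> M * (\<Prod>i\<in>UNIV. ?w (x $ i) * norm (g i (x $ i)))" for x
    proof -
      have "norm ((\<Prod>i\<in>UNIV. g i (x $ i)) * R x) = (\<Prod>i\<in>UNIV. norm (g i (x $ i))) * norm (R x)"
        by (simp add: norm_mult prod_norm)
      also have "\<dots> \<le> (\<Prod>i\<in>UNIV. norm (g i (x $ i))) * (M * (\<Prod>i\<in>UNIV. ?w (x $ i)))"
        by (intro mult_left_mono dec prod_nonneg) auto
      also have "\<dots> = M * (\<Prod>i\<in>UNIV. ?w (x $ i) * norm (g i (x $ i)))" unfolding prod.distrib by (simp only: mult_ac)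
      finally show ?thesis .
    qed
    have bi: "integrable lborel (\<lambda>x::real^'d. M * (\<Prod>i\<in>UNIV. ?w (x $ i) * norm (g i (x $ i))))"
      by (intro integrable_mult_right integrable_tensor[of "\<lambda>i t. ?w t * norm (g i t)"] wf g)
    show i: "integrable lborel (\<lambda>x. (\<Prod>i\<in>UNIV. g i (x $ i)) * R x)"
    proof (rule Bochner_Integration.integrable_bound[OF bi])
      show "AE x in lborel. norm ((\<Prod>i\<in>UNIV. g i (x $ i)) * R x) \<le> norm (M * (\<Prod>i\<in>UNIV. ?w (x $ i) * norm (g i (x $ i))))"
        unfolding real_norm_def by (rule AE_I2) (rule order_trans[OF le abs_ge_self])
    qed measurable
    have "norm (LINT x|lborel. (\<Prod>i\<in>UNIV. g i (x $ i)) * R x) \<le> (LINT x|lborel. M * (\<Prod>i\<in>UNIV. ?w (x $ i) * norm (g i (x $ i))))"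
      by (rule Bochner_Integration.integral_norm_bound_integral[OF i bi le])
    also have "\<dots> = M * (\<Prod>i\<in>UNIV. (LINT t|lborel. ?w t * norm (g i t)))"
      using integral_tensor[of "\<lambda>i t. ?w t * norm (g i t)", OF wf[OF g]] by simp
    finally show "norm (LINT x|lborel. (\<Prod>i\<in>UNIV. g i (x $ i)) * R x) \<le> M * (\<Prod>i\<in>UNIV. (LINT t|lborel. ?w t * norm (g i t)))" .
  qed
  \<comment> \<open>\<open>J\<close> is the set of coordinates in which the basis function has already been replaced.\<close>
  have zero: "(LINT x|lborel. (\<Prod>i\<in>UNIV. g i (x $ i)) * R x) = 0"
    if "finite J" "\<And>i. i \<in> J \<Longrightarrow> square_integrable (g i)" "\<And>i. i \<notin> J \<Longrightarrow> g i \<in> range e" for J and g :: "'d \<Rightarrow> real \<Rightarrow> complex"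
    using that
  proof (induction J arbitrary: g rule: finite_induct)
    case empty
    then have "\<forall>i. \<exists>a. g i = e a" by auto
    then obtain \<kappa> where "\<And>i. g i = e (\<kappa> i)" by metis
    then show ?case using orth[of \<kappa>] by simp
  next
    case (insert j J)
    have gsq: "square_integrable (g i)" for i
      using insert.prems(1)[of i] insert.prems(2)[of i] esq by (cases "i \<in> insert j J") auto
    define Q where "Q = M * (\<Prod>i\<in>UNIV - {j}. (LINT t|lborel. ?w t * norm (g i t)))"
    have Q0: "Q \<ge> 0" unfolding Q_def using M0 w2(2)
      by (intro mult_nonneg_nonneg prod_nonneg integral_nonneg_AE) (auto intro!: AE_I2)
    define W where "W = (LINT t|lborel. ?w t)"
    let ?I = "LINT x|lborel. (\<Prod>i\<in>UNIV. g i (x $ i)) * R x"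
    have split: "(\<Prod>i\<in>UNIV. (g(j := f)) i (x $ i)) = f (x $ j) * (\<Prod>i\<in>UNIV - {j}. g i (x $ i))" for f x
    proof -
      have "(\<Prod>i\<in>UNIV. (g(j := f)) i (x $ i)) = (g(j := f)) j (x $ j) * (\<Prod>i\<in>UNIV - {j}. (g(j := f)) i (x $ i))"
        by (rule prod.remove) auto
      also have "(\<Prod>i\<in>UNIV - {j}. (g(j := f)) i (x $ i)) = (\<Prod>i\<in>UNIV - {j}. g i (x $ i))"
        by (rule prod.cong) auto
      finally show ?thesis by simp
    qed
    have small: "norm ?I \<le> Q * (\<delta> * (W + 1))" if d: "\<delta> > 0" for \<delta>
    proof -
      have "\<forall>\<epsilon>>0. \<exists>F c. finite F \<and> (LINT t|lborel. (norm (g j t - (\<Sum>a\<in>F. c a * e a t)))\<^sup>2) < \<epsilon>"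
        using onb gsq[of j] by (simp add: orthonormal_basis_L2_def)
      moreover have "\<delta>\<^sup>2 > 0" using d by simp
      ultimately obtain F c where F: "finite F" "(LINT t|lborel. (norm (g j t - (\<Sum>a\<in>F. c a * e a t)))\<^sup>2) < \<delta>\<^sup>2" by blast
      \<comment> \<open>Only the remainder \<open>r\<close> contributes to the integral, because each \<open>e a\<close> in place \<open>j\<close> gives zero.\<close>
      define r where "r t = g j t - (\<Sum>a\<in>F. c a * e a t)" for t
      have add_sq: "square_integrable (\<lambda>t. p t + q t)" if pq: "square_integrable p" "square_integrable q" for p q :: "real \<Rightarrow> complex"
      proof -
        note [measurable] = sqm[OF pq(1)] sqm[OF pq(2)]
        have "integrable lborel (\<lambda>t. (norm (p t + q t))\<^sup>2)"
        proof (rule Bochner_Integration.integrable_bound)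
          show "integrable lborel (\<lambda>t. 2 * (norm (p t))\<^sup>2 + 2 * (norm (q t))\<^sup>2)"
            using pq by (intro Bochner_Integration.integrable_add integrable_mult_right) (auto simp: square_integrable_def)
          show "AE t in lborel. norm ((norm (p t + q t))\<^sup>2) \<le> norm (2 * (norm (p t))\<^sup>2 + 2 * (norm (q t))\<^sup>2)"
          proof (rule AE_I2)
            fix t
            have "(norm (p t + q t))\<^sup>2 \<le> (norm (p t) + norm (q t))\<^sup>2" by (intro power_mono norm_triangle_ineq) auto
            also have "\<dots> \<le> 2 * (norm (p t))\<^sup>2 + 2 * (norm (q t))\<^sup>2"
              using zero_le_power2[of "norm (p t) - norm (q t)"] by (simp add: power2_sum power2_diff)
            finally show "norm ((norm (p t + q t))\<^sup>2) \<le> norm (2 * (norm (p t))\<^sup>2 + 2 * (norm (q t))\<^sup>2)" by simp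
          qed
        qed measurable
        then show ?thesis by (simp add: square_integrable_def)
      qed
      have scale_sq: "square_integrable (\<lambda>t. b * p t)" if p: "square_integrable p" for p :: "real \<Rightarrow> complex" and b
      proof -
        note [measurable] = sqm[OF p]
        have "(\<lambda>t. b * p t) \<in> borel_measurable lborel" by measurable
        then show ?thesis using p unfolding square_integrable_def by (simp add: norm_mult power_mult_distrib)
      qed
      have sum_sq: "square_integrable (\<lambda>t. \<Sum>a\<in>F. - c a * e a t)"
        using F(1)
      proof (induction F rule: finite_induct)
        case empty
        then show ?case by (simp add: square_integrable_def)
      next
        case (insert a F)
        then show ?case using add_sq[OF scale_sq[OF esq, of "- c a" a] insert.IH] by simp
      qed
      have rsq: "square_integrable r"
        using add_sq[OF gsq[of j] sum_sq] by (simp add: r_def[abs_def] sum_negf)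
      have zero: "(LINT x|lborel. (\<Prod>i\<in>UNIV. (g(j := e a)) i (x $ i)) * R x) = 0" for a
        using insert.prems by (intro insert.IH) (auto simp: esq split: if_splits)
      have int_a: "integrable lborel (\<lambda>x. (\<Prod>i\<in>UNIV. (g(j := e a)) i (x $ i)) * R x)" for a
        by (rule gR) (simp add: gsq esq)
      have int_r: "integrable lborel (\<lambda>x. (\<Prod>i\<in>UNIV. (g(j := r)) i (x $ i)) * R x)"
        by (rule gR) (simp add: gsq rsq)
      have "(\<Prod>i\<in>UNIV. g i (x $ i)) * R x = (\<Prod>i\<in>UNIV. (g(j := r)) i (x $ i)) * R x +
         (\<Sum>a\<in>F. c a * ((\<Prod>i\<in>UNIV. (g(j := e a)) i (x $ i)) * R x))" for x
      proof -
        have "(\<Prod>i\<in>UNIV. g i (x $ i)) = g j (x $ j) * (\<Prod>i\<in>UNIV - {j}. g i (x $ i))"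
          using split[of "g j" x] by simp
        moreover have "g j (x $ j) = r (x $ j) + (\<Sum>a\<in>F. c a * e a (x $ j))" by (simp add: r_def)
        ultimately show ?thesis unfolding split by (simp add: distrib_right sum_distrib_right mult.assoc)
      qed
      then have "?I = (LINT x|lborel. (\<Prod>i\<in>UNIV. (g(j := r)) i (x $ i)) * R x) +
          (\<Sum>a\<in>F. c a * (LINT x|lborel. (\<Prod>i\<in>UNIV. (g(j := e a)) i (x $ i)) * R x))"
        using int_a int_r by simp
      then have "?I = (LINT x|lborel. (\<Prod>i\<in>UNIV. (g(j := r)) i (x $ i)) * R x)" using zero by simp
      then have "norm ?I \<le> M * (\<Prod>i\<in>UNIV. (LINT t|lborel. ?w t * norm ((g(j := r)) i t)))"
        using gR_le[of "g(j := r)"] gsq rsq by simp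
      also have "(\<Prod>i\<in>UNIV. (LINT t|lborel. ?w t * norm ((g(j := r)) i t))) =
         (LINT t|lborel. ?w t * norm (r t)) * (\<Prod>i\<in>UNIV - {j}. (LINT t|lborel. ?w t * norm ((g(j := r)) i t)))"
        using prod.remove[of UNIV j "\<lambda>i. LINT t|lborel. ?w t * norm ((g(j := r)) i t)"] by simp
      also have "(\<Prod>i\<in>UNIV - {j}. (LINT t|lborel. ?w t * norm ((g(j := r)) i t))) = (\<Prod>i\<in>UNIV - {j}. (LINT t|lborel. ?w t * norm (g i t)))"
        by (rule prod.cong) auto
      finally have "norm ?I \<le> Q * (LINT t|lborel. ?w t * norm (r t))" by (simp add: Q_def mult_ac)
      also have "\<dots> \<le> Q * (\<delta> * (W + 1))"
      proof (intro mult_left_mono Q0)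
        have "(LINT t|lborel. ?w t * norm (r t)) \<le> \<delta> * W + (LINT t|lborel. (norm (r t))\<^sup>2) / \<delta>" unfolding W_def by (rule wf_le[OF rsq d])
        also have "(LINT t|lborel. (norm (r t))\<^sup>2) / \<delta> \<le> \<delta>\<^sup>2 / \<delta>"
          using F(2) d by (intro divide_right_mono) (auto simp: r_def)
        finally show "(LINT t|lborel. ?w t * norm (r t)) \<le> \<delta> * (W + 1)"
          using d by (simp add: power2_eq_square distrib_left)
      qed
      finally show ?thesis .
    qed
    have W0: "W \<ge> 0" unfolding W_def using w2(2) by (intro integral_nonneg_AE) (auto intro!: AE_I2)
    have "norm ?I \<le> 0"
    proof (rule field_le_epsilon)
      fix \<epsilon> :: real assume "\<epsilon> > 0"
      then have "norm ?I \<le> Q * (\<epsilon> / ((Q + 1) * (W + 1)) * (W + 1))"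
        using Q0 W0 by (intro small divide_pos_pos mult_pos_pos) auto
      also have "\<dots> = Q * \<epsilon> / (Q + 1)" 
      proof -
        have "W + 1 \<noteq> 0" "Q + 1 \<noteq> 0" using W0 Q0 by linarith+
        then show ?thesis by (simp add: divide_simps)
      qed
      also have "\<dots> \<le> \<epsilon>" using Q0 \<open>\<epsilon> > 0\<close> by (simp add: field_simps)
      finally show "norm ?I \<le> 0 + \<epsilon>" by simp
    qed
    then show ?case by simp
  qed
  show "R x = 0"
  proof (rule ccontr)
    \<comment> \<open>The integral of \<open>R\<close> over a small box around \<open>x\<close> vanishes, but \<open>R\<close> is close to \<open>R x\<close> there.\<close>
    assume nz: "R x \<noteq> 0"
    then obtain d where d: "d > 0" "\<And>y. dist y x < d \<Longrightarrow> dist (R y) (R x) < norm (R x) / 2"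
      using cont unfolding continuous_on_iff by (metis UNIV_I zero_less_norm_iff half_gt_zero)
    define b where "b = d / (2 * real CARD('d))"
    have b: "b > 0" using d by (simp add: b_def)
    define g :: "'d \<Rightarrow> real \<Rightarrow> complex" where "g i t = of_real (indicator {x $ i - b..x $ i + b} t)" for i t
    have ind: "integrable lborel (indicat_real {u..v})" for u v :: real by (rule integrable_real_indicator) (auto simp: emeasure_lborel_Icc_eq)
    have gsq: "square_integrable (g i)" for i
    proof -
      have "(\<lambda>t. (norm (g i t))\<^sup>2) = indicator {x $ i - b..x $ i + b}" by (auto simp: g_def indicator_def fun_eq_iff)
      moreover have "g i \<in> borel_measurable borel" unfolding g_def[abs_def] by measurable
      ultimately show ?thesis using ind by (simp add: square_integrable_def)
    qed
    let ?p = "\<lambda>y::real^'d. \<Prod>i\<in>UNIV. g i (y $ i)"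
    have gi: "integrable lborel (g i)" for i unfolding g_def[abs_def] by (intro integrable_of_real ind)
    have p_int: "integrable lborel ?p" by (rule integrable_tensor[OF gi])
    have p_val: "(LINT y|lborel. ?p y) = of_real ((2 * b) ^ CARD('d))"
    proof -
      have "(LINT t|lborel. g i t) = of_real (2 * b)" for i
        unfolding g_def[abs_def] integral_complex_of_real using b by simp
      then show ?thesis unfolding integral_tensor[OF gi] by simp
    qed
    have near: "norm (?p y * R y - ?p y * R x) \<le> norm (?p y) * (norm (R x) / 2)" for y
    proof (cases "\<forall>i. y $ i \<in> {x $ i - b..x $ i + b}")
      case True
      have "dist y x \<le> (\<Sum>i\<in>UNIV. \<bar>(y - x) $ i\<bar>)" unfolding dist_norm by (rule norm_le_l1_cart)
      also have "\<dots> \<le> (\<Sum>i::'d\<in>UNIV. b)" using True by (intro sum_mono) (auto simp: abs_le_iff algebra_simps)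
      also have "\<dots> < d" using d by (simp add: b_def)
      finally have "norm (R y - R x) \<le> norm (R x) / 2" using d(2)[of y] by (simp add: dist_norm)
      then have "norm (?p y) * norm (R y - R x) \<le> norm (?p y) * (norm (R x) / 2)" by (intro mult_left_mono) auto
      then show ?thesis by (simp only: right_diff_distrib[symmetric] norm_mult)
    next
      case False
      then obtain i where "y $ i \<notin> {x $ i - b..x $ i + b}" by blast
      then have "g i (y $ i) = 0" by (simp add: g_def)
      then have "?p y = 0" by (intro prod_zero) auto
      then show ?thesis by (simp only: mult_zero_left norm_zero diff_self order_refl)
    qed
    have norm_p: "norm (?p y) = Re (?p y)" for y
    proof -
      have "?p y = of_real (\<Prod>i\<in>UNIV. indicator {x $ i - b..x $ i + b} (y $ i))"
        unfolding of_real_prod by (intro prod.cong) (auto simp: g_def indicator_def)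
      moreover have "(\<Prod>i\<in>UNIV. indicator {x $ i - b..x $ i + b} (y $ i)) \<ge> (0::real)" by (intro prod_nonneg) auto
      ultimately show ?thesis by (simp only: norm_of_real Re_complex_of_real abs_of_nonneg)
    qed
    have pR: "integrable lborel (\<lambda>y. ?p y * R y)" by (rule gR[OF gsq])
    have "(LINT y|lborel. ?p y * R y) = 0" by (rule zero[of UNIV]) (auto simp: gsq)
    then have "(LINT y|lborel. ?p y * R y - ?p y * R x) = - (of_real ((2 * b) ^ CARD('d)) * R x)"
      using pR p_int p_val by (subst Bochner_Integration.integral_diff) auto
    moreover have "norm (LINT y|lborel. ?p y * R y - ?p y * R x) \<le> (LINT y|lborel. norm (?p y) * (norm (R x) / 2))"
      using pR p_int by (intro Bochner_Integration.integral_norm_bound_integral near) auto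
    moreover have "(LINT y|lborel. norm (?p y) * (norm (R x) / 2)) = (2 * b) ^ CARD('d) * (norm (R x) / 2)"
    proof -
      have "(LINT y|lborel. Re (?p y)) = Re (LINT y|lborel. ?p y)" using p_int by (rule integral_Re)
      then show ?thesis using p_val unfolding norm_p by simp
    qed
    ultimately have "norm (- (complex_of_real ((2 * b) ^ CARD('d)) * R x)) \<le> (2 * b) ^ CARD('d) * (norm (R x) / 2)"
      by (simp only:)
    then have "(2 * b) ^ CARD('d) * norm (R x) \<le> (2 * b) ^ CARD('d) * (norm (R x) / 2)"
      using b by (simp only: norm_minus_cancel norm_mult norm_of_real abs_of_nonneg zero_le_power)
    moreover have "(2 * b) ^ CARD('d) > 0" using b by simp
    ultimately have "norm (R x) \<le> norm (R x) / 2" by (simp only: mult_le_cancel_left_pos)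
    then show False using nz by simp
  qed
qed

section \<open>Expansion of test functions\<close>

context analytic_window begin

lemma rho_scale:
  assumes "s > 0" "h > 0"
  shows "(rho k / h) powr (1/s) = (1 / h) powr (1/s) * rho k powr (1/s)"
  using powr_mult[of "1/h" "rho k" "1/s"] rho_nonneg[of k] assms by simp

text \<open>The next four lemmas restate the basic estimates by quantifiers: fixed \<open>h\<close> gives some rate, and any rate is
attained for a suitable \<open>h\<close>. They are what distinguishes the Roumieu from the Beurling case.\<close>

lemma coef_decay_some_rate:
  assumes s: "s > 1" and h: "h > 0"
  shows "\<exists>\<tau>>0. \<exists>C>0. \<forall>f\<in>gs_step s h. \<forall>k :: (nat^'d::finite) \<times> (int^'d).
     norm (coef f k) \<le> C * enn2real (gs_norm s h f) * exp (- \<tau> * rho k powr (1/s))"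
proof -
  obtain \<kappa> where \<kappa>: "\<kappa> > 0" and C: "\<And>h. h > 0 \<Longrightarrow> \<exists>C>0. \<forall>f\<in>gs_step s h. \<forall>k :: (nat^'d) \<times> (int^'d).
       norm (coef f k) \<le> C * enn2real (gs_norm s h f) * exp (- \<kappa> * (rho k / h) powr (1/s))"
    using coef_decay[OF s] by blast
  have "- \<kappa> * (rho k / h) powr (1/s) = - (\<kappa> * (1 / h) powr (1/s)) * rho k powr (1/s)" for k :: "(nat^'d) \<times> (int^'d)"
    using rho_scale[of s h k] s h by simp
  with C[OF h] have "\<exists>C>0. \<forall>f\<in>gs_step s h. \<forall>k :: (nat^'d) \<times> (int^'d).
       norm (coef f k) \<le> C * enn2real (gs_norm s h f) * exp (- (\<kappa> * (1 / h) powr (1/s)) * rho k powr (1/s))"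
    by (simp only:)
  moreover have "\<kappa> * (1 / h) powr (1/s) > 0" using \<kappa> h by simp
  ultimately show ?thesis by blast
qed

lemma coef_decay_any_rate:
  assumes s: "s > 1" and \<tau>: "\<tau> > 0"
  shows "\<exists>h>0. \<exists>C>0. \<forall>f\<in>gs_step s h. \<forall>k :: (nat^'d::finite) \<times> (int^'d).
     norm (coef f k) \<le> C * enn2real (gs_norm s h f) * exp (- \<tau> * rho k powr (1/s))"
proof -
  obtain \<kappa> where \<kappa>: "\<kappa> > 0" and C: "\<And>h. h > 0 \<Longrightarrow> \<exists>C>0. \<forall>f\<in>gs_step s h. \<forall>k :: (nat^'d) \<times> (int^'d).
       norm (coef f k) \<le> C * enn2real (gs_norm s h f) * exp (- \<kappa> * (rho k / h) powr (1/s))"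
    using coef_decay[OF s] by blast
  \<comment> \<open>Chosen such that \<open>\<kappa> (1/h)^(1/s) = \<tau>\<close>.\<close>
  define h where "h = 1 / (\<tau> / \<kappa>) powr s"
  have h: "h > 0" using \<kappa> \<tau> by (simp add: h_def)
  have "(1 / h) powr (1/s) = \<tau> / \<kappa>" using \<kappa> \<tau> s by (simp add: h_def powr_powr)
  then have "- \<kappa> * (rho k / h) powr (1/s) = - \<tau> * rho k powr (1/s)" for k :: "(nat^'d) \<times> (int^'d)"
    using rho_scale[of s h k] s h \<kappa> by simp
  then show ?thesis using C[OF h] h by (intro exI[of _ h]) simp
qed

lemma wilson_growth_some_rate:
  assumes s: "s > 1" and h: "h > 0"
  shows "\<exists>t>0. \<exists>C>0. \<forall>k :: (nat^'d::finite) \<times> (int^'d). gs_norm s h (wilson \<psi> k) \<le> ennreal (C * exp (t * rho k powr (1/s)))"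
proof -
  obtain \<kappa> where \<kappa>: "\<kappa> > 0" and C: "\<And>h. h > 0 \<Longrightarrow> \<exists>C>0. \<forall>k :: (nat^'d) \<times> (int^'d). gs_norm s h (wilson \<psi> k) \<le> ennreal (C * exp (\<kappa> * (rho k / h) powr (1/s)))"
    using gs_norm_wilson[OF s] by blast
  have "\<kappa> * (rho k / h) powr (1/s) = (\<kappa> * (1 / h) powr (1/s)) * rho k powr (1/s)" for k :: "(nat^'d) \<times> (int^'d)"
    using rho_scale[of s h k] s h by simp
  with C[OF h] have "\<exists>C>0. \<forall>k :: (nat^'d) \<times> (int^'d).
       gs_norm s h (wilson \<psi> k) \<le> ennreal (C * exp ((\<kappa> * (1 / h) powr (1/s)) * rho k powr (1/s)))"
    by (simp only:)
  moreover have "\<kappa> * (1 / h) powr (1/s) > 0" using \<kappa> h by simp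
  ultimately show ?thesis by blast
qed

lemma wilson_growth_any_rate:
  assumes s: "s > 1" and t: "t > 0"
  shows "\<exists>h>0. \<exists>C>0. \<forall>k :: (nat^'d::finite) \<times> (int^'d). gs_norm s h (wilson \<psi> k) \<le> ennreal (C * exp (t * rho k powr (1/s)))"
proof -
  obtain \<kappa> where \<kappa>: "\<kappa> > 0" and C: "\<And>h. h > 0 \<Longrightarrow> \<exists>C>0. \<forall>k :: (nat^'d) \<times> (int^'d). gs_norm s h (wilson \<psi> k) \<le> ennreal (C * exp (\<kappa> * (rho k / h) powr (1/s)))"
    using gs_norm_wilson[OF s] by blast
  \<comment> \<open>Chosen such that \<open>\<kappa> (1/h)^(1/s) = t\<close>.\<close>
  define h where "h = 1 / (t / \<kappa>) powr s"
  have h: "h > 0" using \<kappa> t by (simp add: h_def)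
  have "(1 / h) powr (1/s) = t / \<kappa>" using \<kappa> t s by (simp add: h_def powr_powr)
  then have "\<kappa> * (rho k / h) powr (1/s) = t * rho k powr (1/s)" for k :: "(nat^'d) \<times> (int^'d)"
    using rho_scale[of s h k] s h \<kappa> by simp
  then show ?thesis using C[OF h] h by (intro exI[of _ h]) simp
qed

lemma wilson_in_gs_step:
  assumes s: "s > 1" and h: "h > 0"
  shows "wilson \<psi> (k :: (nat^'d::finite) \<times> (int^'d)) \<in> gs_step s h"
proof -
  obtain t C where "gs_norm s h (wilson \<psi> k) \<le> ennreal (C * exp (t * rho k powr (1/s)))"
    using wilson_growth_some_rate[OF s h, where 'd = 'd] by blast
  then show ?thesis by (auto simp: gs_step_def smooth_wilson intro: le_less_trans)
qed

lemma gs_step_borel: "f \<in> gs_step s h \<Longrightarrow> f \<in> borel_measurable borel"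
  using smooth_continuous[of f "[]"] by (intro borel_measurable_continuous_onI) (simp add: gs_step_def)

lemma gs_step_bounded: "h > 0 \<Longrightarrow> f \<in> gs_step s h \<Longrightarrow> norm (f x) \<le> enn2real (gs_norm s h f)"
  using gs_norm_power_bound[of h s f x undefined 0] by (simp add: gs_step_def)

lemma integrable_wilson_gs_step: "h > 0 \<Longrightarrow> f \<in> gs_step s h \<Longrightarrow> integrable lborel (\<lambda>x. wilson \<psi> k x * f x)"
  by (rule integrable_wilson_mult[OF gs_step_borel gs_step_bounded])

lemma coef_add:
  assumes "h > 0" "f \<in> gs_step s h" "g \<in> gs_step s h"
  shows "coef (\<lambda>x. f x + g x) k = coef f k + coef g k"
  unfolding coef_def distrib_left
  by (rule Bochner_Integration.integral_add[OF integrable_wilson_gs_step[OF assms(1,2)] integrable_wilson_gs_step[OF assms(1,3)]])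

lemma coef_scale: "coef (\<lambda>x. b * f x) k = b * coef f k"
proof -
  have "coef (\<lambda>x. b * f x) k = (LINT x|lborel. b * (wilson \<psi> k x * f x))"
    unfolding coef_def by (simp only: mult.left_commute)
  then show ?thesis by (simp add: coef_def)
qed

context
  assumes onb: "orthonormal_basis_L2 (\<lambda>(l, n) x. complex_of_real (wilson1 \<psi> l n x))"
begin

lemma coef_wilson:
  "coef (wilson \<psi> j) k = (if j = k then 1 else 0)" for j k :: "(nat^'d::finite) \<times> (int^'d)"
proof -
  let ?e = "\<lambda>(l, n) x. complex_of_real (wilson1 \<psi> l n x)"
  have o: "(LINT x|lborel. of_real (wilson1 \<psi> l n x) * of_real (wilson1 \<psi> l' n' x)) = (if l = l' \<and> n = n' then 1 else (0::complex))" for l n l' n'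
  proof -
    have "(LINT x|lborel. ?e (l, n) x * cnj (?e (l', n') x)) = (if (l, n) = (l', n') then 1 else 0)"
      using onb unfolding orthonormal_basis_L2_def by blast
    then show ?thesis by simp
  qed
  have i: "integrable lborel (\<lambda>x. of_real (wilson1 \<psi> l n x) * complex_of_real (wilson1 \<psi> l' n' x))" for l n l' n'
  proof -
    have [measurable]: "wilson1 \<psi> l n \<in> borel_measurable borel" for l n
      unfolding wilson1_deriv_0[symmetric] by (rule borel_measurable_continuous_onI[OF continuous_wd])
    show ?thesis
    proof (rule Bochner_Integration.integrable_bound)
      show "integrable lborel (\<lambda>x. (2 * K) * (2 * K) * exp (- c * \<bar>x - centre l n\<bar>))"
        by (intro integrable_mult_right integrable_exp_abs_shift c_pos)
      show "AE x in lborel. norm (of_real (wilson1 \<psi> l n x) * complex_of_real (wilson1 \<psi> l' n' x)) \<le> norm ((2 * K) * (2 * K) * exp (- c * \<bar>x - centre l n\<bar>))"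
      proof (rule AE_I2)
        fix x
        have "2 * K * exp (- c * \<bar>x - centre l' n'\<bar>) \<le> 2 * K * 1" using K_pos c_pos by (intro mult_left_mono) auto
        then have "\<bar>wilson1 \<psi> l' n' x\<bar> \<le> 2 * K" using wilson1_bound[of l' n' x] by linarith
        then have "\<bar>wilson1 \<psi> l n x\<bar> * \<bar>wilson1 \<psi> l' n' x\<bar> \<le> (2 * K * exp (- c * \<bar>x - centre l n\<bar>)) * (2 * K)"
          using K_pos by (intro mult_mono wilson1_bound) auto
        also have "\<dots> = (2 * K) * (2 * K) * exp (- c * \<bar>x - centre l n\<bar>)" by simp
        also have "\<dots> \<le> norm ((2 * K) * (2 * K) * exp (- c * \<bar>x - centre l n\<bar>))" by simp
        finally show "norm (of_real (wilson1 \<psi> l n x) * complex_of_real (wilson1 \<psi> l' n' x)) \<le> norm ((2 * K) * (2 * K) * exp (- c * \<bar>x - centre l n\<bar>))"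
          by (simp only: norm_mult norm_of_real)
      qed
    qed measurable
  qed
  have "coef (wilson \<psi> j) k = (LINT x|lborel. (\<Prod>i\<in>UNIV. of_real (wilson1 \<psi> (fst k $ i) (snd k $ i) (x $ i)) * complex_of_real (wilson1 \<psi> (fst j $ i) (snd j $ i) (x $ i))))"
    unfolding coef_def wilson_eq wilson1_deriv_0 by (simp add: prod.distrib)
  also have "\<dots> = (\<Prod>i\<in>UNIV. (LINT t|lborel. of_real (wilson1 \<psi> (fst k $ i) (snd k $ i) t) * complex_of_real (wilson1 \<psi> (fst j $ i) (snd j $ i) t)))"
    by (rule integral_tensor[of "\<lambda>i t. of_real (wilson1 \<psi> (fst k $ i) (snd k $ i) t) * complex_of_real (wilson1 \<psi> (fst j $ i) (snd j $ i) t)"]) (rule i)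
  also have "\<dots> = (\<Prod>i\<in>UNIV. if fst k $ i = fst j $ i \<and> snd k $ i = snd j $ i then 1 else 0)" unfolding o ..
  also have "\<dots> = (if j = k then 1 else 0)"
  proof (cases "j = k")
    case False
    then have "\<not> (\<forall>i. fst k $ i = fst j $ i \<and> snd k $ i = snd j $ i)" unfolding prod_eq_iff vec_eq_iff by metis
    then obtain i where "\<not> (fst k $ i = fst j $ i \<and> snd k $ i = snd j $ i)" by blast
    then show ?thesis using False by (intro trans[OF prod_zero]) auto
  qed simp
  finally show ?thesis .
qed

text \<open>If the coefficients decay faster than the norms of the basis functions grow, the series converges
absolutely in the norm, and its sum is continuous and rapidly decreasing with the same coefficients as \<open>\<phi>\<close>.
By completeness it equals \<open>\<phi>\<close>. The expansion is then differentiated term by term, and the norm of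
the remainder is at most a tail of a convergent series of numbers.\<close>

lemma wilson_expansion_test_function:
  fixes \<phi> :: "real^'d::finite \<Rightarrow> complex"
  assumes s: "s > 1" and h: "h > 0" and \<phi>: "\<phi> \<in> gs_step s h"
    and A1: "\<And>k. norm (coef \<phi> k) \<le> A1 * exp (- \<tau> * rho k powr (1/s))"
    and A2: "\<And>k :: (nat^'d) \<times> (int^'d). gs_norm s h (wilson \<psi> k) \<le> ennreal (A2 * exp (t * rho k powr (1/s)))"
    and t: "t < \<tau>" "A1 \<ge> 0" "A2 \<ge> 0"
  shows "((\<lambda>F. enn2real (gs_norm s h (\<lambda>x. \<phi> x - (\<Sum>k\<in>F. coef \<phi> k * wilson \<psi> k x)))) \<longlongrightarrow> 0) (finite_subsets_at_top UNIV)"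
    and "\<And>F. finite F \<Longrightarrow> (\<lambda>x. \<phi> x - (\<Sum>k\<in>F. coef \<phi> k * wilson \<psi> k x)) \<in> gs_step s h"
proof -
  \<comment> \<open>\<open>G k\<close> bounds the step norm of the \<open>k\<close>-th term, up to the weights.\<close>
  define G where "G k = A1 * A2 * exp (- (\<tau> - t) * rho k powr (1/s))" for k :: "(nat^'d) \<times> (int^'d)"
  have G0: "G k \<ge> 0" for k using t by (simp add: G_def)
  have Gs: "G summable_on UNIV"
    unfolding G_def[abs_def] using s t by (intro summable_on_cmult_right summable_exp_rho) auto
  let ?a = "coef \<phi>"
  have \<phi>': "smooth \<phi>" "gs_norm s h \<phi> < \<infinity>" using \<phi> by (auto simp: gs_step_def)
  have Wb: "norm (?a k) * norm (of_real (monomial \<alpha> x) * multi_deriv \<beta> (wilson \<psi> k) x) \<le> G k * gs_weight s h \<alpha> \<beta>" for k \<alpha> \<beta> x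
  proof -
    have fin: "gs_norm s h (wilson \<psi> k) < \<infinity>" using wilson_in_gs_step[OF s h, of k] by (simp add: gs_step_def)
    have "enn2real (gs_norm s h (wilson \<psi> k)) \<le> A2 * exp (t * rho k powr (1/s))"
      using A2[of k] t by (intro enn2real_leI) auto
    then have "norm (of_real (monomial \<alpha> x) * multi_deriv \<beta> (wilson \<psi> k) x) \<le> A2 * exp (t * rho k powr (1/s)) * gs_weight s h \<alpha> \<beta>"
      by (intro order_trans[OF gs_norm_bound[OF h fin] mult_right_mono]) (auto intro: less_imp_le gs_weight_pos h)
    then have "norm (?a k) * norm (of_real (monomial \<alpha> x) * multi_deriv \<beta> (wilson \<psi> k) x) \<le>
        (A1 * exp (- \<tau> * rho k powr (1/s))) * (A2 * exp (t * rho k powr (1/s)) * gs_weight s h \<alpha> \<beta>)"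
      using t by (intro mult_mono A1) auto
    also have "\<dots> = A1 * A2 * (exp (- \<tau> * rho k powr (1/s)) * exp (t * rho k powr (1/s))) * gs_weight s h \<alpha> \<beta>" by (simp add: mult_ac)
    also have "exp (- \<tau> * rho k powr (1/s)) * exp (t * rho k powr (1/s)) = exp (- (\<tau> - t) * rho k powr (1/s))"
      by (simp add: exp_add[symmetric] algebra_simps)
    finally show ?thesis by (simp add: G_def)
  qed
  \<comment> \<open>Derivatives of tensor products depend only on how often each coordinate occurs.\<close>
  have iw: "iter_deriv is (wilson \<psi> k) = multi_deriv (\<chi> i. count_list is i) (wilson \<psi> k)" for "is" and k :: "(nat^'d) \<times> (int^'d)"
  proof -
    obtain js where js: "\<And>i. count_list js i = (\<chi> i. count_list is i) $ i" "multi_deriv (\<chi> i. count_list is i) = iter_deriv js"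
      using multi_deriv_eq[of "\<chi> i. count_list is i"] by blast
    show ?thesis unfolding js(2) iter_deriv_wilson using js(1) by simp
  qed
  have m0: "monomial 0 x = 1" for x :: "real^'d" by (simp add: monomial_def)
  have Db: "norm (?a k * iter_deriv is (wilson \<psi> k) x) \<le> G k * gs_weight s h 0 (\<chi> i. count_list is i)" for k x and "is" :: "'d list"
    using Wb[of k 0 x "\<chi> i. count_list is i"] by (simp add: iw m0 norm_mult)
  have Gw: "(\<lambda>k. G k * w) summable_on UNIV" for w by (intro summable_on_cmult_left Gs)
  have nsum: "(\<lambda>k. norm (?a k * iter_deriv is (wilson \<psi> k) x)) summable_on UNIV" for x and "is" :: "'d list"
    by (rule summable_on_comparison_test[OF Gw]) (rule Db, rule norm_ge_zero)
  define S where "S x = (\<Sum>\<^sub>\<infinity>k. ?a k * wilson \<psi> k x)" for x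
  have S: "((\<lambda>k. ?a k * wilson \<psi> k x) has_sum S x) UNIV" for x
    unfolding S_def using nsum[of "[]" x] by (intro has_sum_infsum abs_summable_summable[of "\<lambda>k. ?a k * wilson \<psi> k x"]) simp
  have ul: "uniform_limit UNIV (\<lambda>F x. \<Sum>k\<in>F. ?a k * wilson \<psi> k x) S (finite_subsets_at_top UNIV)"
    unfolding S_def[abs_def]
    by (rule Weierstrass_m_test_general[OF _ Gw]) (use Db[of _ "[]"] in simp)
  have S_cont: "continuous_on UNIV S"
    by (rule uniform_limit_theorem[OF _ ul]) (auto intro!: always_eventually continuous_on_sum continuous_on_mult continuous_on_const continuous_wilson)
  define R where "R x = \<phi> x - S x" for x
  have R_zero: "R x = 0" for x
  proof (rule tensor_completeness[OF onb])
    show "continuous_on UNIV R"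
      unfolding R_def[abs_def] using smooth_continuous[OF \<phi>'(1), of "[]"] by (intro continuous_intros S_cont) simp
    let ?N = "enn2real (gs_norm s h \<phi>) + infsum G UNIV"
    have N0: "?N \<ge> 0" using G0 by (intro add_nonneg_nonneg infsum_nonneg) auto
    have mR: "\<bar>monomial \<alpha> x\<bar> * norm (R x) \<le> ?N * gs_weight s h \<alpha> 0" for \<alpha> x
    proof -
      have "\<bar>monomial \<alpha> x\<bar> * norm (S x) \<le> infsum G UNIV * gs_weight s h \<alpha> 0"
      proof -
        have "((\<lambda>k. of_real (monomial \<alpha> x) * (?a k * wilson \<psi> k x)) has_sum of_real (monomial \<alpha> x) * S x) UNIV"
          by (intro has_sum_cmult_right S)
        moreover have "((\<lambda>k. G k * gs_weight s h \<alpha> 0) has_sum infsum G UNIV * gs_weight s h \<alpha> 0) UNIV"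
          by (intro has_sum_cmult_left has_sum_infsum Gs)
        moreover have "norm (of_real (monomial \<alpha> x) * (?a k * wilson \<psi> k x)) \<le> G k * gs_weight s h \<alpha> 0" for k
          using Wb[of k \<alpha> x 0] by (simp add: multi_deriv_0 norm_mult mult_ac)
        ultimately have "norm (of_real (monomial \<alpha> x) * S x) \<le> infsum G UNIV * gs_weight s h \<alpha> 0"
          by (rule norm_infsum_le)
        then show ?thesis by (simp add: norm_mult)
      qed
      moreover have "\<bar>monomial \<alpha> x\<bar> * norm (\<phi> x) \<le> enn2real (gs_norm s h \<phi>) * gs_weight s h \<alpha> 0"
        using gs_norm_moment_bound[OF h \<phi>'(2), of \<alpha> x] by (simp add: norm_mult)
      moreover have "\<bar>monomial \<alpha> x\<bar> * norm (R x) \<le> \<bar>monomial \<alpha> x\<bar> * (norm (\<phi> x) + norm (S x))"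
        unfolding R_def by (intro mult_left_mono norm_triangle_ineq4) auto
      ultimately show ?thesis by (simp add: distrib_left distrib_right)
    qed
    define W where "W = ((max 1 h)\<^sup>2 * 2 powr s) ^ CARD('d)"
    have W0: "W \<ge> 0" by (simp add: W_def)
    show "norm (R x) \<le> (2 ^ CARD('d) * (?N * W)) * (\<Prod>i\<in>UNIV. 1 / (1 + (x $ i)\<^sup>2))" for x
    proof -
      \<comment> \<open>The monomial adapted to \<open>x\<close> that dominates the product of the \<open>1 + x\<^sub>i\<^sup>2\<close> up to \<open>2^d\<close>.\<close>
      define \<alpha> :: "nat^'d" where "\<alpha> = (\<chi> i. if \<bar>x $ i\<bar> \<ge> 1 then 2 else 0)"
      have "(\<Prod>i\<in>UNIV. 1 + (x $ i)\<^sup>2) \<le> (\<Prod>i\<in>UNIV. 2 * \<bar>x $ i ^ (\<alpha> $ i)\<bar>)"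
      proof (intro prod_mono conjI)
        fix i
        show "1 + (x $ i)\<^sup>2 \<le> 2 * \<bar>x $ i ^ (\<alpha> $ i)\<bar>"
          using abs_square_le_1[of "x $ i"] abs_square_less_1[of "x $ i"] by (auto simp: \<alpha>_def not_le)
      qed auto
      also have "\<dots> = 2 ^ CARD('d) * \<bar>monomial \<alpha> x\<bar>" unfolding prod.distrib monomial_def abs_prod by simp
      finally have p: "(\<Prod>i\<in>UNIV. 1 + (x $ i)\<^sup>2) \<le> 2 ^ CARD('d) * \<bar>monomial \<alpha> x\<bar>" .
      have "gs_weight s h \<alpha> 0 \<le> (\<Prod>i::'d\<in>UNIV. (max 1 h)\<^sup>2 * 2 powr s)"
        unfolding gs_weight_prod
      proof (intro prod_mono conjI)
        fix i :: 'd
        have "h\<^sup>2 \<le> (max 1 h)\<^sup>2" "1 \<le> (max 1 h)\<^sup>2" using h by (auto intro: power_mono)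
        moreover have "1 \<le> 2 powr s" using s by (intro ge_one_powr_ge_zero) auto
        ultimately have "h\<^sup>2 * 2 powr s \<le> (max 1 h)\<^sup>2 * 2 powr s" "1 * 1 \<le> (max 1 h)\<^sup>2 * 2 powr s"
          by (intro mult_right_mono mult_mono; simp)+
        then show "h ^ (\<alpha> $ i + (0::nat^'d) $ i) * (fact (\<alpha> $ i) * fact ((0::nat^'d) $ i)) powr s \<le> (max 1 h)\<^sup>2 * 2 powr s"
          by (simp add: \<alpha>_def)
      qed (use h in auto)
      then have w: "gs_weight s h \<alpha> 0 \<le> W" by (simp add: W_def)
      have "(\<Prod>i\<in>UNIV. 1 + (x $ i)\<^sup>2) * norm (R x) \<le> 2 ^ CARD('d) * \<bar>monomial \<alpha> x\<bar> * norm (R x)"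
        by (intro mult_right_mono p) auto
      also have "\<dots> \<le> 2 ^ CARD('d) * (?N * gs_weight s h \<alpha> 0)" using mR[of \<alpha> x] by (simp add: mult.assoc)
      also have "\<dots> \<le> 2 ^ CARD('d) * (?N * W)" using N0 by (intro mult_left_mono w) auto
      finally have "(\<Prod>i\<in>UNIV. 1 + (x $ i)\<^sup>2) * norm (R x) \<le> 2 ^ CARD('d) * (?N * W)" .
      moreover have "(\<Prod>i\<in>UNIV. 1 + (x $ i)\<^sup>2) > 0" by (intro prod_pos) (auto intro: add_pos_nonneg)
      ultimately show ?thesis by (simp add: prod_dividef field_simps)
    qed
    fix \<kappa> :: "'d \<Rightarrow> nat \<times> int"
    define j :: "(nat^'d) \<times> (int^'d)" where "j = (\<chi> i. fst (\<kappa> i), \<chi> i. snd (\<kappa> i))"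
    have we: "(\<Prod>i\<in>UNIV. (\<lambda>(l, n) x. complex_of_real (wilson1 \<psi> l n x)) (\<kappa> i) (x $ i)) = wilson \<psi> j x" for x
      unfolding wilson_eq wilson1_deriv_0 j_def by (simp add: case_prod_unfold)
    have [measurable]: "S \<in> borel_measurable borel" by (rule borel_measurable_continuous_onI[OF S_cont])
    have Sb: "norm (S x) \<le> infsum G UNIV" for x
    proof (rule norm_infsum_le[OF S has_sum_infsum[OF Gs]])
      show "norm (?a k * wilson \<psi> k x) \<le> G k" for k
        using Wb[of k 0 x 0] by (simp add: multi_deriv_0 norm_mult m0 gs_weight_def)
    qed
    have iS: "integrable lborel (\<lambda>x. wilson \<psi> j x * S x)" by (rule integrable_wilson_mult[OF _ Sb]) measurable
    \<comment> \<open>The coefficients of \<open>S\<close> are those of \<open>\<phi>\<close>: the series converges uniformly and \<open>\<psi>\<^sub>j\<close> is integrable.\<close>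
    have "norm ((LINT x|lborel. wilson \<psi> j x * S x) - ?a j) \<le> 0"
    proof (rule field_le_epsilon)
      fix \<epsilon> :: real assume e: "\<epsilon> > 0"
      define I where "I = (LINT x|lborel. norm (wilson \<psi> j x))"
      have I0: "I \<ge> 0" unfolding I_def by (intro integral_nonneg_AE) auto
      define d where "d = \<epsilon> / (I + 1)"
      have d: "d > 0" using e I0 by (simp add: d_def)
      have "\<forall>\<^sub>F F in finite_subsets_at_top UNIV. \<forall>x. dist (\<Sum>k\<in>F. ?a k * wilson \<psi> k x) (S x) < d"
        using ul d by (auto simp: uniform_limit_iff)
      then obtain F0 where F0: "finite F0" "\<And>F. finite F \<Longrightarrow> F0 \<subseteq> F \<Longrightarrow> \<forall>x. dist (\<Sum>k\<in>F. ?a k * wilson \<psi> k x) (S x) < d"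
        unfolding eventually_finite_subsets_at_top by auto
      define F where "F = insert j F0"
      have F: "finite F" "j \<in> F" "\<And>x. norm (S x - (\<Sum>k\<in>F. ?a k * wilson \<psi> k x)) \<le> d"
        using F0(1) F0(2)[of F] by (auto simp: F_def dist_norm norm_minus_commute intro: less_imp_le)
      have ij: "integrable lborel (\<lambda>x. wilson \<psi> j x * wilson \<psi> k x)" for k
        by (rule integrable_wilson_gs_step[OF h wilson_in_gs_step[OF s h]])
      have "(LINT x|lborel. wilson \<psi> j x * (\<Sum>k\<in>F. ?a k * wilson \<psi> k x)) = (LINT x|lborel. (\<Sum>k\<in>F. ?a k * (wilson \<psi> j x * wilson \<psi> k x)))"
        by (simp add: sum_distrib_left mult.left_commute)
      also have "\<dots> = (\<Sum>k\<in>F. ?a k * coef (wilson \<psi> k) j)" using ij by (simp add: coef_def)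
      also have "\<dots> = ?a j" using F by (simp add: coef_wilson if_distrib[of "\<lambda>z. _ * z"] sum.delta' cong: if_cong)
      finally have eq: "(LINT x|lborel. wilson \<psi> j x * (\<Sum>k\<in>F. ?a k * wilson \<psi> k x)) = ?a j" .
      have iF: "integrable lborel (\<lambda>x. wilson \<psi> j x * (\<Sum>k\<in>F. ?a k * wilson \<psi> k x))"
      proof -
        have "wilson \<psi> j x * (\<Sum>k\<in>F. ?a k * wilson \<psi> k x) = (\<Sum>k\<in>F. ?a k * (wilson \<psi> j x * wilson \<psi> k x))" for x
          by (simp add: sum_distrib_left mult.left_commute)
        then show ?thesis by (simp only:) (intro Bochner_Integration.integrable_sum integrable_mult_right ij)
      qed
      have "(LINT x|lborel. wilson \<psi> j x * S x) - ?a j = (LINT x|lborel. wilson \<psi> j x * (S x - (\<Sum>k\<in>F. ?a k * wilson \<psi> k x)))"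
        unfolding right_diff_distrib using eq Bochner_Integration.integral_diff[OF iS iF] by simp
      also have "norm \<dots> \<le> (LINT x|lborel. norm (wilson \<psi> j x) * d)"
      proof (rule Bochner_Integration.integral_norm_bound_integral)
        show "integrable lborel (\<lambda>x. wilson \<psi> j x * (S x - (\<Sum>k\<in>F. ?a k * wilson \<psi> k x)))"
          unfolding right_diff_distrib by (rule Bochner_Integration.integrable_diff[OF iS iF])
        show "norm (wilson \<psi> j x * (S x - (\<Sum>k\<in>F. ?a k * wilson \<psi> k x))) \<le> norm (wilson \<psi> j x) * d" for x
          unfolding norm_mult by (intro mult_left_mono F) auto
      qed (intro integrable_mult_left integrable_norm integrable_wilson)
      also have "\<dots> = I * d" by (simp add: I_def)
      also have "\<dots> \<le> \<epsilon>" using I0 e by (simp add: d_def field_simps)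
      finally show "norm ((LINT x|lborel. wilson \<psi> j x * S x) - ?a j) \<le> 0 + \<epsilon>" by simp
    qed
    then have "(LINT x|lborel. wilson \<psi> j x * S x) = ?a j" by simp
    then have "(LINT x|lborel. wilson \<psi> j x * R x) = 0"
      unfolding R_def right_diff_distrib
      using Bochner_Integration.integral_diff[OF integrable_wilson_gs_step[OF h \<phi>] iS, of j] by (simp add: coef_def)
    then show "(LINT x|lborel. (\<Prod>i\<in>UNIV. (\<lambda>(l, n) x. complex_of_real (wilson1 \<psi> l n x)) (\<kappa> i) (x $ i)) * R x) = 0"
      by (simp only: we)
  qed
  \<comment> \<open>The expansion holds pointwise for all derivatives.\<close>
  have deriv_sum: "((\<lambda>k. ?a k * iter_deriv is (wilson \<psi> k) x) has_sum iter_deriv is \<phi> x) UNIV" for "is" x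
  proof (induction "is" arbitrary: x)
    case Nil
    then show ?case using S[of x] R_zero[of x] by (simp add: R_def)
  next
    case (Cons i "is")
    have ld: "((\<lambda>t. iter_deriv is f (x + t *\<^sub>R axis i 1)) has_vector_derivative iter_deriv (i # is) f (x + t *\<^sub>R axis i 1)) (at t)"
      if f: "smooth f" for f :: "real^'d \<Rightarrow> complex" and t
    proof -
      have "((\<lambda>r. r - t) has_vector_derivative 1) (at t)" by (auto intro!: derivative_eq_intros)
      moreover have "((\<lambda>r. iter_deriv is f ((x + t *\<^sub>R axis i 1) + r *\<^sub>R axis i 1)) has_vector_derivative iter_deriv (i # is) f (x + t *\<^sub>R axis i 1)) (at (t - t))"
        using smooth_line_deriv[OF f, of "is" "x + t *\<^sub>R axis i 1" i] by simp
      ultimately have "((\<lambda>r. iter_deriv is f ((x + t *\<^sub>R axis i 1) + r *\<^sub>R axis i 1)) \<circ> (\<lambda>r. r - t) has_vector_derivative 1 *\<^sub>R iter_deriv (i # is) f (x + t *\<^sub>R axis i 1)) (at t)"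
        by (rule vector_diff_chain_at)
      then show ?thesis by (simp add: o_def algebra_simps)
    qed
    have "((\<lambda>k. ?a k * iter_deriv (i # is) (wilson \<psi> k) (x + 0 *\<^sub>R axis i 1)) has_sum iter_deriv (i # is) \<phi> (x + 0 *\<^sub>R axis i 1)) UNIV"
    proof (rule has_sum_vector_derivative[where b' = "\<lambda>k t. ?a k * iter_deriv (i # is) (wilson \<psi> k) (x + t *\<^sub>R axis i 1)"
          and b = "\<lambda>k t. ?a k * iter_deriv is (wilson \<psi> k) (x + t *\<^sub>R axis i 1)" and B = "\<lambda>t. iter_deriv is \<phi> (x + t *\<^sub>R axis i 1)"
          and M = "\<lambda>k. G k * gs_weight s h 0 (\<chi> j. count_list (i # is) j)"])
      show "((\<lambda>t. ?a k * iter_deriv is (wilson \<psi> k) (x + t *\<^sub>R axis i 1)) has_vector_derivative ?a k * iter_deriv (i # is) (wilson \<psi> k) (x + t *\<^sub>R axis i 1)) (at t)" for k t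
        by (rule has_vector_derivative_mult_right[OF ld[OF smooth_wilson]])
      show "norm (?a k * iter_deriv (i # is) (wilson \<psi> k) (x + t *\<^sub>R axis i 1)) \<le> G k * gs_weight s h 0 (\<chi> j. count_list (i # is) j)" for k t
        by (rule Db)
      show "((\<lambda>t. iter_deriv is \<phi> (x + t *\<^sub>R axis i 1)) has_vector_derivative iter_deriv (i # is) \<phi> (x + 0 *\<^sub>R axis i 1)) (at 0)"
        by (rule ld[OF \<phi>'(1)])
    qed (rule Gw, rule Cons.IH)
    then show ?case by simp
  qed
  have fin_sum: "smooth (\<lambda>x. \<Sum>k\<in>F. b k * wilson \<psi> k x) \<and> iter_deriv is (\<lambda>x. \<Sum>k\<in>F. b k * wilson \<psi> k x) = (\<lambda>x. \<Sum>k\<in>F. b k * iter_deriv is (wilson \<psi> k) x)"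
    if "finite F" for F "is" and b :: "(nat^'d) \<times> (int^'d) \<Rightarrow> complex"
    using that
  proof (induction F rule: finite_induct)
    case empty
    then show ?case by (simp add: iter_deriv_zero smooth_def)
  next
    case (insert k F)
    have 1: "smooth (\<lambda>x. b k * wilson \<psi> k x)" by (rule smooth_cmult[OF smooth_wilson])
    have 2: "smooth (\<lambda>x. \<Sum>k\<in>F. b k * wilson \<psi> k x)" using insert.IH by blast
    show ?case using insert.hyps insert.IH smooth_add[OF 1 2] iter_deriv_add[OF 1 2, of "is"] iter_deriv_cmult[OF smooth_wilson, of "is" "b k" k]
      by simp
  qed
  \<comment> \<open>The remainder after \<open>F\<close> is the sum over the complement of \<open>F\<close>, hence bounded by the tail of \<open>G\<close>.\<close>
  have rem: "smooth (\<lambda>x. \<phi> x - (\<Sum>k\<in>F. ?a k * wilson \<psi> k x))"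
     "gs_norm s h (\<lambda>x. \<phi> x - (\<Sum>k\<in>F. ?a k * wilson \<psi> k x)) \<le> ennreal (infsum G (UNIV - F))" if F: "finite F" for F
  proof -
    have neg: "(\<lambda>x. \<phi> x - (\<Sum>k\<in>F. ?a k * wilson \<psi> k x)) = (\<lambda>x. \<phi> x + (\<Sum>k\<in>F. (- ?a k) * wilson \<psi> k x))"
      by (simp add: sum_negf)
    have sm: "smooth (\<lambda>x. \<Sum>k\<in>F. (- ?a k) * wilson \<psi> k x)" using fin_sum[OF F, of "\<lambda>k. - ?a k"] by blast
    show "smooth (\<lambda>x. \<phi> x - (\<Sum>k\<in>F. ?a k * wilson \<psi> k x))" unfolding neg by (rule smooth_add[OF \<phi>'(1) sm])
    show "gs_norm s h (\<lambda>x. \<phi> x - (\<Sum>k\<in>F. ?a k * wilson \<psi> k x)) \<le> ennreal (infsum G (UNIV - F))"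
    proof (rule gs_norm_leI[OF h])
      fix \<alpha> \<beta> :: "nat^'d" and x
      obtain js where js: "multi_deriv \<beta> = iter_deriv js" using multi_deriv_eq by metis
      have "iter_deriv js (\<lambda>x. \<phi> x - (\<Sum>k\<in>F. ?a k * wilson \<psi> k x)) x = iter_deriv js \<phi> x + (\<Sum>k\<in>F. (- ?a k) * iter_deriv js (wilson \<psi> k) x)"
        unfolding neg iter_deriv_add[OF \<phi>'(1) sm] using fin_sum[OF F, of "\<lambda>k. - ?a k" js] by simp
      then have e: "multi_deriv \<beta> (\<lambda>x. \<phi> x - (\<Sum>k\<in>F. ?a k * wilson \<psi> k x)) x = iter_deriv js \<phi> x - (\<Sum>k\<in>F. ?a k * iter_deriv js (wilson \<psi> k) x)"
        by (simp add: js sum_negf)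
      have "((\<lambda>k. ?a k * iter_deriv js (wilson \<psi> k) x) has_sum (iter_deriv js \<phi> x - (\<Sum>k\<in>F. ?a k * iter_deriv js (wilson \<psi> k) x))) (UNIV - F)"
        by (rule has_sum_Diff[OF deriv_sum has_sum_finite[OF F]]) simp
      from has_sum_cmult_right[OF this, of "of_real (monomial \<alpha> x)"]
      have "((\<lambda>k. of_real (monomial \<alpha> x) * (?a k * iter_deriv js (wilson \<psi> k) x)) has_sum
          of_real (monomial \<alpha> x) * multi_deriv \<beta> (\<lambda>x. \<phi> x - (\<Sum>k\<in>F. ?a k * wilson \<psi> k x)) x) (UNIV - F)" by (simp only: e)
      moreover have "((\<lambda>k. G k * gs_weight s h \<alpha> \<beta>) has_sum infsum G (UNIV - F) * gs_weight s h \<alpha> \<beta>) (UNIV - F)"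
        by (intro has_sum_cmult_left has_sum_infsum summable_on_subset_banach[OF Gs]) auto
      moreover have "norm (of_real (monomial \<alpha> x) * (?a k * iter_deriv js (wilson \<psi> k) x)) \<le> G k * gs_weight s h \<alpha> \<beta>" for k
        using Wb[of k \<alpha> x \<beta>] by (simp add: js norm_mult mult_ac)
      ultimately show "norm (of_real (monomial \<alpha> x) * multi_deriv \<beta> (\<lambda>x. \<phi> x - (\<Sum>k\<in>F. ?a k * wilson \<psi> k x)) x) \<le> infsum G (UNIV - F) * gs_weight s h \<alpha> \<beta>"
        by (rule norm_infsum_le)
    qed
  qed
  show "(\<lambda>x. \<phi> x - (\<Sum>k\<in>F. coef \<phi> k * wilson \<psi> k x)) \<in> gs_step s h" if "finite F" for F
    using rem[OF that] by (auto simp: gs_step_def intro: le_less_trans)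
  have tail: "((\<lambda>F. infsum G (UNIV - F)) \<longlongrightarrow> 0) (finite_subsets_at_top UNIV)"
  proof -
    have "((\<lambda>F. infsum G UNIV - sum G F) \<longlongrightarrow> infsum G UNIV - infsum G UNIV) (finite_subsets_at_top UNIV)"
      by (intro tendsto_diff tendsto_const infsum_tendsto Gs)
    moreover have "\<forall>\<^sub>F F in finite_subsets_at_top UNIV. infsum G UNIV - sum G F = infsum G (UNIV - F)"
    proof (rule eventually_finite_subsets_at_top_weakI)
      fix F :: "((nat^'d) \<times> (int^'d)) set" assume F: "finite F" "F \<subseteq> UNIV"
      show "infsum G UNIV - sum G F = infsum G (UNIV - F)"
        using infsum_Diff[OF Gs summable_on_finite[OF F(1), of G] F(2)] F by simp
    qed
    ultimately show ?thesis by (simp add: tendsto_cong)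
  qed
  show "((\<lambda>F. enn2real (gs_norm s h (\<lambda>x. \<phi> x - (\<Sum>k\<in>F. coef \<phi> k * wilson \<psi> k x)))) \<longlongrightarrow> 0) (finite_subsets_at_top UNIV)"
  proof (rule tendsto_sandwich[OF _ _ tendsto_const tail])
    show "\<forall>\<^sub>F F in finite_subsets_at_top UNIV. enn2real (gs_norm s h (\<lambda>x. \<phi> x - (\<Sum>k\<in>F. coef \<phi> k * wilson \<psi> k x))) \<le> infsum G (UNIV - F)"
      by (rule eventually_finite_subsets_at_top_weakI) (auto intro!: enn2real_leI rem infsum_nonneg G0)
  qed simp
qed

end
end

section \<open>Wilson series in the dual\<close>

lemma roumieu_seminorm_space:
  "seminorm_space (gs_roumieu s)
     {p. seminorm_on (gs_roumieu s) p \<and> (\<forall>h>0. \<exists>C. \<forall>f\<in>gs_step s h. p f \<le> C * enn2real (gs_norm s h f))}"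
proof
  have "(\<lambda>f. 0) \<in> {p. seminorm_on (gs_roumieu s) p \<and> (\<forall>h>0. \<exists>C. \<forall>f\<in>gs_step s h. p f \<le> C * enn2real (gs_norm s h f))}"
    by (auto simp: seminorm_on_def intro!: exI[of _ 0])
  then show "{p. seminorm_on (gs_roumieu s) p \<and> (\<forall>h>0. \<exists>C. \<forall>f\<in>gs_step s h. p f \<le> C * enn2real (gs_norm s h f))} \<noteq> {}" by blast
  show "(\<lambda>x. 0) \<in> gs_roumieu s" using zero_in_gs_step[of s 1] by (auto simp: gs_roumieu_eq intro: bexI[of _ 1])
  show "(\<lambda>x. c * f x) \<in> gs_roumieu s" if "f \<in> gs_roumieu s" for f c
  proof -
    obtain h where "h > 0" "f \<in> gs_step s h" using \<open>f \<in> gs_roumieu s\<close> by (auto simp: gs_roumieu_eq)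
    then show ?thesis using gs_step_cmult[of h f s c] by (auto simp: gs_roumieu_eq)
  qed
qed (auto intro: gs_roumieu_add)

lemma beurling_seminorm_space:
  "seminorm_space (gs_beurling s) {(\<lambda>f. enn2real (gs_norm s h f)) | h. h > 0}"
proof
  show "seminorm_on (gs_beurling s) p" if "p \<in> {(\<lambda>f. enn2real (gs_norm s h f)) | h. h > 0}" for p
    using that by (auto intro!: seminorm_on_gs_norm simp: gs_beurling_eq)
  show "{(\<lambda>f. enn2real (gs_norm s h f)) | h. h > 0} \<noteq> {}" using zero_less_one by blast
  show "(\<lambda>x. 0) \<in> gs_beurling s" using zero_in_gs_step by (auto simp: gs_beurling_eq)
  show "(\<lambda>x. c * f x) \<in> gs_beurling s" if "f \<in> gs_beurling s" for f c
    using that by (auto simp: gs_beurling_eq intro!: gs_step_cmult)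
  show "(\<lambda>x. f x + g x) \<in> gs_beurling s" if "f \<in> gs_beurling s" "g \<in> gs_beurling s" for f g
    using that by (auto simp: gs_beurling_eq intro!: gs_step_add)
qed

context analytic_window begin

lemma weighted_summable_rho:
  "weighted_summable s h \<gamma> \<longleftrightarrow> (\<lambda>k. (norm (\<gamma> k))\<^sup>2 * exp (- 2 * h * rho k powr (1/s))) summable_on UNIV"
  unfolding weighted_summable_def rho_def by (simp add: case_prod_unfold)

text \<open>Weighted square summability and growth at most \<open>exp (h rho^(1/s))\<close> are equivalent up to an arbitrarily small
change of the rate. This loss does not matter where a bound is wanted for all \<open>h\<close> or for some \<open>h\<close>.\<close>

lemma weighted_summable_imp_bound:
  assumes "weighted_summable s h \<gamma>"
  shows "\<exists>C\<ge>0. \<forall>k. norm (\<gamma> k) \<le> C * exp (h * rho k powr (1/s))"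
proof -
  let ?f = "\<lambda>k. (norm (\<gamma> k))\<^sup>2 * exp (- 2 * h * rho k powr (1/s))"
  have f: "?f summable_on UNIV" using assms by (simp add: weighted_summable_rho)
  have "norm (\<gamma> k) \<le> sqrt (infsum ?f UNIV) * exp (h * rho k powr (1/s))" for k
  proof -
    have "sum ?f {k} \<le> infsum ?f UNIV" by (rule finite_sum_le_infsum[OF f]) auto
    moreover have "?f k = (norm (\<gamma> k) * exp (- h * rho k powr (1/s)))\<^sup>2"
      by (simp add: power_mult_distrib exp_double[symmetric] mult.assoc)
    ultimately have "(norm (\<gamma> k) * exp (- h * rho k powr (1/s)))\<^sup>2 \<le> infsum ?f UNIV" by simp
    then have "norm (\<gamma> k) * exp (- h * rho k powr (1/s)) \<le> sqrt (infsum ?f UNIV)" by (rule real_le_rsqrt)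
    then show ?thesis by (simp add: exp_minus field_simps)
  qed
  moreover have "sqrt (infsum ?f UNIV) \<ge> 0" by (intro real_sqrt_ge_zero infsum_nonneg) auto
  ultimately show ?thesis by blast
qed

lemma bound_imp_weighted_summable:
  assumes "s > 0" "t < h" and \<gamma>: "\<And>k. norm (\<gamma> k) \<le> C * exp (t * rho k powr (1/s))"
  shows "weighted_summable s h \<gamma>"
  unfolding weighted_summable_rho
proof (rule summable_on_comparison_test)
  show "(\<lambda>k. C\<^sup>2 * exp (- (2 * (h - t)) * rho k powr (1/s))) summable_on UNIV"
    using assms by (intro summable_on_cmult_right summable_exp_rho) auto
  fix k
  have "(norm (\<gamma> k))\<^sup>2 * exp (- 2 * h * rho k powr (1/s)) \<le> (C * exp (t * rho k powr (1/s)))\<^sup>2 * exp (- 2 * h * rho k powr (1/s))"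
    by (intro mult_right_mono power_mono \<gamma>) auto
  also have "\<dots> = C\<^sup>2 * exp (- (2 * (h - t)) * rho k powr (1/s))"
    by (simp add: power_mult_distrib exp_double[symmetric] exp_add[symmetric] algebra_simps)
  finally show "(norm (\<gamma> k))\<^sup>2 * exp (- 2 * h * rho k powr (1/s)) \<le> C\<^sup>2 * exp (- (2 * (h - t)) * rho k powr (1/s))" .
qed auto

text \<open>A seminorm that dominates the series \<open>\<Sum>\<gamma>\<^sub>k \<langle>f,\<psi>\<^sub>k\<rangle>\<close>. The factor \<open>1 + rho k\<close> makes it dominate the tail over
\<open>rho k > r\<close> with the small constant \<open>1 / (1 + r)\<close>, so that tails are uniformly small on every set on which
the seminorm is bounded.\<close>

definition weighted_coef_sum :: "((nat^'d::finite) \<times> (int^'d) \<Rightarrow> complex) \<Rightarrow> (real^'d \<Rightarrow> complex) \<Rightarrow> real" where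
  "weighted_coef_sum \<gamma> f = (\<Sum>\<^sub>\<infinity>k. (1 + rho k) * norm (\<gamma> k) * norm (coef f k))"

abbreviation coef_summable :: "((nat^'d::finite) \<times> (int^'d) \<Rightarrow> complex) \<Rightarrow> (real^'d \<Rightarrow> complex) \<Rightarrow> bool" where
  "coef_summable \<gamma> f \<equiv> (\<lambda>k. (1 + rho k) * norm (\<gamma> k) * norm (coef f k)) summable_on UNIV"

lemma coef_term_nonneg: "0 \<le> (1 + rho k) * norm (\<gamma> k) * norm (coef f k)"
  using rho_nonneg[of k] by simp

lemma weighted_coef_sum_bound:
  fixes \<gamma> :: "(nat^'d::finite) \<times> (int^'d) \<Rightarrow> complex"
  assumes s: "s > 0" and t: "t < \<tau>" and C: "C \<ge> 0" "D' \<ge> 0"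
    and \<gamma>: "\<And>k. norm (\<gamma> k) \<le> C * exp (t * rho k powr (1/s))"
    and f: "\<And>k. norm (coef f k) \<le> D' * exp (- \<tau> * rho k powr (1/s))"
  shows "coef_summable \<gamma> f"
    and "weighted_coef_sum \<gamma> f \<le> C * D' * (\<Sum>\<^sub>\<infinity>k :: (nat^'d) \<times> (int^'d). (1 + rho k) * exp (- (\<tau> - t) * rho k powr (1/s)))"
proof -
  have S: "(\<lambda>k :: (nat^'d) \<times> (int^'d). C * D' * ((1 + rho k) * exp (- (\<tau> - t) * rho k powr (1/s)))) summable_on UNIV"
    using s t by (intro summable_on_cmult_right summable_rho_exp) auto
  have le: "(1 + rho k) * norm (\<gamma> k) * norm (coef f k) \<le> C * D' * ((1 + rho k) * exp (- (\<tau> - t) * rho k powr (1/s)))" for k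
  proof -
    have "(1 + rho k) * norm (\<gamma> k) * norm (coef f k) \<le> (1 + rho k) * (C * exp (t * rho k powr (1/s))) * (D' * exp (- \<tau> * rho k powr (1/s)))"
      using rho_nonneg[of k] C by (intro mult_mono \<gamma> f) auto
    also have "\<dots> = C * D' * ((1 + rho k) * (exp (t * rho k powr (1/s)) * exp (- \<tau> * rho k powr (1/s))))" by (simp add: mult_ac)
    also have "exp (t * rho k powr (1/s)) * exp (- \<tau> * rho k powr (1/s)) = exp (- (\<tau> - t) * rho k powr (1/s))"
      by (simp add: exp_add[symmetric] algebra_simps)
    finally show ?thesis .
  qed
  have nn: "0 \<le> (1 + rho k) * norm (\<gamma> k) * norm (coef f k)" for k using rho_nonneg[of k] by simp
  show sm: "coef_summable \<gamma> f" by (rule summable_on_comparison_test[OF S le nn])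
  have "weighted_coef_sum \<gamma> f \<le> (\<Sum>\<^sub>\<infinity>k :: (nat^'d) \<times> (int^'d). C * D' * ((1 + rho k) * exp (- (\<tau> - t) * rho k powr (1/s))))"
    unfolding weighted_coef_sum_def by (rule infsum_mono[OF sm S le])
  also have "\<dots> = C * D' * (\<Sum>\<^sub>\<infinity>k :: (nat^'d) \<times> (int^'d). (1 + rho k) * exp (- (\<tau> - t) * rho k powr (1/s)))"
    by (rule infsum_cmult_right')
  finally show "weighted_coef_sum \<gamma> f \<le> C * D' * (\<Sum>\<^sub>\<infinity>k :: (nat^'d) \<times> (int^'d). (1 + rho k) * exp (- (\<tau> - t) * rho k powr (1/s)))" .
qed

lemma partial_coef_sum_le:
  assumes "coef_summable \<gamma> f" "finite F"
  shows "norm (\<Sum>k\<in>F. \<gamma> k * coef f k) \<le> weighted_coef_sum \<gamma> f"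
proof -
  have "norm (\<Sum>k\<in>F. \<gamma> k * coef f k) \<le> (\<Sum>k\<in>F. (1 + rho k) * norm (\<gamma> k) * norm (coef f k))"
  proof (rule sum_norm_le)
    fix k
    have "1 * (norm (\<gamma> k) * norm (coef f k)) \<le> (1 + rho k) * (norm (\<gamma> k) * norm (coef f k))"
      using rho_nonneg[of k] by (intro mult_right_mono) auto
    then show "norm (\<gamma> k * coef f k) \<le> (1 + rho k) * norm (\<gamma> k) * norm (coef f k)" by (simp add: norm_mult mult.assoc)
  qed
  also have "\<dots> \<le> weighted_coef_sum \<gamma> f"
    unfolding weighted_coef_sum_def by (intro finite_sum_le_infsum assms coef_term_nonneg) auto
  finally show ?thesis .
qed

lemma coef_series_has_sum:
  assumes "coef_summable \<gamma> f"
  shows "((\<lambda>k. \<gamma> k * coef f k) has_sum (\<Sum>\<^sub>\<infinity>k. \<gamma> k * coef f k)) UNIV"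
proof -
  have "(\<lambda>k. norm (\<gamma> k * coef f k)) summable_on UNIV"
  proof (rule summable_on_comparison_test[OF assms])
    fix k
    have "1 * (norm (\<gamma> k) * norm (coef f k)) \<le> (1 + rho k) * (norm (\<gamma> k) * norm (coef f k))"
      using rho_nonneg[of k] by (intro mult_right_mono) auto
    then show "norm (\<gamma> k * coef f k) \<le> (1 + rho k) * norm (\<gamma> k) * norm (coef f k)" by (simp add: norm_mult mult.assoc)
  qed auto
  then show ?thesis by (rule has_sum_infsum[OF abs_summable_summable])
qed

lemma coef_series_le:
  assumes "coef_summable \<gamma> f"
  shows "norm (\<Sum>\<^sub>\<infinity>k. \<gamma> k * coef f k) \<le> weighted_coef_sum \<gamma> f"
proof (rule tendsto_upperbound)
  show "((\<lambda>F. norm (\<Sum>k\<in>F. \<gamma> k * coef f k)) \<longlongrightarrow> norm (\<Sum>\<^sub>\<infinity>k. \<gamma> k * coef f k)) (finite_subsets_at_top UNIV)"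
    using coef_series_has_sum[OF assms] unfolding has_sum_def by (rule tendsto_norm)
  show "\<forall>\<^sub>F F in finite_subsets_at_top UNIV. norm (\<Sum>k\<in>F. \<gamma> k * coef f k) \<le> weighted_coef_sum \<gamma> f"
    by (rule eventually_finite_subsets_at_top_weakI) (rule partial_coef_sum_le[OF assms])
qed simp

lemma coef_series_tail:
  assumes "coef_summable \<gamma> f" and F: "finite F" and r: "r \<ge> 0" "{k. rho k \<le> r} \<subseteq> F"
  shows "norm ((\<Sum>k\<in>F. \<gamma> k * coef f k) - (\<Sum>\<^sub>\<infinity>k. \<gamma> k * coef f k)) \<le> weighted_coef_sum \<gamma> f / (1 + r)"
proof -
  let ?g = "\<lambda>k. (1 + rho k) * norm (\<gamma> k) * norm (coef f k)"
  have h: "((\<lambda>k. \<gamma> k * coef f k) has_sum ((\<Sum>\<^sub>\<infinity>k. \<gamma> k * coef f k) - (\<Sum>k\<in>F. \<gamma> k * coef f k))) (UNIV - F)"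
    by (rule has_sum_Diff[OF coef_series_has_sum[OF assms(1)] has_sum_finite[OF F]]) simp
  have gs: "?g summable_on (UNIV - F)" by (rule summable_on_subset_banach[OF assms(1)]) simp
  have "norm ((\<Sum>\<^sub>\<infinity>k. \<gamma> k * coef f k) - (\<Sum>k\<in>F. \<gamma> k * coef f k)) \<le> 1 / (1 + r) * infsum ?g (UNIV - F)"
  proof (rule norm_infsum_le[OF h has_sum_cmult_right[OF has_sum_infsum[OF gs]]])
    fix k assume "k \<in> UNIV - F"
    then have "\<not> rho k \<le> r" using r(2) by blast
    then have "r \<le> rho k" by simp
    then have "(1 + r) * (norm (\<gamma> k) * norm (coef f k)) \<le> (1 + rho k) * (norm (\<gamma> k) * norm (coef f k))"
      by (intro mult_right_mono) auto
    then show "norm (\<gamma> k * coef f k) \<le> 1 / (1 + r) * ?g k"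
      using r by (simp add: norm_mult field_simps)
  qed
  also have "\<dots> \<le> 1 / (1 + r) * weighted_coef_sum \<gamma> f"
    unfolding weighted_coef_sum_def using r
    by (intro mult_left_mono infsum_mono_neutral gs assms(1)) (auto simp: rho_nonneg intro!: mult_nonneg_nonneg add_nonneg_nonneg)
  finally show ?thesis by (simp add: norm_minus_commute)
qed

text \<open>In the Roumieu case this seminorm itself belongs to the family that generates the topology.\<close>

lemma seminorm_on_weighted_coef_sum:
  assumes sm: "\<And>f. f \<in> V \<Longrightarrow> coef_summable \<gamma> f"
    and add: "\<And>f g k. f \<in> V \<Longrightarrow> g \<in> V \<Longrightarrow> coef (\<lambda>x. f x + g x) k = coef f k + coef g k"
    and mem: "\<And>f g. f \<in> V \<Longrightarrow> g \<in> V \<Longrightarrow> (\<lambda>x. f x + g x) \<in> V"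
  shows "seminorm_on V (weighted_coef_sum \<gamma>)"
  unfolding seminorm_on_def
proof (intro conjI ballI allI)
  show "0 \<le> weighted_coef_sum \<gamma> f" for f
    unfolding weighted_coef_sum_def by (intro infsum_nonneg coef_term_nonneg)
  show "weighted_coef_sum \<gamma> (\<lambda>x. b * f x) = norm b * weighted_coef_sum \<gamma> f" for f b
    unfolding weighted_coef_sum_def coef_scale by (simp add: norm_mult infsum_cmult_right' mult.left_commute)
  fix f g assume fg: "f \<in> V" "g \<in> V"
  have "weighted_coef_sum \<gamma> (\<lambda>x. f x + g x) \<le> (\<Sum>\<^sub>\<infinity>k. (1 + rho k) * norm (\<gamma> k) * norm (coef f k) + (1 + rho k) * norm (\<gamma> k) * norm (coef g k))"
    unfolding weighted_coef_sum_def
  proof (rule infsum_mono[OF sm[OF mem[OF fg]] summable_on_add[OF sm[OF fg(1)] sm[OF fg(2)]]])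
    fix k
    have "(1 + rho k) * norm (\<gamma> k) * norm (coef f k + coef g k) \<le> (1 + rho k) * norm (\<gamma> k) * (norm (coef f k) + norm (coef g k))"
      using rho_nonneg[of k] by (intro mult_left_mono norm_triangle_ineq) auto
    then show "(1 + rho k) * norm (\<gamma> k) * norm (coef (\<lambda>x. f x + g x) k) \<le>
      (1 + rho k) * norm (\<gamma> k) * norm (coef f k) + (1 + rho k) * norm (\<gamma> k) * norm (coef g k)"
      unfolding add[OF fg] by (simp add: distrib_left)
  qed
  also have "\<dots> = weighted_coef_sum \<gamma> f + weighted_coef_sum \<gamma> g"
    unfolding weighted_coef_sum_def by (rule infsum_add[OF sm[OF fg(1)] sm[OF fg(2)]])
  finally show "weighted_coef_sum \<gamma> (\<lambda>x. f x + g x) \<le> weighted_coef_sum \<gamma> f + weighted_coef_sum \<gamma> g" .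
qed

text \<open>A continuous seminorm is bounded on bounded sets, and the tails of the series are small uniformly
there, by \<open>coef_series_tail\<close>. Hence the series converges in the strong topology.\<close>

lemma wilson_series_in_dual:
  fixes V :: "(real^'d::finite \<Rightarrow> complex) set"
  assumes sp: "seminorm_space V P"
    and add: "\<And>f g k. f \<in> V \<Longrightarrow> g \<in> V \<Longrightarrow> coef (\<lambda>x. f x + g x) k = coef f k + coef g k"
    and p: "p \<in> P" and sm: "\<And>f. f \<in> V \<Longrightarrow> coef_summable \<gamma> f"
    and le: "\<And>f. f \<in> V \<Longrightarrow> weighted_coef_sum \<gamma> f \<le> C * p f"
  defines "u \<equiv> \<lambda>f\<in>V. \<Sum>\<^sub>\<infinity>k. \<gamma> k * coef f k"
  shows "u \<in> dual_space (seminorm_topology V P)" "wilson_expansion (seminorm_topology V P) \<psi> \<gamma> u"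
proof -
  interpret seminorm_space V P by (rule sp)
  show u: "u \<in> dual_space T"
  proof (rule in_dualI[OF _ _ _ p])
    show "u \<in> extensional V" by (simp add: u_def)
    show "u (\<lambda>x. f x + g x) = u f + u g" if "f \<in> V" "g \<in> V" for f g
      using that has_sum_add[OF coef_series_has_sum[OF sm[OF that(1)]] coef_series_has_sum[OF sm[OF that(2)]]]
      by (simp add: u_def add_mem add infsumI distrib_left)
    show "u (\<lambda>x. b * f x) = b * u f" if "f \<in> V" for f b
      using that by (simp add: u_def scale_mem coef_scale infsum_cmult_right' mult.left_commute)
    show "norm (u f) \<le> C * p f" if "f \<in> V" for f
      using coef_series_le[OF sm[OF that]] le[OF that] that by (simp add: u_def)
  qed
  define v where "v F = (\<lambda>\<phi>\<in>topspace T. \<Sum>k\<in>F. \<gamma> k * as_functional T (wilson \<psi> k) \<phi>)" for F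
  have v_eq: "v F f = (\<Sum>k\<in>F. \<gamma> k * coef f k)" if "f \<in> V" for f F
    using that by (simp add: v_def topspace_eq as_functional_def coef_def)
  have "limitin (strong_dual T) v u (finite_subsets_at_top UNIV)"
  proof (rule strong_dual_limitin[OF u])
    show "v F \<in> dual_space T" for F
    proof (cases "finite F")
      case True
      show ?thesis
      proof (rule in_dualI[OF _ _ _ p])
        show "v F \<in> extensional V" by (simp add: v_def topspace_eq)
        show "v F (\<lambda>x. f x + g x) = v F f + v F g" if "f \<in> V" "g \<in> V" for f g
          using that by (simp add: v_eq add_mem add distrib_left sum.distrib)
        show "v F (\<lambda>x. b * f x) = b * v F f" if "f \<in> V" for f b
          using that by (simp add: v_eq scale_mem coef_scale sum_distrib_left mult.left_commute)
        show "norm (v F f) \<le> C * p f" if "f \<in> V" for f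
          using partial_coef_sum_le[OF sm[OF that] True] le[OF that] that by (simp add: v_eq)
      qed
    next
      \<comment> \<open>The sum over an infinite set is zero by convention.\<close>
      case False
      show ?thesis
      proof (rule in_dualI[OF _ _ _ p, where C = 0])
        show "v F \<in> extensional V" by (simp add: v_def topspace_eq)
      qed (use False in \<open>auto simp: v_eq add_mem scale_mem\<close>)
    qed
    fix B and e :: real assume B: "vn_bounded T B" "B \<noteq> {}" and e: "e > 0"
    obtain M where M: "\<And>f. f \<in> B \<Longrightarrow> p f \<le> M" using bounded_seminorm[OF B(1) p] by blast
    have BV: "B \<subseteq> V" using B(1) topspace_eq unfolding vn_bounded_def by blast
    \<comment> \<open>Beyond \<open>rho k > r\<close> the tail is at most \<open>|C| |M| / (1 + r) \<le> e\<close>, uniformly on \<open>B\<close>.\<close>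
    define r where "r = \<bar>C\<bar> * \<bar>M\<bar> / e"
    have r: "r \<ge> 0" using e by (simp add: r_def)
    have "\<forall>\<^sub>F F in finite_subsets_at_top UNIV. finite F \<and> {k :: (nat^'d) \<times> (int^'d). rho k \<le> r} \<subseteq> F"
      unfolding eventually_finite_subsets_at_top
      by (rule exI[of _ "{k. rho k \<le> r}"]) (use finite_rho_le in auto)
    then show "\<forall>\<^sub>F F in finite_subsets_at_top UNIV. \<forall>\<phi>\<in>B. norm (v F \<phi> - u \<phi>) \<le> e"
    proof eventually_elim
      case (elim F)
      show ?case
      proof
        fix f assume f: "f \<in> B"
        then have fV: "f \<in> V" using BV by blast
        have "C * p f \<le> \<bar>C\<bar> * \<bar>M\<bar>"
        proof -
          have "C * p f \<le> \<bar>C\<bar> * p f" using seminorm_nonneg[OF p fV] by (intro mult_right_mono) auto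
          also have "\<dots> \<le> \<bar>C\<bar> * \<bar>M\<bar>" using M[OF f] by (intro mult_left_mono) auto
          finally show ?thesis .
        qed
        have "norm (v F f - u f) \<le> weighted_coef_sum \<gamma> f / (1 + r)"
          using coef_series_tail[OF sm[OF fV], of F r] elim r fV by (simp add: v_eq u_def)
        also have "\<dots> \<le> (\<bar>C\<bar> * \<bar>M\<bar>) / (1 + r)"
          using le[OF fV] \<open>C * p f \<le> \<bar>C\<bar> * \<bar>M\<bar>\<close> r by (intro divide_right_mono) auto
        also have "\<dots> \<le> e"
        proof -
          have "\<bar>C\<bar> * \<bar>M\<bar> = e * r" using e by (simp add: r_def)
          also have "\<dots> \<le> e * (1 + r)" using e by simp
          finally show ?thesis using r by (simp add: pos_divide_le_eq)
        qed
        finally show "norm (v F f - u f) \<le> e" .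
      qed
    qed
  qed
  then show "wilson_expansion T \<psi> \<gamma> u" unfolding wilson_expansion_def v_def .
qed

text \<open>The basis functions are real, so the conjugation in the pairing disappears.\<close>

lemma pairing_wilson: "pairing f (wilson \<psi> k) = f (wilson \<psi> k)"
  by (simp add: pairing_def wilson_eq)

text \<open>Apply the functional to the expansion of a test function. It is enough that, for each \<open>\<phi>\<close>, the
functional is bounded by some norm in which the expansion of \<open>\<phi>\<close> converges; this norm may depend on \<open>\<phi>\<close>, as
it does in the Roumieu case.\<close>

lemma dual_element_eq_series:
  fixes V :: "(real^'d::finite \<Rightarrow> complex) set"
  assumes sp: "seminorm_space V P" and f: "f \<in> dual_space (seminorm_topology V P)"
    and W: "\<And>k. wilson \<psi> k \<in> V" and sm: "\<And>\<phi>. \<phi> \<in> V \<Longrightarrow> coef_summable (\<lambda>k. f (wilson \<psi> k)) \<phi>"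
    and approx: "\<And>\<phi>. \<phi> \<in> V \<Longrightarrow> \<exists>h>0. \<exists>C.
        (\<forall>F. finite F \<longrightarrow> norm (f (\<lambda>x. \<phi> x - (\<Sum>k\<in>F. coef \<phi> k * wilson \<psi> k x))) \<le>
           C * enn2real (gs_norm s h (\<lambda>x. \<phi> x - (\<Sum>k\<in>F. coef \<phi> k * wilson \<psi> k x)))) \<and>
        ((\<lambda>F. enn2real (gs_norm s h (\<lambda>x. \<phi> x - (\<Sum>k\<in>F. coef \<phi> k * wilson \<psi> k x)))) \<longlongrightarrow> 0) (finite_subsets_at_top UNIV)"
  shows "f = (\<lambda>\<phi>\<in>V. \<Sum>\<^sub>\<infinity>k. f (wilson \<psi> k) * coef \<phi> k)"
proof
  fix \<phi>
  interpret seminorm_space V P by (rule sp)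
  have fa: "f (\<lambda>x. g x + g' x) = f g + f g'" if "g \<in> V" "g' \<in> V" for g g' using f that unfolding dual_space_def topspace_eq by blast
  have fs: "f (\<lambda>x. b * g x) = b * f g" if "g \<in> V" for g b using f that unfolding dual_space_def topspace_eq by blast
  have fe: "f \<in> extensional V" using f unfolding dual_space_def topspace_eq by blast
  show "f \<phi> = (\<lambda>\<phi>\<in>V. \<Sum>\<^sub>\<infinity>k. f (wilson \<psi> k) * coef \<phi> k) \<phi>"
  proof (cases "\<phi> \<in> V")
    case True
    let ?r = "\<lambda>F x. \<phi> x - (\<Sum>k\<in>F. coef \<phi> k * wilson \<psi> k x)"
    have lin: "?r F \<in> V \<and> f (?r F) = f \<phi> - (\<Sum>k\<in>F. f (wilson \<psi> k) * coef \<phi> k)" if "finite F" for F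
      using that
    proof (induction F rule: finite_induct)
      case empty
      then show ?case using True by simp
    next
      case (insert k F)
      have m: "(\<lambda>x. (- coef \<phi> k) * wilson \<psi> k x) \<in> V" by (rule scale_mem[OF W])
      have "(\<lambda>x. \<phi> x - (\<Sum>k\<in>insert k F. coef \<phi> k * wilson \<psi> k x)) = (\<lambda>x. ?r F x + (- coef \<phi> k) * wilson \<psi> k x)"
        using insert.hyps by (auto simp: algebra_simps)
      note eq = this
      have fm: "f (?r (insert k F)) = f (?r F) + (- coef \<phi> k) * f (wilson \<psi> k)"
        unfolding eq fa[OF conjunct1[OF insert.IH] m] fs[OF W] ..
      have "?r (insert k F) \<in> V" unfolding eq by (rule add_mem[OF conjunct1[OF insert.IH] m])
      moreover have "f (?r (insert k F)) = f \<phi> - (\<Sum>k\<in>insert k F. f (wilson \<psi> k) * coef \<phi> k)"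
      proof -
        have "f (?r (insert k F)) = (f \<phi> - (\<Sum>k\<in>F. f (wilson \<psi> k) * coef \<phi> k)) + (- coef \<phi> k) * f (wilson \<psi> k)"
          using fm conjunct2[OF insert.IH] by (simp only:)
        also have "\<dots> = f \<phi> - (\<Sum>k\<in>insert k F. f (wilson \<psi> k) * coef \<phi> k)"
          using insert.hyps by (simp add: algebra_simps)
        finally show ?thesis .
      qed
      ultimately show ?case by blast
    qed
    obtain h C where hC: "h > 0" "\<forall>F. finite F \<longrightarrow> norm (f (?r F)) \<le> C * enn2real (gs_norm s h (?r F))"
      "((\<lambda>F. enn2real (gs_norm s h (?r F))) \<longlongrightarrow> 0) (finite_subsets_at_top UNIV)"
      using approx[OF True] by blast
    have z: "((\<lambda>F. C * enn2real (gs_norm s h (?r F))) \<longlongrightarrow> 0) (finite_subsets_at_top UNIV)"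
      by (rule tendsto_mult_right_zero[OF hC(3)])
    have lim0: "((\<lambda>F. f \<phi> - (\<Sum>k\<in>F. f (wilson \<psi> k) * coef \<phi> k)) \<longlongrightarrow> 0) (finite_subsets_at_top UNIV)"
    proof (rule Lim_null_comparison[OF _ z], rule eventually_finite_subsets_at_top_weakI)
      fix F :: "((nat^'d) \<times> (int^'d)) set" assume F: "finite F"
      have "norm (f (?r F)) \<le> C * enn2real (gs_norm s h (?r F))" using hC(2) F by blast
      then show "norm (f \<phi> - (\<Sum>k\<in>F. f (wilson \<psi> k) * coef \<phi> k)) \<le> C * enn2real (gs_norm s h (?r F))"
        by (simp only: conjunct2[OF lin[OF F]])
    qed
    have "((\<lambda>F. f \<phi> - (\<Sum>k\<in>F. f (wilson \<psi> k) * coef \<phi> k)) \<longlongrightarrow> f \<phi> - (\<Sum>\<^sub>\<infinity>k. f (wilson \<psi> k) * coef \<phi> k)) (finite_subsets_at_top UNIV)"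
      using coef_series_has_sum[OF sm[OF True]] unfolding has_sum_def by (intro tendsto_diff tendsto_const)
    then have "f \<phi> - (\<Sum>\<^sub>\<infinity>k. f (wilson \<psi> k) * coef \<phi> k) = 0"
      by (rule tendsto_unique[OF finite_subsets_at_top_neq_bot _ lim0])
    then show ?thesis using True by simp
  next
    case False
    then show ?thesis using fe by (simp add: extensional_def)
  qed
qed

context
  assumes onb: "orthonormal_basis_L2 (\<lambda>(l, n) x. complex_of_real (wilson1 \<psi> l n x))"
begin

text \<open>Test the expansion with \<open>\<psi>\<^sub>j\<close>.\<close>

lemma wilson_expansion_unique:
  fixes \<gamma> :: "(nat^'d::finite) \<times> (int^'d) \<Rightarrow> complex"
  assumes sp: "seminorm_space V P" and W: "\<And>k. wilson \<psi> k \<in> V"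
    and ex: "wilson_expansion (seminorm_topology V P) \<psi> \<gamma> f"
  shows "\<gamma> = (\<lambda>k. pairing f (wilson \<psi> k))"
proof
  fix j
  interpret seminorm_space V P by (rule sp)
  have "((\<lambda>F. (\<lambda>\<phi>\<in>topspace T. \<Sum>k\<in>F. \<gamma> k * as_functional T (wilson \<psi> k) \<phi>) (wilson \<psi> j)) \<longlongrightarrow> f (wilson \<psi> j)) (finite_subsets_at_top (UNIV :: ((nat^'d) \<times> (int^'d)) set))"
    using limitin_strong_dual_pointwise[OF ex[unfolded wilson_expansion_def] W] .
  moreover have "as_functional T (wilson \<psi> k) (wilson \<psi> j) = (if j = k then 1 else 0)" for k
    using coef_wilson[OF onb, of j k] W by (simp add: as_functional_def topspace_eq coef_def)
  ultimately have "((\<lambda>F. \<Sum>k\<in>F. \<gamma> k * (if j = k then 1 else 0)) \<longlongrightarrow> f (wilson \<psi> j)) (finite_subsets_at_top (UNIV :: ((nat^'d) \<times> (int^'d)) set))"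
    using W by (simp add: topspace_eq)
  \<comment> \<open>As soon as \<open>F\<close> contains \<open>j\<close>, orthonormality leaves the single term \<open>\<gamma> j\<close>.\<close>
  moreover have "\<forall>\<^sub>F F in finite_subsets_at_top (UNIV :: ((nat^'d) \<times> (int^'d)) set). (\<Sum>k\<in>F. \<gamma> k * (if j = k then 1 else 0)) = \<gamma> j"
    unfolding eventually_finite_subsets_at_top
    by (rule exI[of _ "{j}"]) (auto simp: if_distrib[of "\<lambda>z. _ * z"] sum.delta cong: if_cong)
  ultimately have "((\<lambda>F. \<gamma> j) \<longlongrightarrow> f (wilson \<psi> j)) (finite_subsets_at_top (UNIV :: ((nat^'d) \<times> (int^'d)) set))"
    by (simp add: tendsto_cong)
  then show "\<gamma> j = pairing f (wilson \<psi> j)" by (simp add: pairing_wilson tendsto_const_iff)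
qed

end
end

section \<open>Roumieu and Beurling ultradistributions\<close>

text \<open>A continuous functional is dominated by finitely many seminorms, and each of these is continuous on every
step: the functional is bounded in all norms.\<close>

lemma roumieu_dual_bound:
  assumes f: "f \<in> dual_space (roumieu_topology s)" and h: "h > 0"
  shows "\<exists>C\<ge>0. \<forall>\<phi>\<in>gs_step s h. norm (f \<phi>) \<le> C * enn2real (gs_norm s h \<phi>)"
proof -
  let ?P = "{p. seminorm_on (gs_roumieu s) p \<and> (\<forall>h>0. \<exists>C. \<forall>f\<in>gs_step s h. p f \<le> C * enn2real (gs_norm s h f))}"
  interpret seminorm_space "gs_roumieu s" ?P by (rule roumieu_seminorm_space)
  obtain Q C where Q: "finite Q" "Q \<subseteq> ?P" "C > 0" "\<forall>\<phi>\<in>gs_roumieu s. norm (f \<phi>) \<le> C * (\<Sum>p\<in>Q. p \<phi>)"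
    using dual_bound[OF f[unfolded roumieu_topology_def]] by blast
  have "\<forall>p\<in>Q. \<exists>M. \<forall>\<phi>\<in>gs_step s h. p \<phi> \<le> M * enn2real (gs_norm s h \<phi>)" using Q(2) h by blast
  then obtain M where M: "\<And>p \<phi>. p \<in> Q \<Longrightarrow> \<phi> \<in> gs_step s h \<Longrightarrow> p \<phi> \<le> M p * enn2real (gs_norm s h \<phi>)" by metis
  have "norm (f \<phi>) \<le> (C * (\<Sum>p\<in>Q. \<bar>M p\<bar>)) * enn2real (gs_norm s h \<phi>)" if \<phi>: "\<phi> \<in> gs_step s h" for \<phi>
  proof -
    have "\<phi> \<in> gs_roumieu s" using \<phi> h by (auto simp: gs_roumieu_eq)
    then have "norm (f \<phi>) \<le> C * (\<Sum>p\<in>Q. p \<phi>)" using Q(4) by blast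
    also have "(\<Sum>p\<in>Q. p \<phi>) \<le> (\<Sum>p\<in>Q. \<bar>M p\<bar> * enn2real (gs_norm s h \<phi>))"
    proof (rule sum_mono)
      fix p assume "p \<in> Q"
      then have "p \<phi> \<le> M p * enn2real (gs_norm s h \<phi>)" using M \<phi> by metis
      also have "\<dots> \<le> \<bar>M p\<bar> * enn2real (gs_norm s h \<phi>)" by (intro mult_right_mono) auto
      finally show "p \<phi> \<le> \<bar>M p\<bar> * enn2real (gs_norm s h \<phi>)" .
    qed
    finally show ?thesis using Q(3) by (simp add: sum_distrib_right mult.assoc)
  qed
  moreover have "C * (\<Sum>p\<in>Q. \<bar>M p\<bar>) \<ge> 0" using Q(3) by (intro mult_nonneg_nonneg sum_nonneg) auto
  ultimately show ?thesis by (intro exI[of _ "C * (\<Sum>p\<in>Q. \<bar>M p\<bar>)"] conjI ballI)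
qed

text \<open>The norms increase as \<open>h\<close> decreases, so a finite number of them is dominated by a single one.\<close>

lemma beurling_dual_bound:
  assumes f: "f \<in> dual_space (beurling_topology s)"
  shows "\<exists>h>0. \<exists>C\<ge>0. \<forall>\<phi>\<in>gs_beurling s. norm (f \<phi>) \<le> C * enn2real (gs_norm s h \<phi>)"
proof -
  let ?P = "{(\<lambda>f. enn2real (gs_norm s h f)) | h. h > 0}"
  interpret seminorm_space "gs_beurling s" ?P by (rule beurling_seminorm_space)
  obtain Q C where Q: "finite Q" "Q \<subseteq> ?P" "C > 0" "\<forall>\<phi>\<in>gs_beurling s. norm (f \<phi>) \<le> C * (\<Sum>p\<in>Q. p \<phi>)"
    using dual_bound[OF f[unfolded beurling_topology_def]] by blast
  have "\<exists>h>0. \<forall>p\<in>Q. \<forall>\<phi>\<in>gs_beurling s. p \<phi> \<le> enn2real (gs_norm s h \<phi>)"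
    using Q(1,2)
  proof (induction Q rule: finite_induct)
    case empty
    then show ?case using zero_less_one by blast
  next
    case (insert p Q)
    from insert.IH insert.prems obtain h1 where h1: "h1 > 0" "\<forall>p\<in>Q. \<forall>\<phi>\<in>gs_beurling s. p \<phi> \<le> enn2real (gs_norm s h1 \<phi>)"
      by auto
    from insert.prems obtain h2 where h2: "h2 > 0" "p = (\<lambda>f. enn2real (gs_norm s h2 f))" by auto
    note h = h1 h2
    have mono: "enn2real (gs_norm s h' \<phi>) \<le> enn2real (gs_norm s (min h1 h2) \<phi>)" if "min h1 h2 \<le> h'" "\<phi> \<in> gs_beurling s" for h' \<phi>
      using that h by (intro enn2real_mono gs_norm_antimono) (auto simp: gs_beurling_def)
    have "q \<phi> \<le> enn2real (gs_norm s (min h1 h2) \<phi>)" if "q \<in> insert p Q" "\<phi> \<in> gs_beurling s" for q \<phi>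
    proof (cases "q = p")
      case True
      then show ?thesis using mono[of h2 \<phi>] that(2) h2(2) by simp
    next
      case False
      then have "q \<phi> \<le> enn2real (gs_norm s h1 \<phi>)" using that h1(2) by blast
      then show ?thesis using mono[of h1 \<phi>] that(2) by simp
    qed
    moreover have "min h1 h2 > 0" using h by simp
    ultimately show ?case by (intro exI[of _ "min h1 h2"] conjI ballI)
  qed
  then obtain h where h: "h > 0" "\<forall>p\<in>Q. \<forall>\<phi>\<in>gs_beurling s. p \<phi> \<le> enn2real (gs_norm s h \<phi>)" by blast
  have "norm (f \<phi>) \<le> (C * real (card Q)) * enn2real (gs_norm s h \<phi>)" if \<phi>: "\<phi> \<in> gs_beurling s" for \<phi>
  proof -
    have "norm (f \<phi>) \<le> C * (\<Sum>p\<in>Q. p \<phi>)" using Q(4) \<phi> by blast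
    also have "(\<Sum>p\<in>Q. p \<phi>) \<le> (\<Sum>p\<in>Q. enn2real (gs_norm s h \<phi>))"
    proof (rule sum_mono)
      show "p \<phi> \<le> enn2real (gs_norm s h \<phi>)" if "p \<in> Q" for p using h(2) that \<phi> by blast
    qed
    finally show ?thesis using Q(3) by (simp add: mult.assoc)
  qed
  moreover have "C * real (card Q) \<ge> 0" using Q(3) by simp
  ultimately show ?thesis using h(1)
    by (intro exI[of _ h] exI[of _ "C * real (card Q)"] conjI ballI)
qed

context analytic_window begin

lemma growth_via_norm:
  assumes le: "\<And>\<phi>. \<phi> \<in> V \<Longrightarrow> norm (f \<phi>) \<le> C * enn2real (gs_norm s h \<phi>)" and C: "C \<ge> 0"
    and W: "\<And>k :: (nat^'d::finite) \<times> (int^'d). wilson \<psi> k \<in> V"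
    and g: "\<And>k :: (nat^'d) \<times> (int^'d). gs_norm s h (wilson \<psi> k) \<le> ennreal (C' * exp (t * rho k powr (1/s)))" and C': "C' \<ge> 0"
  shows "norm (f (wilson \<psi> k)) \<le> (C * C') * exp (t * rho k powr (1/s))"
proof -
  have "norm (f (wilson \<psi> k)) \<le> C * enn2real (gs_norm s h (wilson \<psi> k))" by (rule le[OF W])
  also have "\<dots> \<le> C * (C' * exp (t * rho k powr (1/s)))"
    using g[of k] C C' by (intro mult_left_mono enn2real_leI) auto
  finally show ?thesis by (simp add: mult.assoc)
qed

text \<open>Two functions from different steps lie in a common larger one.\<close>

lemma coef_add_roumieu:
  assumes "f \<in> gs_roumieu s" "g \<in> gs_roumieu s"
  shows "coef (\<lambda>x. f x + g x) k = coef f k + coef g k"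
proof -
  obtain h1 h2 where h: "h1 > 0" "h2 > 0" "f \<in> gs_step s h1" "g \<in> gs_step s h2" using assms by (auto simp: gs_roumieu_eq)
  then have "f \<in> gs_step s (max h1 h2)" "g \<in> gs_step s (max h1 h2)"
    using gs_step_mono[of h1 "max h1 h2" s] gs_step_mono[of h2 "max h1 h2" s] by auto
  then show ?thesis using h(1) by (intro coef_add[of "max h1 h2"]) auto
qed

lemma coef_add_beurling:
  assumes "f \<in> gs_beurling s" "g \<in> gs_beurling s"
  shows "coef (\<lambda>x. f x + g x) k = coef f k + coef g k"
  using assms by (intro coef_add[of 1]) (auto simp: gs_beurling_eq)

text \<open>The test function fixes a rate \<open>\<tau>\<close>; coefficients that grow slower than any rate grow slower than \<open>\<tau>/2\<close>.\<close>

lemma roumieu_coef_sum: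
  fixes \<gamma> :: "(nat^'d::finite) \<times> (int^'d) \<Rightarrow> complex"
  assumes s: "s > 1" and \<gamma>: "\<And>t. t > 0 \<Longrightarrow> \<exists>C\<ge>0. \<forall>k. norm (\<gamma> k) \<le> C * exp (t * rho k powr (1/s))" and h: "h > 0"
  shows "\<exists>C. \<forall>f\<in>gs_step s h. coef_summable \<gamma> f \<and> weighted_coef_sum \<gamma> f \<le> C * enn2real (gs_norm s h f)"
proof -
  obtain \<tau> C where C: "\<tau> > 0" "C > 0" "\<And>f (k :: (nat^'d) \<times> (int^'d)). f \<in> gs_step s h \<Longrightarrow>
     norm (coef f k) \<le> C * enn2real (gs_norm s h f) * exp (- \<tau> * rho k powr (1/s))"
    using coef_decay_some_rate[OF s h] by blast
  obtain C' where C': "C' \<ge> 0" "\<And>k. norm (\<gamma> k) \<le> C' * exp (\<tau> / 2 * rho k powr (1/s))"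
    using \<gamma>[of "\<tau> / 2"] C(1) by auto
  let ?S = "\<Sum>\<^sub>\<infinity>k :: (nat^'d) \<times> (int^'d). (1 + rho k) * exp (- (\<tau> - \<tau> / 2) * rho k powr (1/s))"
  have "coef_summable \<gamma> f \<and> weighted_coef_sum \<gamma> f \<le> (C' * C * ?S) * enn2real (gs_norm s h f)" if f: "f \<in> gs_step s h" for f
  proof -
    have a: "s > 0" "\<tau> / 2 < \<tau>" "C * enn2real (gs_norm s h f) \<ge> 0" using s C by auto
    show ?thesis
      using weighted_coef_sum_bound[OF a(1,2) C'(1) a(3) C'(2) C(3)[OF f]] by (simp add: mult_ac)
  qed
  then show ?thesis by blast
qed

text \<open>The coefficients fix a rate \<open>t\<close>; for a suitable \<open>h\<close> the test functions decay at a larger one.\<close>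

lemma beurling_coef_sum:
  fixes \<gamma> :: "(nat^'d::finite) \<times> (int^'d) \<Rightarrow> complex"
  assumes s: "s > 1" and C': "C' \<ge> 0" "\<And>k. norm (\<gamma> k) \<le> C' * exp (t * rho k powr (1/s))"
  shows "\<exists>h>0. \<exists>C. \<forall>f\<in>gs_step s h. coef_summable \<gamma> f \<and> weighted_coef_sum \<gamma> f \<le> C * enn2real (gs_norm s h f)"
proof -
  define \<tau> where "\<tau> = \<bar>t\<bar> + 1"
  have \<tau>: "\<tau> > 0" "t < \<tau>" by (auto simp: \<tau>_def)
  obtain h C where C: "h > 0" "C > 0" "\<And>f (k :: (nat^'d) \<times> (int^'d)). f \<in> gs_step s h \<Longrightarrow>
     norm (coef f k) \<le> C * enn2real (gs_norm s h f) * exp (- \<tau> * rho k powr (1/s))"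
    using coef_decay_any_rate[OF s \<tau>(1)] by blast
  let ?S = "\<Sum>\<^sub>\<infinity>k :: (nat^'d) \<times> (int^'d). (1 + rho k) * exp (- (\<tau> - t) * rho k powr (1/s))"
  have "coef_summable \<gamma> f \<and> weighted_coef_sum \<gamma> f \<le> (C' * C * ?S) * enn2real (gs_norm s h f)" if f: "f \<in> gs_step s h" for f
  proof -
    have a: "s > 0" "C * enn2real (gs_norm s h f) \<ge> 0" using s C by auto
    show ?thesis
      using weighted_coef_sum_bound[OF a(1) \<tau>(2) C'(1) a(2) C'(2) C(3)[OF f]] by (simp add: mult_ac)
  qed
  then show ?thesis using C(1) by blast
qed

lemma roumieu_series:
  fixes \<gamma> :: "(nat^'d::finite) \<times> (int^'d) \<Rightarrow> complex"
  assumes s: "s > 1" and \<gamma>: "\<And>t. t > 0 \<Longrightarrow> \<exists>C\<ge>0. \<forall>k. norm (\<gamma> k) \<le> C * exp (t * rho k powr (1/s))"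
  defines "u \<equiv> \<lambda>f\<in>gs_roumieu s. \<Sum>\<^sub>\<infinity>k. \<gamma> k * coef f k"
  shows "u \<in> dual_space (roumieu_topology s)" "wilson_expansion (roumieu_topology s) \<psi> \<gamma> u"
    and "\<And>f. f \<in> gs_roumieu s \<Longrightarrow> coef_summable \<gamma> f"
proof -
  show sm: "coef_summable \<gamma> f" if "f \<in> gs_roumieu s" for f
    using that roumieu_coef_sum[OF s \<gamma>] by (auto simp: gs_roumieu_eq)
  have sn: "seminorm_on (gs_roumieu s) (weighted_coef_sum \<gamma>)"
    by (rule seminorm_on_weighted_coef_sum[OF sm coef_add_roumieu gs_roumieu_add])
  have p: "weighted_coef_sum \<gamma> \<in> {p. seminorm_on (gs_roumieu s) p \<and> (\<forall>h>0. \<exists>C. \<forall>f\<in>gs_step s h. p f \<le> C * enn2real (gs_norm s h f))}"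
    using sn roumieu_coef_sum[OF s \<gamma>] by blast
  have le: "weighted_coef_sum \<gamma> f \<le> 1 * weighted_coef_sum \<gamma> f" for f by simp
  show "u \<in> dual_space (roumieu_topology s)"
    unfolding roumieu_topology_def u_def
    by (rule wilson_series_in_dual(1)[OF roumieu_seminorm_space coef_add_roumieu p sm le])
  show "wilson_expansion (roumieu_topology s) \<psi> \<gamma> u"
    unfolding roumieu_topology_def u_def
    by (rule wilson_series_in_dual(2)[OF roumieu_seminorm_space coef_add_roumieu p sm le])
qed

lemma beurling_series:
  fixes \<gamma> :: "(nat^'d::finite) \<times> (int^'d) \<Rightarrow> complex"
  assumes s: "s > 1" and \<gamma>: "C' \<ge> 0" "\<And>k. norm (\<gamma> k) \<le> C' * exp (t * rho k powr (1/s))"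
  defines "u \<equiv> \<lambda>f\<in>gs_beurling s. \<Sum>\<^sub>\<infinity>k. \<gamma> k * coef f k"
  shows "u \<in> dual_space (beurling_topology s)" "wilson_expansion (beurling_topology s) \<psi> \<gamma> u"
    and "\<And>f. f \<in> gs_beurling s \<Longrightarrow> coef_summable \<gamma> f"
proof -
  obtain h C where h: "h > 0" "\<And>f. f \<in> gs_step s h \<Longrightarrow> coef_summable \<gamma> f"
     "\<And>f. f \<in> gs_step s h \<Longrightarrow> weighted_coef_sum \<gamma> f \<le> C * enn2real (gs_norm s h f)"
    using beurling_coef_sum[OF s \<gamma>] by blast
  have sub: "f \<in> gs_step s h" if "f \<in> gs_beurling s" for f using that h(1) by (auto simp: gs_beurling_eq)
  show sm: "coef_summable \<gamma> f" if "f \<in> gs_beurling s" for f by (rule h(2)[OF sub[OF that]])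
  have p: "(\<lambda>f. enn2real (gs_norm s h f)) \<in> {(\<lambda>f. enn2real (gs_norm s h f)) | h. h > 0}" using h(1) by blast
  have le: "weighted_coef_sum \<gamma> f \<le> C * enn2real (gs_norm s h f)" if "f \<in> gs_beurling s" for f by (rule h(3)[OF sub[OF that]])
  show "u \<in> dual_space (beurling_topology s)"
    unfolding beurling_topology_def u_def
    by (rule wilson_series_in_dual(1)[OF beurling_seminorm_space coef_add_beurling p sm le])
  show "wilson_expansion (beurling_topology s) \<psi> \<gamma> u"
    unfolding beurling_topology_def u_def
    by (rule wilson_series_in_dual(2)[OF beurling_seminorm_space coef_add_beurling p sm le])
qed

context
  assumes onb: "orthonormal_basis_L2 (\<lambda>(l, n) x. complex_of_real (wilson1 \<psi> l n x))"
begin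

text \<open>A functional on the Roumieu space is bounded in all norms, so its values on the basis grow slower than any
rate. The basis expansion of each test function converges in a step that depends on it.\<close>

lemma roumieu_expansion:
  fixes f :: "(real^'d::finite \<Rightarrow> complex) \<Rightarrow> complex"
  assumes s: "s > 1" and f: "f \<in> dual_space (roumieu_topology s)"
  shows "wilson_expansion (roumieu_topology s) \<psi> (\<lambda>k. pairing f (wilson \<psi> k)) f"
    and "\<And>h. h > 0 \<Longrightarrow> weighted_summable s h (\<lambda>k. pairing f (wilson \<psi> k))"
proof -
  have W: "wilson \<psi> k \<in> gs_roumieu s" for k :: "(nat^'d) \<times> (int^'d)"
    using wilson_in_gs_step[OF s zero_less_one, of k] by (auto simp: gs_roumieu_eq intro: bexI[of _ 1])
  have growth: "\<exists>C\<ge>0. \<forall>k :: (nat^'d) \<times> (int^'d). norm (f (wilson \<psi> k)) \<le> C * exp (t * rho k powr (1/s))" if t: "t > 0" for t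
  proof -
    obtain h C' where h: "h > 0" "C' > 0" "\<And>k :: (nat^'d) \<times> (int^'d). gs_norm s h (wilson \<psi> k) \<le> ennreal (C' * exp (t * rho k powr (1/s)))"
      using wilson_growth_any_rate[OF s t, where 'd = 'd] by blast
    obtain C where C: "C \<ge> 0" "\<And>\<phi>. \<phi> \<in> gs_step s h \<Longrightarrow> norm (f \<phi>) \<le> C * enn2real (gs_norm s h \<phi>)"
      using roumieu_dual_bound[OF f h(1)] by blast
    have "norm (f (wilson \<psi> k)) \<le> (C * C') * exp (t * rho k powr (1/s))" for k :: "(nat^'d) \<times> (int^'d)"
      by (rule growth_via_norm[OF C(2) C(1) wilson_in_gs_step[OF s h(1)] h(3) less_imp_le[OF h(2)]])
    then show ?thesis using C(1) h(2) by (intro exI[of _ "C * C'"]) auto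
  qed
  show "weighted_summable s h (\<lambda>k. pairing f (wilson \<psi> k))" if h: "h > 0" for h
  proof -
    obtain C where "\<And>k :: (nat^'d) \<times> (int^'d). norm (f (wilson \<psi> k)) \<le> C * exp (h / 2 * rho k powr (1/s))"
      using growth[of "h / 2"] h by auto
    then show ?thesis using s h unfolding pairing_wilson by (intro bound_imp_weighted_summable[of s "h / 2" h]) auto
  qed
  note ser = roumieu_series[OF s growth]
  have "f = (\<lambda>\<phi>\<in>gs_roumieu s. \<Sum>\<^sub>\<infinity>k. f (wilson \<psi> k) * coef \<phi> k)"
  proof (rule dual_element_eq_series[OF roumieu_seminorm_space f[unfolded roumieu_topology_def] W ser(3)])
    fix \<phi> :: "real^'d \<Rightarrow> complex" assume "\<phi> \<in> gs_roumieu s"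
    then obtain h0 where h0: "h0 > 0" "\<phi> \<in> gs_step s h0" by (auto simp: gs_roumieu_eq)
    \<comment> \<open>The test function fixes a rate \<open>\<tau>\<close> of decay; a large \<open>h\<close> lets the basis grow only at rate \<open>\<tau>/2\<close>.\<close>
    obtain \<tau> C where C: "\<tau> > 0" "C > 0" "\<And>k :: (nat^'d) \<times> (int^'d). norm (coef \<phi> k) \<le> C * enn2real (gs_norm s h0 \<phi>) * exp (- \<tau> * rho k powr (1/s))"
      using coef_decay_some_rate[OF s h0(1)] h0(2) by blast
    have t: "\<tau> / 2 > 0" "\<tau> / 2 < \<tau>" using C by auto
    obtain h1 C' where h1: "h1 > 0" "C' > 0" "\<And>k :: (nat^'d) \<times> (int^'d). gs_norm s h1 (wilson \<psi> k) \<le> ennreal (C' * exp (\<tau> / 2 * rho k powr (1/s)))"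
      using wilson_growth_any_rate[OF s t(1), where 'd = 'd] by blast
    define h where "h = max h0 h1"
    have h: "h > 0" "\<phi> \<in> gs_step s h" using h0 gs_step_mono[of h0 h s] by (auto simp: h_def)
    have g: "gs_norm s h (wilson \<psi> k) \<le> ennreal (C' * exp (\<tau> / 2 * rho k powr (1/s)))" for k :: "(nat^'d) \<times> (int^'d)"
      by (rule order_trans[OF gs_norm_antimono h1(3)]) (use h1(1) in \<open>auto simp: h_def\<close>)
    have nn: "C * enn2real (gs_norm s h0 \<phi>) \<ge> 0" using C by simp
    note ex = wilson_expansion_test_function[OF onb s h C(3) g t(2) nn less_imp_le[OF h1(2)]]
    obtain M where M: "\<And>\<phi>. \<phi> \<in> gs_step s h \<Longrightarrow> norm (f \<phi>) \<le> M * enn2real (gs_norm s h \<phi>)"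
      using roumieu_dual_bound[OF f h(1)] by blast
    show "\<exists>h>0. \<exists>C. (\<forall>F. finite F \<longrightarrow> norm (f (\<lambda>x. \<phi> x - (\<Sum>k\<in>F. coef \<phi> k * wilson \<psi> k x))) \<le>
           C * enn2real (gs_norm s h (\<lambda>x. \<phi> x - (\<Sum>k\<in>F. coef \<phi> k * wilson \<psi> k x)))) \<and>
        ((\<lambda>F. enn2real (gs_norm s h (\<lambda>x. \<phi> x - (\<Sum>k\<in>F. coef \<phi> k * wilson \<psi> k x)))) \<longlongrightarrow> 0) (finite_subsets_at_top UNIV)"
    proof (rule exI[of _ h], intro conjI exI[of _ M] allI impI)
      show "norm (f (\<lambda>x. \<phi> x - (\<Sum>k\<in>F. coef \<phi> k * wilson \<psi> k x))) \<le>
           M * enn2real (gs_norm s h (\<lambda>x. \<phi> x - (\<Sum>k\<in>F. coef \<phi> k * wilson \<psi> k x)))" if "finite F" for F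
        by (rule M[OF ex(2)[OF that]])
    qed (rule h(1), rule ex(1))
  qed
  from this[symmetric] show "wilson_expansion (roumieu_topology s) \<psi> (\<lambda>k. pairing f (wilson \<psi> k)) f"
    using ser(2) unfolding pairing_wilson by (simp only:)
qed

text \<open>A functional on the Beurling space is bounded in one norm, so its values on the basis grow at some rate.
In that same norm the expansion of every test function converges.\<close>

lemma beurling_expansion:
  fixes f :: "(real^'d::finite \<Rightarrow> complex) \<Rightarrow> complex"
  assumes s: "s > 1" and f: "f \<in> dual_space (beurling_topology s)"
  shows "wilson_expansion (beurling_topology s) \<psi> (\<lambda>k. pairing f (wilson \<psi> k)) f"
    and "\<exists>h>0. weighted_summable s h (\<lambda>k. pairing f (wilson \<psi> k))"
proof -
  have W: "wilson \<psi> k \<in> gs_beurling s" for k :: "(nat^'d) \<times> (int^'d)"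
    using wilson_in_gs_step[OF s, of _ k] by (auto simp: gs_beurling_eq)
  obtain h M where h: "h > 0" and M: "M \<ge> 0" "\<And>\<phi>. \<phi> \<in> gs_beurling s \<Longrightarrow> norm (f \<phi>) \<le> M * enn2real (gs_norm s h \<phi>)"
    using beurling_dual_bound[OF f] by blast
  obtain t C' where t: "t > 0" and C': "C' > 0" "\<And>k :: (nat^'d) \<times> (int^'d). gs_norm s h (wilson \<psi> k) \<le> ennreal (C' * exp (t * rho k powr (1/s)))"
    using wilson_growth_some_rate[OF s h, where 'd = 'd] by blast
  have growth: "norm (f (wilson \<psi> k)) \<le> (M * C') * exp (t * rho k powr (1/s))" for k :: "(nat^'d) \<times> (int^'d)"
    by (rule growth_via_norm[OF M(2) M(1) W C'(2) less_imp_le[OF C'(1)]])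
  have "weighted_summable s (t + 1) (\<lambda>k. pairing f (wilson \<psi> k))"
    using s growth unfolding pairing_wilson by (intro bound_imp_weighted_summable[of s t "t + 1"]) auto
  then show "\<exists>h>0. weighted_summable s h (\<lambda>k. pairing f (wilson \<psi> k))" using t by (intro exI[of _ "t + 1"]) auto
  have MC: "M * C' \<ge> 0" using M C' by simp
  note ser = beurling_series[OF s MC growth]
  have "f = (\<lambda>\<phi>\<in>gs_beurling s. \<Sum>\<^sub>\<infinity>k. f (wilson \<psi> k) * coef \<phi> k)"
  proof (rule dual_element_eq_series[OF beurling_seminorm_space f[unfolded beurling_topology_def] W ser(3)])
    fix \<phi> :: "real^'d \<Rightarrow> complex" assume \<phi>: "\<phi> \<in> gs_beurling s"
    have t1: "t + 1 > 0" "t < t + 1" using t by auto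
    \<comment> \<open>The functional fixes the norm and hence the rate \<open>t\<close> of growth of the basis; the coefficients of
      \<open>\<phi>\<close> decay at the larger rate \<open>t + 1\<close>, as they do at any rate.\<close>
    obtain h0 C where C: "h0 > 0" "C > 0" "\<And>f (k :: (nat^'d) \<times> (int^'d)). f \<in> gs_step s h0 \<Longrightarrow> norm (coef f k) \<le> C * enn2real (gs_norm s h0 f) * exp (- (t + 1) * rho k powr (1/s))"
      using coef_decay_any_rate[OF s t1(1)] by blast
    have \<phi>h: "\<phi> \<in> gs_step s h0" "\<phi> \<in> gs_step s h" using \<phi> C(1) h by (auto simp: gs_beurling_eq)
    have nn: "C * enn2real (gs_norm s h0 \<phi>) \<ge> 0" using C by simp
    note ex = wilson_expansion_test_function[OF onb s h \<phi>h(2) C(3)[OF \<phi>h(1)] C'(2) t1(2) nn less_imp_le[OF C'(1)]]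
    have mem: "(\<lambda>x. \<phi> x - (\<Sum>k\<in>F. coef \<phi> k * wilson \<psi> k x)) \<in> gs_beurling s" if "finite F" for F
      using that
    proof (induction F rule: finite_induct)
      case empty
      then show ?case using \<phi> by simp
    next
      case (insert k F)
      interpret seminorm_space "gs_beurling s :: (real^'d \<Rightarrow> complex) set" "{(\<lambda>f. enn2real (gs_norm s h f)) | h. h > 0}" by (rule beurling_seminorm_space)
      have eq: "(\<lambda>x. \<phi> x - (\<Sum>k\<in>insert k F. coef \<phi> k * wilson \<psi> k x)) = (\<lambda>x. (\<phi> x - (\<Sum>k\<in>F. coef \<phi> k * wilson \<psi> k x)) + (- coef \<phi> k) * wilson \<psi> k x)"
        using insert.hyps by (auto simp: algebra_simps)
      show ?case unfolding eq by (rule add_mem[OF insert.IH scale_mem[OF W]])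
    qed
    show "\<exists>h>0. \<exists>C. (\<forall>F. finite F \<longrightarrow> norm (f (\<lambda>x. \<phi> x - (\<Sum>k\<in>F. coef \<phi> k * wilson \<psi> k x))) \<le>
           C * enn2real (gs_norm s h (\<lambda>x. \<phi> x - (\<Sum>k\<in>F. coef \<phi> k * wilson \<psi> k x)))) \<and>
        ((\<lambda>F. enn2real (gs_norm s h (\<lambda>x. \<phi> x - (\<Sum>k\<in>F. coef \<phi> k * wilson \<psi> k x)))) \<longlongrightarrow> 0) (finite_subsets_at_top UNIV)"
    proof (rule exI[of _ h], intro conjI exI[of _ M] allI impI)
      show "norm (f (\<lambda>x. \<phi> x - (\<Sum>k\<in>F. coef \<phi> k * wilson \<psi> k x))) \<le>
           M * enn2real (gs_norm s h (\<lambda>x. \<phi> x - (\<Sum>k\<in>F. coef \<phi> k * wilson \<psi> k x)))" if "finite F" for F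
        by (rule M(2)[OF mem[OF that]])
    qed (rule h, rule ex(1))
  qed
  from this[symmetric] show "wilson_expansion (beurling_topology s) \<psi> (\<lambda>k. pairing f (wilson \<psi> k)) f"
    using ser(2) unfolding pairing_wilson by (simp only:)
qed

end
end

theorem theorem3p3:
  fixes s :: real and \<psi> :: "real \<Rightarrow> real"
  assumes s: "s > 1"
    and wilson: "wilson_window \<psi>"
  shows
   "(\<forall>f \<in> dual_space (roumieu_topology s :: (real^'d::finite \<Rightarrow> complex) topology).
      wilson_expansion (roumieu_topology s) \<psi> (\<lambda>k. pairing f (wilson \<psi> k)) f \<and>
      (\<forall>c. wilson_expansion (roumieu_topology s) \<psi> c f \<longrightarrow> c = (\<lambda>k. pairing f (wilson \<psi> k))) \<and>
      (\<forall>h>0. weighted_summable s h (\<lambda>k. pairing f (wilson \<psi> k)))) \<and>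
    (\<forall>f \<in> dual_space (beurling_topology s :: (real^'d \<Rightarrow> complex) topology).
      wilson_expansion (beurling_topology s) \<psi> (\<lambda>k. pairing f (wilson \<psi> k)) f \<and>
      (\<forall>c. wilson_expansion (beurling_topology s) \<psi> c f \<longrightarrow> c = (\<lambda>k. pairing f (wilson \<psi> k))) \<and>
      (\<exists>h>0. weighted_summable s h (\<lambda>k. pairing f (wilson \<psi> k)))) \<and>
    (\<forall>c :: (nat^'d) \<times> (int^'d) \<Rightarrow> complex. (\<forall>h>0. weighted_summable s h c) \<longrightarrow>
      (\<exists>f \<in> dual_space (roumieu_topology s). wilson_expansion (roumieu_topology s) \<psi> c f)) \<and>
    (\<forall>c :: (nat^'d) \<times> (int^'d) \<Rightarrow> complex. (\<exists>h>0. weighted_summable s h c) \<longrightarrow>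
      (\<exists>f \<in> dual_space (beurling_topology s). wilson_expansion (beurling_topology s) \<psi> c f))"
proof -
  obtain a b C where abC: "a > 0" "b > 0" "\<And>x. \<bar>\<psi> x\<bar> \<le> C * exp (- a * \<bar>x\<bar>)"
      "\<And>\<xi>. norm (fourier (\<lambda>x. of_real (\<psi> x)) \<xi>) \<le> C * exp (- b * \<bar>\<xi>\<bar>)"
    and cont: "continuous_on UNIV \<psi>"
    and onb: "orthonormal_basis_L2 (\<lambda>(l, n) x. complex_of_real (wilson1 \<psi> l n x))"
    using wilson unfolding wilson_window_def by blast
  obtain D K A c where "analytic_window \<psi> D K A c"
    using window_derivatives[OF cont abC] unfolding analytic_window_def by metis
  then interpret analytic_window \<psi> D K A c .
  have W: "wilson \<psi> k \<in> gs_step s h" if "h > 0" for k :: "(nat^'d) \<times> (int^'d)" and h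
    by (rule wilson_in_gs_step[OF s that])
  have WR: "wilson \<psi> k \<in> gs_roumieu s" for k :: "(nat^'d) \<times> (int^'d)"
    using W[OF zero_less_one, of k] zero_less_one unfolding gs_roumieu_eq by blast
  have WB: "wilson \<psi> k \<in> gs_beurling s" for k :: "(nat^'d) \<times> (int^'d)"
    using W[of _ k] unfolding gs_beurling_eq by blast
  have uR: "c = (\<lambda>k. pairing f (wilson \<psi> k))" if "wilson_expansion (roumieu_topology s) \<psi> c f"
    for c and f :: "(real^'d \<Rightarrow> complex) \<Rightarrow> complex"
    by (rule wilson_expansion_unique[OF onb roumieu_seminorm_space WR that[unfolded roumieu_topology_def]])
  have uB: "c = (\<lambda>k. pairing f (wilson \<psi> k))" if "wilson_expansion (beurling_topology s) \<psi> c f"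
    for c and f :: "(real^'d \<Rightarrow> complex) \<Rightarrow> complex"
    by (rule wilson_expansion_unique[OF onb beurling_seminorm_space WB that[unfolded beurling_topology_def]])
  have bR: "\<exists>f\<in>dual_space (roumieu_topology s). wilson_expansion (roumieu_topology s) \<psi> c f"
    if "\<forall>h>0. weighted_summable s h c" for c :: "(nat^'d) \<times> (int^'d) \<Rightarrow> complex"
    using roumieu_series(1,2)[OF s weighted_summable_imp_bound, of c] that by blast
  have bB: "\<exists>f\<in>dual_space (beurling_topology s). wilson_expansion (beurling_topology s) \<psi> c f"
    if hc: "\<exists>h>0. weighted_summable s h c" for c :: "(nat^'d) \<times> (int^'d) \<Rightarrow> complex"
  proof -
    obtain h where "weighted_summable s h c" using hc by blast
    then obtain C where "C \<ge> 0" "\<And>k. norm (c k) \<le> C * exp (h * rho k powr (1/s))"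
      using weighted_summable_imp_bound by blast
    from beurling_series(1,2)[OF s this] show ?thesis by blast
  qed
  show ?thesis
  proof (intro conjI ballI allI impI)
    fix f :: "(real^'d \<Rightarrow> complex) \<Rightarrow> complex" assume f: "f \<in> dual_space (roumieu_topology s)"
    show "wilson_expansion (roumieu_topology s) \<psi> (\<lambda>k. pairing f (wilson \<psi> k)) f"
      by (rule roumieu_expansion(1)[OF onb s f])
    show "c = (\<lambda>k. pairing f (wilson \<psi> k))" if "wilson_expansion (roumieu_topology s) \<psi> c f" for c
      by (rule uR[OF that])
    show "weighted_summable s h (\<lambda>k. pairing f (wilson \<psi> k))" if "h > 0" for h
      by (rule roumieu_expansion(2)[OF onb s f that])
  next
    fix f :: "(real^'d \<Rightarrow> complex) \<Rightarrow> complex" assume f: "f \<in> dual_space (beurling_topology s)"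
    show "wilson_expansion (beurling_topology s) \<psi> (\<lambda>k. pairing f (wilson \<psi> k)) f"
      by (rule beurling_expansion(1)[OF onb s f])
    show "c = (\<lambda>k. pairing f (wilson \<psi> k))" if "wilson_expansion (beurling_topology s) \<psi> c f" for c
      by (rule uB[OF that])
    show "\<exists>h>0. weighted_summable s h (\<lambda>k. pairing f (wilson \<psi> k))"
      by (rule beurling_expansion(2)[OF onb s f])
  qed (rule bR, assumption, rule bB, assumption)
qed

end
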